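(* Let $G$ be a finite group and let $P$ be a collection of prime numbers. The primitive idempotents of $RU(G)_{(P)}$ all lie in the subrings $RO(G)_{(P)}$ and $R\mathbb{Q}(G) \otimes \mathbb{Z}_{(P)}$. Hence, they are precisely the primitive idempotents of these subrings.
   Context: $\mathbb{Z}_{(P)} := \mathbb{Z}[p^{-1} \mid p \text{ prime}, p \notin P]$. $RU(G)$, $RO(G)$ and $R\mathbb{Q}(G)$ are the representation rings of $G$ over the complex, real and rational numbers, respectively; $RU(G)_{(P)} := RU(G)\otimes \mathbb{Z}_{(P)}$ and $RO(G)_{(P)} := RO(G) \otimes \mathbb{Z}_{(P)}$. The rings $RO(G)_{(P)}$ and $R\mathbb{Q}(G)\otimes\mathbb{Z}_{(P)}$ are viewed as subrings of $RU(G)_{(P)}$ via extension of scalars (these maps are injective). An idempotent is primitive if it is non-zero and cannot be written as a sum of (two) non-zero idempotents. *)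

theory Defs
  imports
    "Jordan_Normal_Form.Matrix"
    "HOL-Algebra.QuotRing"
    "HOL-Algebra.Generated_Rings"
    "HOL-Algebra.Algebraic_Closure_Type"
    "HOL-Library.Poly_Mapping"
    "HOL-Computational_Algebra.Primes"
    Complex_Main
begin

hide_const (open) Divisibility.prime

section \<open>Rings presented by a monoid and relations\<close>

text \<open>The monoid ring $\mathbb{Z}[M]$: finite formal integer combinations of elements of \<open>M\<close>.\<close>

definition monoid_ring :: "('a, 'b) monoid_scheme \<Rightarrow> ('a \<Rightarrow>\<^sub>0 int) ring" where
  "monoid_ring M =
    \<lparr>carrier = {c. Poly_Mapping.keys c \<subseteq> carrier M},
     mult = (\<lambda>c d. frag_extend (\<lambda>x. frag_extend (\<lambda>y. frag_of (x \<otimes>\<^bsub>M\<^esub> y)) d) c),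
     one = frag_of \<one>\<^bsub>M\<^esub>,
     zero = 0,
     add = (+)\<rparr>"

definition presented_ring ::
    "('a, 'b) monoid_scheme \<Rightarrow> ('a \<Rightarrow>\<^sub>0 int) set \<Rightarrow> ('a \<Rightarrow>\<^sub>0 int) set ring" where
  "presented_ring M S = monoid_ring M Quot ((Idl\<^bsub>monoid_ring M\<^esub> S))"

text \<open>The map into \<open>presented_ring N S\<close> induced by \<open>f\<close> on generators. It is applied only to maps
  \<open>f\<close> that respect products and the relations, so that all the cosets in the union coincide.\<close>

definition presented_map ::
    "('c, 'd) monoid_scheme \<Rightarrow> ('c \<Rightarrow>\<^sub>0 int) set \<Rightarrow> ('a \<Rightarrow> 'c)
      \<Rightarrow> ('a \<Rightarrow>\<^sub>0 int) set \<Rightarrow> ('c \<Rightarrow>\<^sub>0 int) set" where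
  "presented_map N S f C =
    (\<Union>c\<in>C. (Idl\<^bsub>monoid_ring N\<^esub> S) +>\<^bsub>monoid_ring N\<^esub> frag_extend (\<lambda>x. frag_of (f x)) c)"

section \<open>Representation rings\<close>

text \<open>A representation of \<open>G\<close> over the field \<open>'k\<close> is a pair of a dimension \<open>n\<close> and a homomorphism
  $G \to GL_n$. Values of the homomorphism outside \<open>carrier G\<close> are irrelevant
  (\<open>rep_iso\<close> below ignores them). The zero representation, \<open>n = 0\<close>, is allowed.\<close>

type_synonym ('g, 'k) rep = "nat \<times> ('g \<Rightarrow> 'k mat)"

definition is_rep :: "('g, 'b) monoid_scheme \<Rightarrow> ('g, 'k::field) rep \<Rightarrow> bool" where
  "is_rep G V \<longleftrightarrow> snd V \<in> hom G (units_of (ring_mat TYPE('k) (fst V) ()))"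

definition rep_iso ::
    "('g, 'b) monoid_scheme \<Rightarrow> ('g, 'k::field) rep \<Rightarrow> ('g, 'k) rep \<Rightarrow> bool" where
  "rep_iso G V W \<longleftrightarrow> fst V = fst W \<and>
    (\<exists>T \<in> carrier_mat (fst V) (fst V). invertible_mat T \<and>
      (\<forall>g\<in>carrier G. T * snd V g = snd W g * T))"

definition rep_sum :: "('g, 'k::field) rep \<Rightarrow> ('g, 'k) rep \<Rightarrow> ('g, 'k) rep" where
  "rep_sum V W = (fst V + fst W,
    \<lambda>g. four_block_mat (snd V g) (0\<^sub>m (fst V) (fst W)) (0\<^sub>m (fst W) (fst V)) (snd W g))"

definition kronecker_mat :: "'a::times mat \<Rightarrow> 'a mat \<Rightarrow> 'a mat" where
  "kronecker_mat A B = mat (dim_row A * dim_row B) (dim_col A * dim_col B)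
    (\<lambda>(i, j). A $$ (i div dim_row B, j div dim_col B) * B $$ (i mod dim_row B, j mod dim_col B))"

definition rep_tensor :: "('g, 'k::field) rep \<Rightarrow> ('g, 'k) rep \<Rightarrow> ('g, 'k) rep" where
  "rep_tensor V W = (fst V * fst W, \<lambda>g. kronecker_mat (snd V g) (snd W g))"

definition rep_monoid :: "('g, 'b) monoid_scheme \<Rightarrow> ('g, 'k::field) rep monoid" where
  "rep_monoid G = \<lparr>carrier = {V. is_rep G V}, mult = rep_tensor, one = (1, \<lambda>_. 1\<^sub>m 1)\<rparr>"

definition rep_relations ::
    "('g, 'b) monoid_scheme \<Rightarrow> (('g, 'k::field) rep \<Rightarrow>\<^sub>0 int) set" where
  "rep_relations G =
    {frag_of V - frag_of W |V W. is_rep G V \<and> is_rep G W \<and> rep_iso G V W} \<union>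
    {frag_of (rep_sum V W) - frag_of V - frag_of W |V W. is_rep G V \<and> is_rep G W}"

text \<open>The representation ring: the Grothendieck group of isomorphism classes of finite-dimensional
  representations under direct sum, with multiplication induced by the tensor product.\<close>

definition rep_ring ::
    "('g, 'b) monoid_scheme \<Rightarrow> (('g, 'k::field) rep \<Rightarrow>\<^sub>0 int) set ring" where
  "rep_ring G = presented_ring (rep_monoid G) (rep_relations G)"

text \<open>Extension of scalars along a field homomorphism \<open>h\<close>: apply \<open>h\<close> to all matrix entries.\<close>

definition rep_ring_ext ::
    "('g, 'b) monoid_scheme \<Rightarrow> ('k::field \<Rightarrow> 'l::field) \<Rightarrow>
      (('g, 'k) rep \<Rightarrow>\<^sub>0 int) set \<Rightarrow> (('g, 'l) rep \<Rightarrow>\<^sub>0 int) set" where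
  "rep_ring_ext G h =
    presented_map (rep_monoid G) (rep_relations G) (\<lambda>V. (fst V, \<lambda>g. map_mat h (snd V g)))"

section \<open>Localization at a set of primes\<close>

definition Z_loc :: "nat set \<Rightarrow> rat ring" where
  "Z_loc P = (ring_of_type_algebra :: rat ring)
    \<lparr>carrier := generate_ring ring_of_type_algebra {inverse (of_nat p) |p. prime p \<and> p \<notin> P}\<rparr>"

text \<open>The tensor product $R \otimes_{\mathbb{Z}} A$ of commutative rings is
  $\mathbb{Z}[R \times A]$ modulo biadditivity, the generator \<open>(x, a)\<close> being the pure tensor
  $x \otimes a$; the product on generators is $(x \otimes a)(y \otimes b) = xy \otimes ab$.\<close>

definition tensor_relations ::
    "('a, 'b) ring_scheme \<Rightarrow> ('c, 'd) ring_scheme \<Rightarrow> ('a \<times> 'c \<Rightarrow>\<^sub>0 int) set" where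
  "tensor_relations R A =
    {frag_of (x \<oplus>\<^bsub>R\<^esub> y, a) - frag_of (x, a) - frag_of (y, a) |x y a.
       x \<in> carrier R \<and> y \<in> carrier R \<and> a \<in> carrier A} \<union>
    {frag_of (x, a \<oplus>\<^bsub>A\<^esub> b) - frag_of (x, a) - frag_of (x, b) |x a b.
       x \<in> carrier R \<and> a \<in> carrier A \<and> b \<in> carrier A}"

definition tensor_ring ::
    "('a, 'b) ring_scheme \<Rightarrow> ('c, 'd) ring_scheme \<Rightarrow> ('a \<times> 'c \<Rightarrow>\<^sub>0 int) set ring" where
  "tensor_ring R A = presented_ring (R \<times>\<times> A) (tensor_relations R A)"

text \<open>The map $f \otimes \mathrm{id}$ into $R \otimes A$ induced by a ring homomorphism \<open>f\<close> into \<open>R\<close>.\<close>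

definition tensor_map ::
    "('c, 'd) ring_scheme \<Rightarrow> ('e, 'f) ring_scheme \<Rightarrow> ('a \<Rightarrow> 'c) \<Rightarrow>
      ('a \<times> 'e \<Rightarrow>\<^sub>0 int) set \<Rightarrow> ('c \<times> 'e \<Rightarrow>\<^sub>0 int) set" where
  "tensor_map R A f = presented_map (R \<times>\<times> A) (tensor_relations R A) (\<lambda>(x, a). (f x, a))"

type_synonym ('g, 'k) loc_class = "((('g, 'k) rep \<Rightarrow>\<^sub>0 int) set \<times> rat \<Rightarrow>\<^sub>0 int) set"

definition rep_ring_loc ::
    "('g, 'b) monoid_scheme \<Rightarrow> nat set \<Rightarrow> ('g, 'k::field) loc_class ring" where
  "rep_ring_loc G P = tensor_ring (rep_ring G) (Z_loc P)"

definition rep_ring_loc_ext ::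
    "('g, 'b) monoid_scheme \<Rightarrow> nat set \<Rightarrow> ('k::field \<Rightarrow> 'l::field) \<Rightarrow>
      ('g, 'k) loc_class \<Rightarrow> ('g, 'l) loc_class" where
  "rep_ring_loc_ext G P h = tensor_map (rep_ring G) (Z_loc P) (rep_ring_ext G h)"

definition RU_loc :: "('g, 'b) monoid_scheme \<Rightarrow> nat set \<Rightarrow> ('g, complex) loc_class ring" where
  "RU_loc G P = rep_ring_loc G P"

definition RO_loc :: "('g, 'b) monoid_scheme \<Rightarrow> nat set \<Rightarrow> ('g, real) loc_class ring" where
  "RO_loc G P = rep_ring_loc G P"

definition RQ_loc :: "('g, 'b) monoid_scheme \<Rightarrow> nat set \<Rightarrow> ('g, rat) loc_class ring" where
  "RQ_loc G P = rep_ring_loc G P"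

text \<open>The real and rational rings, viewed as subrings of the complex one by extension of scalars.\<close>

definition RO_subring :: "('g, 'b) monoid_scheme \<Rightarrow> nat set \<Rightarrow> ('g, complex) loc_class set" where
  "RO_subring G P = rep_ring_loc_ext G P complex_of_real ` carrier (RO_loc G P)"

definition RQ_subring :: "('g, 'b) monoid_scheme \<Rightarrow> nat set \<Rightarrow> ('g, complex) loc_class set" where
  "RQ_subring G P = rep_ring_loc_ext G P of_rat ` carrier (RQ_loc G P)"

section \<open>Primitive idempotents\<close>

definition idempotents :: "('a, 'b) ring_scheme \<Rightarrow> 'a set" where
  "idempotents R = {e \<in> carrier R. e \<otimes>\<^bsub>R\<^esub> e = e}"

definition primitive_idempotents :: "('a, 'b) ring_scheme \<Rightarrow> 'a set" where
  "primitive_idempotents R =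
    {e \<in> idempotents R. e \<noteq> \<zero>\<^bsub>R\<^esub> \<and>
      \<not> (\<exists>e\<^sub>1 \<in> idempotents R - {\<zero>\<^bsub>R\<^esub>}. \<exists>e\<^sub>2 \<in> idempotents R - {\<zero>\<^bsub>R\<^esub>}. e = e\<^sub>1 \<oplus>\<^bsub>R\<^esub> e\<^sub>2)}"

end

theory Submission
  imports
    Defs
    "Jordan_Normal_Form.Column_Operations"
    "Jordan_Normal_Form.Schur_Decomposition"
    "HOL-Algebra.Sylow"
    "HOL-Number_Theory.Cong"
begin

text \<open>Let $e$ be an idempotent of $RU(G)_{(P)}$ and $f$ its character, a class function on $G$ with
values 0 and 1. Elements of $RU(G)_{(P)}$ are determined by their characters
(\<open>loc_character_injective\<close>), so $e$ comes from a subfield as soon as $f$ is a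
$\mathbb{Z}_{(P)}$-linear combination of products of characters that are realized over that
subfield. Permutation characters of coset spaces $G/H$ are realized over every field, and they
suffice.

There is an $m$ prime to $P$ such that $m f$ is the character of a virtual representation, so
$k \mapsto m f(g^k)$ is a signed sum of sequences $\lambda^k$ with $\lambda$ a root of unity. For
a prime $q$ this gives $m f(g^q) \equiv (m f(g))^q$ modulo $q$ among the rational integers. As $f$ takes only
the values 0 and 1, it follows that $f(g^q) = f(g)$ if $q$ does not divide $m$. Hence $f$ is
invariant under all power maps with exponent prime to $m$
(\<open>two_valued_exp_sum_invariant\<close>). This contains both the invariance of $f$ under the Galois
group and the fact that $f(g)$ does not depend on the $p$-part of $g$ for $p \in P$.

Now let $p$ be a prime that does not divide $m$, and let $f(x) \neq f(y)$. Replacing $x$ and $y$ by powers,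
one may assume that their orders are prime to $p$ and that the order of $x$ is at most that of
$y$. By the invariance of $f$ no conjugate of $y$ generates $\langle x \rangle$. Let
$H = \langle x \rangle Q$, where $Q$ is a Sylow $p$-subgroup of the normalizer of
$\langle x \rangle$. Then $x$ fixes a number of points of $G/H$ that is prime to $p$, and $y$ fixes none
(\<open>p_regular_separation\<close>). From such separating characters products and differences build the
function $r f$ for some integer $r$ prime to $p$ (\<open>multiple_in_ext_characters\<close>). The integers
$r$ for which $r f$ can be obtained form an ideal of $\mathbb{Z}$. It is not contained in $(p)$
for any $p \in P$, so it has a generator that is invertible in $\mathbb{Z}_{(P)}$, and $f$ itself
is obtained (\<open>idempotent_in_ext_image\<close>).

That characters determine elements reduces to the statement that complex representations with the
same character have the same class (\<open>same_character_same_class\<close>). Its proof avoids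
irreducible representations: averaging a matrix unit produces a nonzero intertwiner, its rank normal form makes the
two representations block triangular with a common diagonal block, averaging again splits this block off, and
induction on the dimension finishes the argument.

Since $RU(G)_{(P)}$ and the image of the ring over a subfield have the same idempotents, zero and
sums, they have the same primitive idempotents.\<close>

section \<open>Monoid rings and rings given by generators and relations\<close>

lemma frag_extend_fun_add:
  "frag_extend (\<lambda>x. f x + g x) c = frag_extend f c + frag_extend g c"
  by (simp add: frag_extend_def frag_cmul_distrib2 sum.distrib)

lemma frag_extend_fun_diff:
  "frag_extend (\<lambda>x. f x - g x) c = frag_extend f c - frag_extend g c"
  using frag_extend_fun_add[of "\<lambda>x. f x - g x" g c] by simp

lemma monoid_ring_simps [simp]:
  "carrier (monoid_ring M) = {c. Poly_Mapping.keys c \<subseteq> carrier M}"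
  "\<one>\<^bsub>monoid_ring M\<^esub> = frag_of \<one>\<^bsub>M\<^esub>" "\<zero>\<^bsub>monoid_ring M\<^esub> = 0"
  "a \<oplus>\<^bsub>monoid_ring M\<^esub> b = a + b"
  by (auto simp: monoid_ring_def)

lemma monoid_ring_mult_of [simp]:
  "frag_of x \<otimes>\<^bsub>monoid_ring M\<^esub> frag_of y = frag_of (x \<otimes>\<^bsub>M\<^esub> y)"
  by (simp add: monoid_ring_def)

lemma monoid_ring_distrib:
  "(a + b) \<otimes>\<^bsub>monoid_ring M\<^esub> c = a \<otimes>\<^bsub>monoid_ring M\<^esub> c + b \<otimes>\<^bsub>monoid_ring M\<^esub> c"
  "c \<otimes>\<^bsub>monoid_ring M\<^esub> (a + b) = c \<otimes>\<^bsub>monoid_ring M\<^esub> a + c \<otimes>\<^bsub>monoid_ring M\<^esub> b"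
  "(a - b) \<otimes>\<^bsub>monoid_ring M\<^esub> c = a \<otimes>\<^bsub>monoid_ring M\<^esub> c - b \<otimes>\<^bsub>monoid_ring M\<^esub> c"
  "c \<otimes>\<^bsub>monoid_ring M\<^esub> (a - b) = c \<otimes>\<^bsub>monoid_ring M\<^esub> a - c \<otimes>\<^bsub>monoid_ring M\<^esub> b"
  "0 \<otimes>\<^bsub>monoid_ring M\<^esub> c = 0" "c \<otimes>\<^bsub>monoid_ring M\<^esub> 0 = 0"
  by (simp_all add: monoid_ring_def frag_extend_add frag_extend_diff frag_extend_fun_add
      frag_extend_fun_diff frag_extend_eq_0)

lemma keys_add_subset: "Poly_Mapping.keys a \<subseteq> S \<Longrightarrow> Poly_Mapping.keys b \<subseteq> S \<Longrightarrow> Poly_Mapping.keys (a + b) \<subseteq> S"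
  using Poly_Mapping.keys_add[of a b] by blast

lemma keys_diff_subset: "Poly_Mapping.keys a \<subseteq> S \<Longrightarrow> Poly_Mapping.keys b \<subseteq> S \<Longrightarrow> Poly_Mapping.keys (a - b) \<subseteq> S"
  using Poly_Mapping.keys_diff[of a b] by blast

text \<open>Multiplication is biadditive, so the ring axioms need only be checked on generators, where they
are the monoid axioms.\<close>

lemma monoid_ring_is_ring:
  assumes "Group.monoid M"
  shows "ring (monoid_ring M)"
proof -
  interpret Group.monoid M by fact
  let ?R = "monoid_ring M"
  have closed: "Poly_Mapping.keys (a \<otimes>\<^bsub>?R\<^esub> b) \<subseteq> carrier M"
    if a: "Poly_Mapping.keys a \<subseteq> carrier M" and b: "Poly_Mapping.keys b \<subseteq> carrier M" for a b
    using a
  proof (induction a rule: frag_induction)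
    case (one x)
    show ?case using b
    proof (induction b rule: frag_induction)
      case (one y)
      then show ?case using \<open>x \<in> carrier M\<close> by simp
    next
      case (diff c d)
      then show ?case unfolding monoid_ring_distrib by (rule keys_diff_subset)
    qed (simp add: monoid_ring_distrib)
  next
    case (diff c d)
    then show ?case unfolding monoid_ring_distrib by (rule keys_diff_subset)
  qed (simp add: monoid_ring_distrib)
  have assoc: "(a \<otimes>\<^bsub>?R\<^esub> b) \<otimes>\<^bsub>?R\<^esub> c = a \<otimes>\<^bsub>?R\<^esub> (b \<otimes>\<^bsub>?R\<^esub> c)"
    if a: "Poly_Mapping.keys a \<subseteq> carrier M" and b: "Poly_Mapping.keys b \<subseteq> carrier M"
      and c: "Poly_Mapping.keys c \<subseteq> carrier M" for a b c
    using a
  proof (induction a rule: frag_induction)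
    case (one x)
    show ?case using b
    proof (induction b rule: frag_induction)
      case (one y)
      show ?case using c
      proof (induction c rule: frag_induction)
        case (one z) then show ?case using \<open>x \<in> carrier M\<close> \<open>y \<in> carrier M\<close> by (simp add: m_assoc)
      qed (simp_all add: monoid_ring_distrib)
    qed (simp_all add: monoid_ring_distrib)
  qed (simp_all add: monoid_ring_distrib)
  have l_one: "frag_of \<one>\<^bsub>M\<^esub> \<otimes>\<^bsub>?R\<^esub> c = c" and r_one: "c \<otimes>\<^bsub>?R\<^esub> frag_of \<one>\<^bsub>M\<^esub> = c"
    if c: "Poly_Mapping.keys c \<subseteq> carrier M" for c
    using c by (induction c rule: frag_induction) (simp_all add: monoid_ring_distrib)
  show ?thesis
  proof (rule ringI)
    show "abelian_group ?R"
    proof (rule abelian_groupI)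
      fix x assume "x \<in> carrier ?R"
      then show "\<exists>y\<in>carrier ?R. y \<oplus>\<^bsub>?R\<^esub> x = \<zero>\<^bsub>?R\<^esub>"
        by (intro bexI[of _ "- x"]) auto
    qed (simp_all add: keys_add_subset ac_simps)
    show "Group.monoid ?R"
      by (rule monoidI) (simp_all add: closed assoc l_one r_one)
  qed (simp_all add: monoid_ring_distrib)
qed

lemma monoid_ring_minus:
  assumes "Group.monoid M" "a \<in> carrier (monoid_ring M)"
  shows "\<ominus>\<^bsub>monoid_ring M\<^esub> a = - a"
proof -
  interpret ring "monoid_ring M" by (rule monoid_ring_is_ring) fact
  show ?thesis using assms by (intro minus_equality) auto
qed

locale ring_presentation =
  fixes M :: "('a, 'b) monoid_scheme" and S :: "('a \<Rightarrow>\<^sub>0 int) set"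
  assumes monoid: "Group.monoid M"
    and relations_closed: "S \<subseteq> carrier (monoid_ring M)"
begin

interpretation F: ring "monoid_ring M"
  by (rule monoid_ring_is_ring) (rule monoid)

interpretation I: ideal "Idl\<^bsub>monoid_ring M\<^esub> S" "monoid_ring M"
  by (rule F.genideal_ideal) (rule relations_closed)

lemma presented_is_ring: "ring (presented_ring M S)"
  unfolding presented_ring_def by (rule I.quotient_is_ring)

interpretation Q: ring "presented_ring M S"
  by (rule presented_is_ring)

definition cls :: "('a \<Rightarrow>\<^sub>0 int) \<Rightarrow> ('a \<Rightarrow>\<^sub>0 int) set" where
  "cls c = (Idl\<^bsub>monoid_ring M\<^esub> S) +>\<^bsub>monoid_ring M\<^esub> c"

definition gen :: "'a \<Rightarrow> ('a \<Rightarrow>\<^sub>0 int) set" where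
  "gen x = cls (frag_of x)"

lemma cls_hom: "cls \<in> ring_hom (monoid_ring M) (presented_ring M S)"
  using I.rcos_ring_hom unfolding presented_ring_def cls_def[abs_def] .

lemma cls_ring_hom: "ring_hom_ring (monoid_ring M) (presented_ring M S) cls"
  by (rule ring_hom_ringI2) (rule F.ring_axioms Q.ring_axioms cls_hom)+

lemmas cls_closed = ring_hom_closed[OF cls_hom]

lemma carrier_presented: "carrier (presented_ring M S) = cls ` carrier (monoid_ring M)"
  unfolding presented_ring_def FactRing_def A_RCOSETS_def RCOSETS_def cls_def a_r_coset_def
  by auto

lemma cls_add: "Poly_Mapping.keys a \<subseteq> carrier M \<Longrightarrow> Poly_Mapping.keys b \<subseteq> carrier M \<Longrightarrow>
    cls (a + b) = cls a \<oplus>\<^bsub>presented_ring M S\<^esub> cls b"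
  using ring_hom_add[OF cls_hom, of a b] by simp

lemma cls_minus: "Poly_Mapping.keys a \<subseteq> carrier M \<Longrightarrow> Poly_Mapping.keys b \<subseteq> carrier M \<Longrightarrow>
    cls (a - b) = cls a \<ominus>\<^bsub>presented_ring M S\<^esub> cls b"
proof -
  interpret cls: ring_hom_ring "monoid_ring M" "presented_ring M S" cls by (rule cls_ring_hom)
  assume "Poly_Mapping.keys a \<subseteq> carrier M" "Poly_Mapping.keys b \<subseteq> carrier M"
  then show ?thesis
    using ring_hom_add[OF cls_hom, of a "- b"] cls.hom_a_inv[of b] monoid_ring_minus[OF monoid, of b]
    by (simp add: a_minus_def)
qed

lemma cls_zero [simp]: "cls 0 = \<zero>\<^bsub>presented_ring M S\<^esub>"
  using ring_hom_zero[OF cls_hom F.ring_axioms Q.ring_axioms] by simp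

lemma gen_closed [simp]: "x \<in> carrier M \<Longrightarrow> gen x \<in> carrier (presented_ring M S)"
  unfolding gen_def by (rule cls_closed) simp

lemma cls_relation: "s \<in> S \<Longrightarrow> cls s = \<zero>\<^bsub>presented_ring M S\<^esub>"
proof -
  assume s: "s \<in> S"
  then have "s \<in> Idl\<^bsub>monoid_ring M\<^esub> S" using F.genideal_self[OF relations_closed] by auto
  then have "cls s = Idl\<^bsub>monoid_ring M\<^esub> S" unfolding cls_def by (rule I.a_rcos_const)
  then show ?thesis by (simp add: presented_ring_def FactRing_def)
qed

text \<open>Differences of generators exhaust the ring additively because products of generators are again
generators.\<close>

lemma presented_induct [consumes 1, case_names gen zero diff]:
  assumes z: "z \<in> carrier (presented_ring M S)"
    and gen: "\<And>x. x \<in> carrier M \<Longrightarrow> A (gen x)"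
    and zero: "A \<zero>\<^bsub>presented_ring M S\<^esub>"
    and diff: "\<And>a b. a \<in> carrier (presented_ring M S) \<Longrightarrow> b \<in> carrier (presented_ring M S) \<Longrightarrow>
      A a \<Longrightarrow> A b \<Longrightarrow> A (a \<ominus>\<^bsub>presented_ring M S\<^esub> b)"
  shows "A z"
proof -
  obtain c where c: "Poly_Mapping.keys c \<subseteq> carrier M" and zc: "z = cls c"
    using z unfolding carrier_presented by auto
  have "Poly_Mapping.keys c \<subseteq> carrier M \<and> A (cls c)" using c
  proof (induction c rule: frag_induction)
    case (diff a b)
    then show ?case
      by (auto simp: cls_minus keys_diff_subset intro!: assms(4) cls_closed)
  qed (use gen zero in \<open>auto simp: gen_def\<close>)
  then show ?thesis using zc by simp
qed

text \<open>The kernel of a ring homomorphism is an ideal; if it contains the relations, it contains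
the ideal that they generate. This is what makes maps out of a presented ring well defined.\<close>

lemma cls_eq_imp:
  assumes \<Phi>: "ring_hom_ring (monoid_ring M) R \<Phi>" and kills: "\<And>s. s \<in> S \<Longrightarrow> \<Phi> s = \<zero>\<^bsub>R\<^esub>"
    and c: "c \<in> carrier (monoid_ring M)" and d: "d \<in> cls c"
  shows "\<Phi> d = \<Phi> c" "d \<in> carrier (monoid_ring M)"
proof -
  interpret \<Phi>: ring_hom_ring "monoid_ring M" R \<Phi> by fact
  have "ideal (a_kernel (monoid_ring M) R \<Phi>) (monoid_ring M)" by (rule \<Phi>.kernel_is_ideal)
  moreover have "S \<subseteq> a_kernel (monoid_ring M) R \<Phi>"
    using kills relations_closed unfolding a_kernel_def' by blast
  ultimately have sub: "Idl\<^bsub>monoid_ring M\<^esub> S \<subseteq> a_kernel (monoid_ring M) R \<Phi>"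
    by (rule F.genideal_minimal)
  obtain i where i: "i \<in> Idl\<^bsub>monoid_ring M\<^esub> S" and di: "d = i \<oplus>\<^bsub>monoid_ring M\<^esub> c"
    using d unfolding cls_def a_r_coset_def' by blast
  have "i \<in> a_kernel (monoid_ring M) R \<Phi>" using sub i by blast
  then have ic: "i \<in> carrier (monoid_ring M)" "\<Phi> i = \<zero>\<^bsub>R\<^esub>"
    unfolding a_kernel_def' by blast+
  show "d \<in> carrier (monoid_ring M)" unfolding di by (rule F.add.m_closed[OF ic(1) c])
  have "\<Phi> d = \<Phi> i \<oplus>\<^bsub>R\<^esub> \<Phi> c" unfolding di by (rule \<Phi>.hom_add[OF ic(1) c])
  then show "\<Phi> d = \<Phi> c" using ic(2) \<Phi>.hom_closed[OF c] by simp
qed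

lemma cls_self: "c \<in> carrier (monoid_ring M) \<Longrightarrow> c \<in> cls c"
  unfolding cls_def by (rule I.a_rcos_self)

lemma factor_hom:
  assumes \<Phi>: "ring_hom_ring (monoid_ring M) R \<Phi>"
    and F: "\<And>c. c \<in> carrier (monoid_ring M) \<Longrightarrow> F (cls c) = \<Phi> c"
  shows "ring_hom_ring (presented_ring M S) R F"
proof -
  interpret \<Phi>: ring_hom_ring "monoid_ring M" R \<Phi> by fact
  show ?thesis
  proof (rule ring_hom_ringI)
    show "ring (presented_ring M S)" "ring R" by (rule Q.ring_axioms \<Phi>.S.ring_axioms)+
    fix x assume "x \<in> carrier (presented_ring M S)"
    then obtain c where c: "c \<in> carrier (monoid_ring M)" "x = cls c" unfolding carrier_presented by auto
    show "F x \<in> carrier R" unfolding c(2) F[OF c(1)] using c(1) by (rule \<Phi>.hom_closed)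
    fix y assume "y \<in> carrier (presented_ring M S)"
    then obtain d where d: "d \<in> carrier (monoid_ring M)" "y = cls d" unfolding carrier_presented by auto
    show "F (x \<otimes>\<^bsub>presented_ring M S\<^esub> y) = F x \<otimes>\<^bsub>R\<^esub> F y"
      unfolding c(2) d(2) F[OF c(1)] F[OF d(1)] ring_hom_mult[OF cls_hom c(1) d(1), symmetric]
        \<Phi>.hom_mult[OF c(1) d(1), symmetric] by (rule F) (rule F.m_closed[OF c(1) d(1)])
    show "F (x \<oplus>\<^bsub>presented_ring M S\<^esub> y) = F x \<oplus>\<^bsub>R\<^esub> F y"
      unfolding c(2) d(2) F[OF c(1)] F[OF d(1)] ring_hom_add[OF cls_hom c(1) d(1), symmetric]
        \<Phi>.hom_add[OF c(1) d(1), symmetric] by (rule F) (rule F.add.m_closed[OF c(1) d(1)])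
  next
    show "F \<one>\<^bsub>presented_ring M S\<^esub> = \<one>\<^bsub>R\<^esub>"
      using F[OF F.one_closed] by (simp only: ring_hom_one[OF cls_hom] \<Phi>.hom_one)
  qed
qed

end

lemma monoid_ring_hom_induced:
  assumes M: "Group.monoid M" and N: "Group.monoid N" and f: "f \<in> hom M N" "f \<one>\<^bsub>M\<^esub> = \<one>\<^bsub>N\<^esub>"
  shows "ring_hom_ring (monoid_ring M) (monoid_ring N) (frag_extend (\<lambda>x. frag_of (f x)))"
proof -
  let ?E = "frag_extend (\<lambda>x. frag_of (f x))"
  have mult: "?E (a \<otimes>\<^bsub>monoid_ring M\<^esub> b) = ?E a \<otimes>\<^bsub>monoid_ring N\<^esub> ?E b"
    if a: "Poly_Mapping.keys a \<subseteq> carrier M" and b: "Poly_Mapping.keys b \<subseteq> carrier M" for a b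
    using a
  proof (induction a rule: frag_induction)
    case (one x)
    show ?case using b
    proof (induction b rule: frag_induction)
      case (one y) then show ?case using \<open>x \<in> carrier M\<close> f by (simp add: hom_mult)
    qed (simp_all add: monoid_ring_distrib frag_extend_diff)
  qed (simp_all add: monoid_ring_distrib frag_extend_diff)
  show ?thesis
  proof (rule ring_hom_ringI)
    fix x assume "x \<in> carrier (monoid_ring M)"
    then show "?E x \<in> carrier (monoid_ring N)"
      using keys_frag_extend[of "\<lambda>x. frag_of (f x)" x] f(1)
      by (simp add: hom_def Pi_iff) blast
  qed (simp_all add: mult monoid_ring_is_ring[OF M] monoid_ring_is_ring[OF N] f(2) frag_extend_add)
qed

text \<open>A monoid homomorphism that respects the relations. Under these conditions the union of cosets
in the definition of the induced map is a union of equal cosets, and the induced map is a ring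
homomorphism.\<close>

locale presentation_map =
  M: ring_presentation M S + N: ring_presentation N T
  for M :: "('a, 'b) monoid_scheme" and S and N :: "('c, 'd) monoid_scheme" and T +
  fixes f :: "'a \<Rightarrow> 'c"
  assumes f_hom: "f \<in> hom M N" and f_one: "f \<one>\<^bsub>M\<^esub> = \<one>\<^bsub>N\<^esub>"
    and f_relations: "\<And>s. s \<in> S \<Longrightarrow> N.cls (frag_extend (\<lambda>x. frag_of (f x)) s) = \<zero>\<^bsub>presented_ring N T\<^esub>"
begin

lemma composite_hom:
  "ring_hom_ring (monoid_ring M) (presented_ring N T) (\<lambda>c. N.cls (frag_extend (\<lambda>x. frag_of (f x)) c))"
  using ring_hom_trans[OF ring_hom_ring.homh[OF monoid_ring_hom_induced[OF M.monoid N.monoid f_hom f_one]] N.cls_hom]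
  by (intro ring_hom_ringI2) (simp_all add: monoid_ring_is_ring[OF M.monoid] N.presented_is_ring comp_def)

lemma presented_map_cls:
  assumes c: "c \<in> carrier (monoid_ring M)"
  shows "presented_map N T f (M.cls c) = N.cls (frag_extend (\<lambda>x. frag_of (f x)) c)"
  unfolding presented_map_def N.cls_def[symmetric]
  using M.cls_eq_imp[OF composite_hom f_relations c] M.cls_self[OF c] by blast

lemma presented_map_gen: "x \<in> carrier M \<Longrightarrow> presented_map N T f (M.gen x) = N.gen (f x)"
  unfolding M.gen_def N.gen_def by (subst presented_map_cls) auto

lemma presented_map_hom:
  "ring_hom_ring (presented_ring M S) (presented_ring N T) (presented_map N T f)"
  using composite_hom presented_map_cls by (rule M.factor_hom)

end

text \<open>The additive extension of a function on generators with values in a commutative ring; it is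
the evaluation map of the universal property.\<close>

definition frag_eval :: "('a \<Rightarrow> 'r::comm_ring_1) \<Rightarrow> ('a \<Rightarrow>\<^sub>0 int) \<Rightarrow> 'r" where
  "frag_eval \<phi> c = (\<Sum>x\<in>Poly_Mapping.keys c. of_int (Poly_Mapping.lookup c x) * \<phi> x)"

lemma frag_eval_superset:
  "finite A \<Longrightarrow> Poly_Mapping.keys c \<subseteq> A \<Longrightarrow>
    frag_eval \<phi> c = (\<Sum>x\<in>A. of_int (Poly_Mapping.lookup c x) * \<phi> x)"
  unfolding frag_eval_def by (rule sum.mono_neutral_left) (auto simp: in_keys_iff)

lemma frag_eval_of [simp]: "frag_eval \<phi> (frag_of x) = \<phi> x"
  by (simp add: frag_eval_def)

lemma frag_eval_0 [simp]: "frag_eval \<phi> 0 = 0"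
  by (simp add: frag_eval_def)

lemma frag_eval_add: "frag_eval \<phi> (a + b) = frag_eval \<phi> a + frag_eval \<phi> b"
  using frag_eval_superset[of "Poly_Mapping.keys a \<union> Poly_Mapping.keys b" _ \<phi>] Poly_Mapping.keys_add[of a b]
  by (simp add: Poly_Mapping.lookup_add distrib_right sum.distrib)

lemma frag_eval_diff: "frag_eval \<phi> (a - b) = frag_eval \<phi> a - frag_eval \<phi> b"
  using frag_eval_add[of \<phi> "a - b" b] by simp

lemma frag_eval_hom:
  fixes \<phi> :: "'a \<Rightarrow> 'r::comm_ring_1"
  assumes M: "Group.monoid M" and mult: "\<And>x y. x \<in> carrier M \<Longrightarrow> y \<in> carrier M \<Longrightarrow> \<phi> (x \<otimes>\<^bsub>M\<^esub> y) = \<phi> x * \<phi> y"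
    and one: "\<phi> \<one>\<^bsub>M\<^esub> = 1"
  shows "ring_hom_ring (monoid_ring M) (ring_of_type_algebra :: 'r ring) (frag_eval \<phi>)"
proof -
  have mult': "frag_eval \<phi> (a \<otimes>\<^bsub>monoid_ring M\<^esub> b) = frag_eval \<phi> a * frag_eval \<phi> b"
    if a: "Poly_Mapping.keys a \<subseteq> carrier M" and b: "Poly_Mapping.keys b \<subseteq> carrier M" for a b
    using a
  proof (induction a rule: frag_induction)
    case (one x)
    show ?case using b
    proof (induction b rule: frag_induction)
      case (one y) then show ?case using \<open>x \<in> carrier M\<close> mult by simp
    qed (simp_all add: monoid_ring_distrib frag_eval_diff algebra_simps)
  qed (simp_all add: monoid_ring_distrib frag_eval_diff algebra_simps)
  show ?thesis
    by (rule ring_hom_ringI[OF monoid_ring_is_ring[OF M] ring_from_type_algebra])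
      (simp_all add: ring_of_type_algebra_def mult' frag_eval_add one)
qed

context ring_presentation begin

text \<open>The evaluation of a coset is the common value of its elements. It is well defined under the
hypotheses of \<open>lift_cls\<close>.\<close>

definition lift :: "('a \<Rightarrow> 'r::comm_ring_1) \<Rightarrow> ('a \<Rightarrow>\<^sub>0 int) set \<Rightarrow> 'r" where
  "lift \<phi> C = the_elem (frag_eval \<phi> ` C)"

context
  fixes \<phi> :: "'a \<Rightarrow> 'r::comm_ring_1"
  assumes mult: "\<And>x y. x \<in> carrier M \<Longrightarrow> y \<in> carrier M \<Longrightarrow> \<phi> (x \<otimes>\<^bsub>M\<^esub> y) = \<phi> x * \<phi> y"
    and one: "\<phi> \<one>\<^bsub>M\<^esub> = 1" and kills: "\<And>s. s \<in> S \<Longrightarrow> frag_eval \<phi> s = 0"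
begin

lemma lift_cls: "c \<in> carrier (monoid_ring M) \<Longrightarrow> lift \<phi> (cls c) = frag_eval \<phi> c"
proof -
  assume c: "c \<in> carrier (monoid_ring M)"
  have hom: "ring_hom_ring (monoid_ring M) (ring_of_type_algebra :: 'r ring) (frag_eval \<phi>)"
    by (rule frag_eval_hom) (rule monoid mult one | assumption)+
  have "frag_eval \<phi> d = frag_eval \<phi> c" if "d \<in> cls c" for d
    by (rule cls_eq_imp(1)[OF hom _ c that]) (simp add: kills ring_of_type_algebra_def)
  then have "frag_eval \<phi> ` cls c = (\<lambda>_. frag_eval \<phi> c) ` cls c" by (rule image_cong[OF refl])
  also have "\<dots> = {frag_eval \<phi> c}" using cls_self[OF c] by (rule image_constant)
  finally have "frag_eval \<phi> ` cls c = {frag_eval \<phi> c}" .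
  then show ?thesis by (simp add: lift_def)
qed

lemma lift_hom: "ring_hom_ring (presented_ring M S) (ring_of_type_algebra :: 'r ring) (lift \<phi>)"
proof (rule factor_hom)
  show "ring_hom_ring (monoid_ring M) (ring_of_type_algebra :: 'r ring) (frag_eval \<phi>)"
    by (rule frag_eval_hom) (rule monoid mult one | assumption)+
qed (rule lift_cls)

lemma lift_gen: "x \<in> carrier M \<Longrightarrow> lift \<phi> (gen x) = \<phi> x"
  unfolding gen_def by (subst lift_cls) auto

end
end

section \<open>The monoid of representations\<close>

text \<open>The index set of a Kronecker product is a product of index sets via division with remainder.\<close>

lemma sum_div_mod:
  fixes f :: "nat \<Rightarrow> nat \<Rightarrow> 'a::comm_monoid_add"
  shows "(\<Sum>k\<in>{0..<p * q}. f (k div q) (k mod q)) = (\<Sum>i\<in>{0..<p}. \<Sum>j\<in>{0..<q}. f i j)"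
proof (cases "q = 0")
  case False
  show ?thesis
  proof (induction p)
    case (Suc p)
    have "{0..<Suc p * q} = {0..<p * q} \<union> {p * q..<p * q + q}" by auto
    then have "(\<Sum>k\<in>{0..<Suc p * q}. f (k div q) (k mod q)) =
      (\<Sum>k\<in>{0..<p * q}. f (k div q) (k mod q)) + (\<Sum>k\<in>{p * q..<p * q + q}. f (k div q) (k mod q))"
      by (simp add: sum.union_disjoint)
    also have "(\<Sum>k\<in>{p * q..<p * q + q}. f (k div q) (k mod q)) = (\<Sum>j\<in>{0..<q}. f p j)"
    proof (rule sum.reindex_bij_witness[of _ "\<lambda>j. p * q + j" "\<lambda>k. k - p * q"])
      fix k assume "k \<in> {p * q..<p * q + q}"
      then obtain r where "k = p * q + r" "r < q" by (auto simp: le_iff_add)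
      then show "f p (k - p * q) = f (k div q) (k mod q)" by simp
    qed auto
    finally show ?case using Suc by simp
  qed simp
qed simp

lemma kronecker_carrier [simp]:
  "A \<in> carrier_mat n n \<Longrightarrow> B \<in> carrier_mat m m \<Longrightarrow> kronecker_mat A B \<in> carrier_mat (n * m) (n * m)"
  by (auto simp: kronecker_mat_def)

lemma kronecker_dim [simp]:
  "dim_row (kronecker_mat A B) = dim_row A * dim_row B"
  "dim_col (kronecker_mat A B) = dim_col A * dim_col B"
  by (auto simp: kronecker_mat_def)

lemma kronecker_index:
  "i < dim_row A * dim_row B \<Longrightarrow> j < dim_col A * dim_col B \<Longrightarrow>
    kronecker_mat A B $$ (i, j) =
      A $$ (i div dim_row B, j div dim_col B) * B $$ (i mod dim_row B, j mod dim_col B)"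
  by (simp add: kronecker_mat_def)

lemma div_mod_bounds: "(i::nat) < n * m \<Longrightarrow> i div m < n \<and> i mod m < m"
  by (cases "m = 0") (auto simp: less_mult_imp_div_less)

lemma map_mat_zero: "h 0 = 0 \<Longrightarrow> map_mat h (0\<^sub>m n m) = 0\<^sub>m n m"
  by (rule eq_matI) auto

lemma mat_mult_index_sum:
  "A \<in> carrier_mat n k \<Longrightarrow> B \<in> carrier_mat k m \<Longrightarrow> i < n \<Longrightarrow> j < m \<Longrightarrow>
    (A * B) $$ (i, j) = (\<Sum>l\<in>{0..<k}. A $$ (i, l) * B $$ (l, j))"
  by (simp add: scalar_prod_def)

lemma kronecker_mult:
  fixes A :: "'a::comm_semiring_0 mat"
  assumes A: "A \<in> carrier_mat n n" "C \<in> carrier_mat n n" and B: "B \<in> carrier_mat m m" "D \<in> carrier_mat m m"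
  shows "kronecker_mat A B * kronecker_mat C D = kronecker_mat (A * C) (B * D)"
proof (rule eq_matI)
  note AB = kronecker_carrier[OF A(1) B(1)] and CD = kronecker_carrier[OF A(2) B(2)]
  fix i j assume "i < dim_row (kronecker_mat (A * C) (B * D))" "j < dim_col (kronecker_mat (A * C) (B * D))"
  then have ij: "i < n * m" "j < n * m" using A B by auto
  note bi = div_mod_bounds[OF ij(1)] and bj = div_mod_bounds[OF ij(2)]
  have "(kronecker_mat A B * kronecker_mat C D) $$ (i, j) =
    (\<Sum>k\<in>{0..<n * m}. kronecker_mat A B $$ (i, k) * kronecker_mat C D $$ (k, j))"
    by (rule mat_mult_index_sum[OF AB CD ij])
  also have "\<dots> = (\<Sum>k\<in>{0..<n * m}. (\<lambda>k l. A $$ (i div m, k) * B $$ (i mod m, l) *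
      (C $$ (k, j div m) * D $$ (l, j mod m))) (k div m) (k mod m))"
    by (intro sum.cong refl) (use A B ij in \<open>simp add: kronecker_index\<close>)
  also have "\<dots> = (\<Sum>k\<in>{0..<n}. \<Sum>l\<in>{0..<m}. A $$ (i div m, k) * B $$ (i mod m, l) *
      (C $$ (k, j div m) * D $$ (l, j mod m)))"
    by (rule sum_div_mod)
  also have "\<dots> = (\<Sum>k\<in>{0..<n}. A $$ (i div m, k) * C $$ (k, j div m)) *
      (\<Sum>l\<in>{0..<m}. B $$ (i mod m, l) * D $$ (l, j mod m))"
    by (simp add: sum_product mult_ac)
  also have "\<dots> = (A * C) $$ (i div m, j div m) * (B * D) $$ (i mod m, j mod m)"
    using bi bj by (simp add: mat_mult_index_sum[OF A] mat_mult_index_sum[OF B] del: index_mult_mat)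
  also have "\<dots> = kronecker_mat (A * C) (B * D) $$ (i, j)"
    using A B ij by (simp add: kronecker_index del: index_mult_mat(1))
  finally show "(kronecker_mat A B * kronecker_mat C D) $$ (i, j) = kronecker_mat (A * C) (B * D) $$ (i, j)" .
qed (use A B in auto)

lemma kronecker_one: "kronecker_mat (1\<^sub>m n) (1\<^sub>m m) = (1\<^sub>m (n * m) :: 'a::semiring_1 mat)"
proof (rule eq_matI)
  fix i j assume "i < dim_row (1\<^sub>m (n * m) :: 'a mat)" "j < dim_col (1\<^sub>m (n * m) :: 'a mat)"
  then have ij: "i < n * m" "j < n * m" by auto
  have "i = j \<longleftrightarrow> i div m = j div m \<and> i mod m = j mod m"
    by (metis div_mult_mod_eq)
  then show "kronecker_mat (1\<^sub>m n) (1\<^sub>m m) $$ (i, j) = (1\<^sub>m (n * m) :: 'a mat) $$ (i, j)"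
    using ij div_mod_bounds[OF ij(1)] div_mod_bounds[OF ij(2)] by (simp add: kronecker_index)
qed auto

lemma kronecker_one_left: "kronecker_mat (1\<^sub>m 1) (B :: 'a::semiring_1 mat) = B"
  by (rule eq_matI) (auto simp: kronecker_index)

lemma kronecker_one_right: "kronecker_mat (B :: 'a::semiring_1 mat) (1\<^sub>m 1) = B"
  by (rule eq_matI) (auto simp: kronecker_index)

lemma kronecker_assoc:
  fixes A :: "'a::semigroup_mult mat"
  shows "kronecker_mat (kronecker_mat A B) C = kronecker_mat A (kronecker_mat B C)"
proof (rule eq_matI)
  fix i j
  assume "i < dim_row (kronecker_mat A (kronecker_mat B C))" "j < dim_col (kronecker_mat A (kronecker_mat B C))"
  then have ij: "i < dim_row A * dim_row B * dim_row C" "j < dim_col A * dim_col B * dim_col C"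
    by (auto simp: mult.assoc)
  have m: "k mod (b * c) div c = k div c mod b" "k mod (b * c) mod c = k mod c" "k div (b * c) = k div c div b"
    for k b c :: nat
    by (simp_all add: mod_mult2_eq mult.commute[of b c] div_mult2_eq mod_mod_cancel)
      (cases "c = 0"; simp)
  show "kronecker_mat (kronecker_mat A B) C $$ (i, j) = kronecker_mat A (kronecker_mat B C) $$ (i, j)"
    using ij div_mod_bounds[OF ij(1)] div_mod_bounds[OF ij(2)]
      div_mod_bounds[of i "dim_row A" "dim_row B * dim_row C"] div_mod_bounds[of j "dim_col A" "dim_col B * dim_col C"]
    by (simp add: kronecker_index mult.assoc m)
qed (auto simp: mult.assoc)

definition mtrace :: "'a::comm_monoid_add mat \<Rightarrow> 'a" where
  "mtrace A = (\<Sum>i\<in>{0..<dim_row A}. A $$ (i, i))"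

lemma mtrace_comm:
  fixes A :: "'a::comm_semiring_0 mat"
  assumes "A \<in> carrier_mat n m" "B \<in> carrier_mat m n"
  shows "mtrace (A * B) = mtrace (B * A)"
proof -
  have "mtrace (A * B) = (\<Sum>i\<in>{0..<n}. \<Sum>j\<in>{0..<m}. A $$ (i, j) * B $$ (j, i))"
    unfolding mtrace_def using assms
    by (intro sum.cong) (auto simp: mat_mult_index_sum simp del: index_mult_mat(1))
  also have "\<dots> = (\<Sum>j\<in>{0..<m}. \<Sum>i\<in>{0..<n}. B $$ (j, i) * A $$ (i, j))"
    by (subst sum.swap) (simp add: mult.commute)
  also have "\<dots> = mtrace (B * A)"
    unfolding mtrace_def using assms
    by (intro sum.cong) (auto simp: mat_mult_index_sum simp del: index_mult_mat(1))
  finally show ?thesis .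
qed

lemma mtrace_kronecker:
  fixes A :: "'a::comm_semiring_0 mat"
  assumes "A \<in> carrier_mat n n" "B \<in> carrier_mat m m"
  shows "mtrace (kronecker_mat A B) = mtrace A * mtrace B"
proof -
  have "mtrace (kronecker_mat A B) = (\<Sum>k\<in>{0..<n * m}. (\<lambda>i j. A $$ (i, i) * B $$ (j, j)) (k div m) (k mod m))"
    unfolding mtrace_def using assms by (intro sum.cong) (auto simp: kronecker_index)
  also have "\<dots> = (\<Sum>i\<in>{0..<n}. \<Sum>j\<in>{0..<m}. A $$ (i, i) * B $$ (j, j))"
    by (rule sum_div_mod)
  also have "\<dots> = mtrace A * mtrace B"
    using assms by (simp add: mtrace_def sum_product)
  finally show ?thesis .
qed

lemma mtrace_four_block:
  assumes "A \<in> carrier_mat n n" "D \<in> carrier_mat m m"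
  shows "mtrace (four_block_mat A B C D) = mtrace A + mtrace D"
proof -
  have "{0..<n + m} = {0..<n} \<union> {n..<n + m}" by auto
  then have "mtrace (four_block_mat A B C D) = (\<Sum>i\<in>{0..<n}. A $$ (i, i)) + (\<Sum>i\<in>{n..<n + m}. D $$ (i - n, i - n))"
    using assms by (simp add: mtrace_def sum.union_disjoint)
  also have "(\<Sum>i\<in>{n..<n + m}. D $$ (i - n, i - n)) = (\<Sum>i\<in>{0..<m}. D $$ (i, i))"
    by (intro sum.reindex_bij_witness[of _ "\<lambda>j. n + j" "\<lambda>k. k - n"]) auto
  finally show ?thesis using assms by (simp add: mtrace_def)
qed

lemma mtrace_one: "mtrace (1\<^sub>m n :: 'a::semiring_1 mat) = of_nat n"
  by (simp add: mtrace_def)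

lemma invertible_mat_obtain:
  assumes "invertible_mat T" "T \<in> carrier_mat n n"
  obtains U where "U \<in> carrier_mat n n" "T * U = 1\<^sub>m n" "U * T = 1\<^sub>m n"
proof -
  obtain U where U: "T * U = 1\<^sub>m (dim_row T)" "U * T = 1\<^sub>m (dim_row U)"
    using assms(1) by (auto simp: invertible_mat_def inverts_mat_def)
  have "dim_col U = n" using arg_cong[OF U(1), of dim_col] assms(2) by simp
  moreover have "dim_row U = n" using arg_cong[OF U(2), of dim_col] assms(2) by simp
  ultimately show ?thesis using that[of U] U assms(2) by auto
qed

lemma invertible_matI:
  "T \<in> carrier_mat n n \<Longrightarrow> U \<in> carrier_mat n n \<Longrightarrow> T * U = 1\<^sub>m n \<Longrightarrow> U * T = 1\<^sub>m n \<Longrightarrow> invertible_mat T"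
  by (auto simp: invertible_mat_def inverts_mat_def intro!: exI[of _ U])

context group begin

lemma is_rep_iff:
  fixes V :: "('a, 'k::field) rep"
  shows "is_rep G V \<longleftrightarrow> (\<forall>g\<in>carrier G. snd V g \<in> carrier_mat (fst V) (fst V)) \<and>
    (\<forall>g\<in>carrier G. \<forall>h\<in>carrier G. snd V (g \<otimes>\<^bsub>G\<^esub> h) = snd V g * snd V h) \<and>
    snd V \<one>\<^bsub>G\<^esub> = 1\<^sub>m (fst V)" (is "?L \<longleftrightarrow> ?R")
proof -
  let ?M = "ring_mat TYPE('k) (fst V) ()"
  interpret M: ring ?M by (rule ring_mat)
  interpret U: group "units_of ?M" by (rule M.units_group)
  have simps [simp]: "carrier ?M = carrier_mat (fst V) (fst V)" "\<one>\<^bsub>?M\<^esub> = 1\<^sub>m (fst V)"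
    "x \<otimes>\<^bsub>?M\<^esub> y = x * y" for x y by (auto simp: ring_mat_def)
  show ?thesis
  proof
    assume ?L
    then have h: "snd V \<in> hom G (units_of ?M)" by (simp add: is_rep_def)
    interpret h: group_hom G "units_of ?M" "snd V" by unfold_locales (rule h)
    have "snd V g \<in> Units ?M" if "g \<in> carrier G" for g
      using h.hom_closed[OF that] by (simp add: units_of_def)
    then have "snd V g \<in> carrier ?M" if "g \<in> carrier G" for g
      using that by (auto simp: Units_def)
    moreover have "snd V \<one> = 1\<^sub>m (fst V)" using h.hom_one by (simp add: units_of_def)
    moreover have "snd V (g \<otimes> h) = snd V g * snd V h" if "g \<in> carrier G" "h \<in> carrier G" for g h
      using h.hom_mult[OF that] by (simp add: units_of_def)
    ultimately show ?R by simp
  next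
    assume R: ?R
    have "snd V g \<in> Units ?M" if "g \<in> carrier G" for g
    proof -
      have "snd V g * snd V (inv g) = 1\<^sub>m (fst V)" "snd V (inv g) * snd V g = 1\<^sub>m (fst V)"
        using R that by (metis inv_closed r_inv, metis inv_closed l_inv)
      then show ?thesis using R that unfolding Units_def by (auto intro!: bexI[of _ "snd V (inv g)"])
    qed
    then show ?L using R by (auto simp: is_rep_def hom_def units_of_def)
  qed
qed

lemma is_repD:
  assumes "is_rep G (V :: ('a, 'k::field) rep)"
  shows "g \<in> carrier G \<Longrightarrow> snd V g \<in> carrier_mat (fst V) (fst V)"
    "g \<in> carrier G \<Longrightarrow> h \<in> carrier G \<Longrightarrow> snd V (g \<otimes> h) = snd V g * snd V h"
    "snd V \<one> = 1\<^sub>m (fst V)"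
  using assms unfolding is_rep_iff by auto

lemma is_repI:
  assumes "\<And>g. g \<in> carrier G \<Longrightarrow> R g \<in> carrier_mat n n"
    "\<And>g h. g \<in> carrier G \<Longrightarrow> h \<in> carrier G \<Longrightarrow> R (g \<otimes> h) = R g * R h" "R \<one> = 1\<^sub>m n"
  shows "is_rep G (n, R :: 'a \<Rightarrow> 'k::field mat)"
  using assms unfolding is_rep_iff by auto

lemma is_rep_sum:
  assumes V: "is_rep G (V :: ('a, 'k::field) rep)" and W: "is_rep G W"
  shows "is_rep G (rep_sum V W)"
  unfolding rep_sum_def
proof (rule is_repI)
  note V = is_repD[OF V] and W = is_repD[OF W]
  fix g h assume g: "g \<in> carrier G" and h: "h \<in> carrier G"
  let ?b = "\<lambda>g. four_block_mat (snd V g) (0\<^sub>m (fst V) (fst W)) (0\<^sub>m (fst W) (fst V)) (snd W g)"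
  show "?b (g \<otimes> h) = ?b g * ?b h"
    using mult_four_block_mat[OF V(1)[OF g] zero_carrier_mat zero_carrier_mat W(1)[OF g]
      V(1)[OF h] zero_carrier_mat zero_carrier_mat W(1)[OF h]] V(1)[OF g] V(1)[OF h] W(1)[OF g] W(1)[OF h]
    by (simp add: V(2)[OF g h] W(2)[OF g h])
qed (use is_repD[OF V] is_repD[OF W] in auto)

lemma is_rep_tensor:
  assumes V: "is_rep G (V :: ('a, 'k::field) rep)" and W: "is_rep G W"
  shows "is_rep G (rep_tensor V W)"
  unfolding rep_tensor_def
proof (rule is_repI)
  note V = is_repD[OF V] and W = is_repD[OF W]
  fix g h assume g: "g \<in> carrier G" and h: "h \<in> carrier G"
  show "kronecker_mat (snd V (g \<otimes> h)) (snd W (g \<otimes> h)) =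
      kronecker_mat (snd V g) (snd W g) * kronecker_mat (snd V h) (snd W h)"
    using kronecker_mult[OF V(1)[OF g] V(1)[OF h] W(1)[OF g] W(1)[OF h]]
    by (simp add: V(2)[OF g h] W(2)[OF g h])
qed (simp_all add: is_repD[OF V] is_repD[OF W] kronecker_one)

lemma is_rep_triv: "is_rep G (1, \<lambda>_. 1\<^sub>m 1 :: 'k::field mat)"
  by (rule is_repI) auto

lemma rep_monoid_simps [simp]:
  "carrier (rep_monoid G) = {V. is_rep G (V :: ('a, 'k::field) rep)}"
  "V \<otimes>\<^bsub>rep_monoid G\<^esub> W = rep_tensor V (W :: ('a, 'k::field) rep)"
  "\<one>\<^bsub>rep_monoid G\<^esub> = (1, \<lambda>_. 1\<^sub>m 1 :: 'k::field mat)"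
  by (simp_all add: rep_monoid_def)

text \<open>With the ordering of rows and columns by division with remainder the Kronecker product is
strictly associative and unital, so representations form a monoid on the nose and not only up to isomorphism.\<close>

lemma rep_monoid_is_monoid: "Group.monoid (rep_monoid G :: ('a, 'k::field) rep monoid)"
proof (rule monoidI)
  fix U V W :: "('a, 'k) rep"
  show "U \<otimes>\<^bsub>rep_monoid G\<^esub> V \<otimes>\<^bsub>rep_monoid G\<^esub> W = U \<otimes>\<^bsub>rep_monoid G\<^esub> (V \<otimes>\<^bsub>rep_monoid G\<^esub> W)"
    by (simp add: rep_tensor_def kronecker_assoc mult.assoc)
  show "\<one>\<^bsub>rep_monoid G\<^esub> \<otimes>\<^bsub>rep_monoid G\<^esub> V = V" "V \<otimes>\<^bsub>rep_monoid G\<^esub> \<one>\<^bsub>rep_monoid G\<^esub> = V"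
    by (simp_all add: rep_tensor_def kronecker_one_left[simplified] kronecker_one_right[simplified])
qed (simp_all del: One_nat_def add: is_rep_tensor is_rep_triv)

lemma rep_relationsE:
  assumes "s \<in> rep_relations G"
  obtains V W :: "('a, 'k::field) rep" where "is_rep G V" "is_rep G W" "rep_iso G V W" "s = frag_of V - frag_of W"
  | V W :: "('a, 'k::field) rep" where "is_rep G V" "is_rep G W" "s = frag_of (rep_sum V W) - frag_of V - frag_of W"
  using assms unfolding rep_relations_def by blast

lemma rep_ring_presentation:
  "ring_presentation (rep_monoid G) (rep_relations G :: (('a, 'k::field) rep \<Rightarrow>\<^sub>0 int) set)"
proof (rule ring_presentation.intro)
  show "Group.monoid (rep_monoid G :: ('a, 'k) rep monoid)" by (rule rep_monoid_is_monoid)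
  have "Poly_Mapping.keys s \<subseteq> {V. is_rep G V}" if "s \<in> rep_relations G" for s :: "('a, 'k) rep \<Rightarrow>\<^sub>0 int"
    using that
  proof (cases rule: rep_relationsE)
    case (1 V W)
    then show ?thesis by (simp add: keys_diff_subset)
  next
    case (2 V W)
    then show ?thesis by (simp add: keys_diff_subset is_rep_sum)
  qed
  then show "rep_relations G \<subseteq> carrier (monoid_ring (rep_monoid G :: ('a, 'k) rep monoid))" by auto
qed

lemma is_rep_map:
  assumes h: "field_hom (h :: 'k::field \<Rightarrow> 'l::field)" and V: "is_rep G V"
  shows "is_rep G (fst V, \<lambda>g. map_mat h (snd V g))"
proof (rule is_repI)
  interpret h: field_hom h by fact
  fix x y assume x: "x \<in> carrier G" and y: "y \<in> carrier G"
  show "map_mat h (snd V (x \<otimes> y)) = map_mat h (snd V x) * map_mat h (snd V y)"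
    using is_repD[OF V] x y h.mat_hom_mult by metis
next
  interpret h: field_hom h by fact
  show "map_mat h (snd V \<one>) = 1\<^sub>m (fst V)" by (simp add: is_repD(3)[OF V] h.mat_hom_one)
qed (simp add: is_repD(1)[OF V])

text \<open>Extension of scalars commutes with Kronecker products strictly. With direct sums it commutes on
the elements of the group, so the images of both sides are related by an identity matrix, hence
isomorphic.\<close>

lemma rep_ring_ext_presentation_map:
  assumes h: "field_hom (h :: 'k::field \<Rightarrow> 'l::field)"
  shows "presentation_map (rep_monoid G) (rep_relations G) (rep_monoid G) (rep_relations G)
    (\<lambda>V. (fst V, \<lambda>g. map_mat h (snd V g)))"
proof -
  interpret h: field_hom h by fact
  interpret M: ring_presentation "rep_monoid G :: ('a, 'k) rep monoid" "rep_relations G"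
    by (rule rep_ring_presentation)
  interpret N: ring_presentation "rep_monoid G :: ('a, 'l) rep monoid" "rep_relations G"
    by (rule rep_ring_presentation)
  interpret Q: ring "presented_ring (rep_monoid G :: ('a, 'l) rep monoid) (rep_relations G)"
    by (rule N.presented_is_ring)
  let ?f = "\<lambda>V :: ('a, 'k) rep. (fst V, \<lambda>g. map_mat h (snd V g))"
  have kron: "map_mat h (kronecker_mat A B) = kronecker_mat (map_mat h A) (map_mat h B)" for A B
  proof (rule eq_matI)
    fix i j
    assume "i < dim_row (kronecker_mat (map_mat h A) (map_mat h B))"
      "j < dim_col (kronecker_mat (map_mat h A) (map_mat h B))"
    then have ij: "i < dim_row A * dim_row B" "j < dim_col A * dim_col B" by auto
    show "map_mat h (kronecker_mat A B) $$ (i, j) = kronecker_mat (map_mat h A) (map_mat h B) $$ (i, j)"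
      using ij div_mod_bounds[OF ij(1)] div_mod_bounds[OF ij(2)]
      by (simp add: kronecker_index h.hom_mult)
  qed auto
  show ?thesis
  proof
    show "?f \<in> hom (rep_monoid G) (rep_monoid G)"
      by (intro homI) (simp_all add: is_rep_map[OF h] rep_tensor_def kron)
    show "?f \<one>\<^bsub>rep_monoid G\<^esub> = \<one>\<^bsub>rep_monoid G\<^esub>"
      using h.mat_hom_one by (simp add: fun_eq_iff)
    fix s :: "('a, 'k) rep \<Rightarrow>\<^sub>0 int" assume "s \<in> rep_relations G"
    then show "N.cls (frag_extend (\<lambda>x. frag_of (?f x)) s) = \<zero>\<^bsub>presented_ring (rep_monoid G) (rep_relations G)\<^esub>"
    proof (cases rule: rep_relationsE)
      case (1 V W)
      then obtain T where T: "T \<in> carrier_mat (fst V) (fst V)" "invertible_mat T"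
        "\<forall>g\<in>carrier G. T * snd V g = snd W g * T" and d: "fst V = fst W"
        unfolding rep_iso_def by blast
      obtain U where U: "U \<in> carrier_mat (fst V) (fst V)" "T * U = 1\<^sub>m (fst V)" "U * T = 1\<^sub>m (fst V)"
        using invertible_mat_obtain[OF T(2,1)] .
      have "map_mat h T * map_mat h (snd V g) = map_mat h (snd W g) * map_mat h T" if g: "g \<in> carrier G" for g
        using h.mat_hom_mult[OF T(1) is_repD(1)[OF 1(1) g]] h.mat_hom_mult[OF is_repD(1)[OF 1(2) g], of T]
          T(1,3) g d by simp
      moreover have "invertible_mat (map_mat h T)"
        using U T(1) h.mat_hom_mult[OF T(1) U(1)] h.mat_hom_mult[OF U(1) T(1)] h.mat_hom_one
        by (intro invertible_matI[of _ "fst V" "map_mat h U"]) auto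
      ultimately have "rep_iso G (?f V) (?f W)"
        using d T(1) by (auto simp: rep_iso_def intro!: bexI[of _ "map_mat h T"])
      then have "frag_of (?f V) - frag_of (?f W) \<in> rep_relations G"
        using is_rep_map[OF h 1(1)] is_rep_map[OF h 1(2)] unfolding rep_relations_def by blast
      then show ?thesis using N.cls_relation by (simp add: 1 frag_extend_diff)
    next
      case (2 V W)
      let ?b = "\<lambda>V W g. four_block_mat (snd V g) (0\<^sub>m (fst V) (fst W)) (0\<^sub>m (fst W) (fst V)) (snd W g)"
      have frag: "frag_of (rep_sum (?f V) (?f W)) - frag_of (?f V) - frag_of (?f W) \<in> rep_relations G"
        using is_rep_map[OF h 2(1)] is_rep_map[OF h 2(2)] unfolding rep_relations_def by blast
      have iso: "rep_iso G (?f (rep_sum V W)) (rep_sum (?f V) (?f W))"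
      proof -
        let ?n = "fst V + fst W"
        have "1\<^sub>m ?n * map_mat h (?b V W g) = ?b (?f V) (?f W) g * 1\<^sub>m ?n" if g: "g \<in> carrier G" for g
        proof -
          have "map_mat h (?b V W g) = ?b (?f V) (?f W) g"
            using map_four_block_mat[where f = h, OF is_repD(1)[OF 2(1) g] zero_carrier_mat zero_carrier_mat is_repD(1)[OF 2(2) g]]
            by (simp add: map_mat_zero)
          moreover have "map_mat h (?b V W g) \<in> carrier_mat ?n ?n"
            using is_repD(1)[OF 2(1) g] is_repD(1)[OF 2(2) g] by simp
          ultimately show ?thesis
            by (metis left_mult_one_mat right_mult_one_mat)
        qed
        moreover have "invertible_mat (1\<^sub>m ?n :: 'l mat)"
          by (rule invertible_matI[of _ ?n "1\<^sub>m ?n"]) simp_all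
        ultimately show ?thesis
          unfolding rep_iso_def rep_sum_def fst_conv snd_conv using one_carrier_mat by blast
      qed
      have reps: "is_rep G (?f (rep_sum V W))" "is_rep G (rep_sum (?f V) (?f W))" "is_rep G (?f V)" "is_rep G (?f W)"
        using is_rep_map[OF h] 2 is_rep_sum by metis+
      let ?A = "frag_of (?f (rep_sum V W)) - frag_of (rep_sum (?f V) (?f W))"
        and ?B = "frag_of (rep_sum (?f V) (?f W)) - frag_of (?f V) - frag_of (?f W)"
      have "?A \<in> rep_relations G" using iso reps unfolding rep_relations_def by blast
      then have "N.cls (?A + ?B) = \<zero>\<^bsub>presented_ring (rep_monoid G) (rep_relations G)\<^esub>"
        using N.cls_relation[OF frag] N.cls_relation[of ?A] reps
        by (subst N.cls_add) (simp_all add: keys_diff_subset)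
      moreover have "frag_extend (\<lambda>x. frag_of (?f x)) s = ?A + ?B"
        by (simp add: 2 frag_extend_diff)
      ultimately show ?thesis by simp
    qed
  qed
qed

end

section \<open>Localization by tensoring with $\mathbb{Z}_{(P)}$\<close>

text \<open>The natural numbers that become invertible in $\mathbb{Z}_{(P)}$.\<close>

definition invertible_at :: "nat set \<Rightarrow> nat \<Rightarrow> bool" where
  "invertible_at P m \<longleftrightarrow> m > 0 \<and> (\<forall>p\<in>P. prime p \<longrightarrow> \<not> p dvd m)"

lemma invertible_at_1 [simp]: "invertible_at P (Suc 0)"
  by (auto simp: invertible_at_def)

lemma invertible_at_mult: "invertible_at P m \<Longrightarrow> invertible_at P n \<Longrightarrow> invertible_at P (m * n)"
  by (auto simp: invertible_at_def prime_dvd_mult_iff)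

lemma Z_loc_ops [simp]:
  "x \<oplus>\<^bsub>Z_loc P\<^esub> y = x + y" "x \<otimes>\<^bsub>Z_loc P\<^esub> y = x * y" "\<one>\<^bsub>Z_loc P\<^esub> = 1" "\<zero>\<^bsub>Z_loc P\<^esub> = 0"
  by (simp_all add: Z_loc_def ring_of_type_algebra_def)

lemma Z_loc_ring: "ring (Z_loc P)"
  unfolding Z_loc_def
  by (rule ring.subring_is_ring[OF ring_from_type_algebra ring.generate_ring_is_subring[OF ring_from_type_algebra]])
    (simp add: ring_of_type_algebra_def)

lemma type_algebra_minus: "\<ominus>\<^bsub>ring_of_type_algebra\<^esub> (x :: 'r::comm_ring_1) = - x"
proof -
  interpret ring "ring_of_type_algebra :: 'r ring" by (rule ring_from_type_algebra)
  show ?thesis by (rule minus_equality) (auto simp: ring_of_type_algebra_def)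
qed

lemma Z_loc_form:
  assumes "x \<in> carrier (Z_loc P)"
  obtains k m where "invertible_at P m" "x = of_int k / of_nat m"
proof -
  let ?R = "ring_of_type_algebra :: rat ring"
  have "x \<in> generate_ring ?R {inverse (of_nat p) |p. prime p \<and> p \<notin> P}" using assms by (simp add: Z_loc_def)
  then have "\<exists>k m. invertible_at P m \<and> x = of_int k / of_nat m"
  proof induction
    case one
    then show ?case by (intro exI[of _ 1]) (simp add: ring_of_type_algebra_def)
  next
    case (incl h)
    then obtain p where p: "prime p" "p \<notin> P" "h = inverse (of_nat p)" by auto
    then show ?case
      by (intro exI[of _ "1::int"] exI[of _ p])
        (auto simp: invertible_at_def inverse_eq_divide prime_gt_0_nat dest: primes_dvd_imp_eq)
  next
    case (a_inv h)
    then obtain k m where "invertible_at P m" "h = of_int k / of_nat m" by auto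
    then show ?case by (intro exI[of _ "- k"] exI[of _ m]) (simp add: type_algebra_minus)
  next
    case (eng_add x y)
    then obtain k m l n where *: "invertible_at P m" "x = of_int k / of_nat m"
      "invertible_at P n" "y = of_int l / of_nat n" by auto
    then have "m > 0" "n > 0" by (auto simp: invertible_at_def)
    then show ?case using *
      by (intro exI[of _ "k * int n + l * int m"] exI[of _ "m * n"])
        (auto simp: invertible_at_mult ring_of_type_algebra_def field_simps)
  next
    case (eng_mult x y)
    then obtain k m l n where *: "invertible_at P m" "x = of_int k / of_nat m"
      "invertible_at P n" "y = of_int l / of_nat n" by auto
    then show ?case
      by (intro exI[of _ "k * l"] exI[of _ "m * n"]) (auto simp: invertible_at_mult ring_of_type_algebra_def)
  qed
  then show ?thesis using that by blast
qed

lemma Z_loc_inverse: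
  assumes "invertible_at P m"
  shows "1 / of_nat m \<in> carrier (Z_loc P)"
  using assms
proof (induction m rule: less_induct)
  case (less m)
  interpret Z: ring "Z_loc P" by (rule Z_loc_ring)
  show ?case
  proof (cases "m = 1")
    case True
    then show ?thesis using Z.one_closed by simp
  next
    case False
    then obtain p where p: "prime p" "p dvd m" using prime_factor_nat by blast
    then obtain n where n: "m = p * n" by (auto elim: dvdE)
    have m0: "m > 0" using less.prems by (simp add: invertible_at_def)
    have pP: "p \<notin> P" using p less.prems by (auto simp: invertible_at_def)
    have "n < m" using m0 prime_gt_1_nat[OF p(1)] by (simp add: n)
    moreover have "invertible_at P n" using less.prems unfolding n invertible_at_def by auto
    ultimately have "1 / of_nat n \<in> carrier (Z_loc P)" by (rule less.IH)
    moreover have "inverse (of_nat p) \<in> carrier (Z_loc P)"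
      using p pP by (auto simp: Z_loc_def intro: generate_ring.incl)
    ultimately have "inverse (of_nat p) * (1 / of_nat n) \<in> carrier (Z_loc P)" using Z.m_closed by force
    then show ?thesis by (simp add: n inverse_eq_divide)
  qed
qed

locale ring_localization =
  fixes R :: "('a, 'b) ring_scheme" and P :: "nat set"
  assumes ring: "ring R"
begin

interpretation R: ring R by (rule ring)

interpretation Z: ring "Z_loc P" by (rule Z_loc_ring)

lemma tensor_relationsE:
  assumes "s \<in> tensor_relations R (Z_loc P)"
  obtains x y a where "x \<in> carrier R" "y \<in> carrier R" "a \<in> carrier (Z_loc P)"
      "s = frag_of (x \<oplus>\<^bsub>R\<^esub> y, a) - frag_of (x, a) - frag_of (y, a)"
  | x a b where "x \<in> carrier R" "a \<in> carrier (Z_loc P)" "b \<in> carrier (Z_loc P)"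
      "s = frag_of (x, a + b) - frag_of (x, a) - frag_of (x, b)"
  using assms unfolding tensor_relations_def by auto

lemma tensor_presentation: "ring_presentation (R \<times>\<times> Z_loc P) (tensor_relations R (Z_loc P))"
proof (rule ring_presentation.intro)
  show "Group.monoid (R \<times>\<times> Z_loc P)"
    by (rule DirProd_monoid) (rule R.monoid_axioms Z.monoid_axioms)+
  have "Poly_Mapping.keys s \<subseteq> carrier R \<times> carrier (Z_loc P)" if "s \<in> tensor_relations R (Z_loc P)" for s
    using that
  proof (cases rule: tensor_relationsE)
    case (1 x y a)
    then show ?thesis unfolding 1(4) by (intro keys_diff_subset) auto
  next
    case (2 x a b)
    then show ?thesis unfolding 2(4) using Z.add.m_closed[OF 2(2,3)] by (intro keys_diff_subset) auto
  qed
  then show "tensor_relations R (Z_loc P) \<subseteq> carrier (monoid_ring (R \<times>\<times> Z_loc P))" by auto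
qed

sublocale T: ring_presentation "R \<times>\<times> Z_loc P" "tensor_relations R (Z_loc P)"
  by (rule tensor_presentation)

definition loc_ring where "loc_ring = tensor_ring R (Z_loc P)"

lemma loc_ring_is_ring: "ring loc_ring"
  unfolding loc_ring_def tensor_ring_def by (rule T.presented_is_ring)

interpretation L: ring loc_ring by (rule loc_ring_is_ring)

definition tensor :: "'a \<Rightarrow> rat \<Rightarrow> _" where "tensor x a = T.gen (x, a)"

lemma loc_ring_eq: "presented_ring (R \<times>\<times> Z_loc P) (tensor_relations R (Z_loc P)) = loc_ring"
  by (simp add: loc_ring_def tensor_ring_def)

lemma tensor_closed [simp]: "x \<in> carrier R \<Longrightarrow> a \<in> carrier (Z_loc P) \<Longrightarrow> tensor x a \<in> carrier loc_ring"
  using T.gen_closed[of "(x, a)"] by (simp add: tensor_def loc_ring_eq)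

lemma diff_diff_zeroD:
  assumes "a \<in> carrier loc_ring" "b \<in> carrier loc_ring" "c \<in> carrier loc_ring" "a \<ominus>\<^bsub>loc_ring\<^esub> b \<ominus>\<^bsub>loc_ring\<^esub> c = \<zero>\<^bsub>loc_ring\<^esub>"
  shows "a = b \<oplus>\<^bsub>loc_ring\<^esub> c"
proof -
  have "a \<ominus>\<^bsub>loc_ring\<^esub> b = c"
    using assms(4) by (subst (asm) L.r_right_minus_eq) (use assms(1-3) in simp_all)
  then have "b \<oplus>\<^bsub>loc_ring\<^esub> c = b \<oplus>\<^bsub>loc_ring\<^esub> (a \<ominus>\<^bsub>loc_ring\<^esub> b)" by simp
  also have "\<dots> = a"
    using assms(1,2) by (simp add: a_minus_def L.a_lcomm[of b a] L.r_neg)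
  finally show ?thesis by simp
qed

lemma tensor_add_left:
  assumes "x \<in> carrier R" "y \<in> carrier R" "a \<in> carrier (Z_loc P)"
  shows "tensor (x \<oplus>\<^bsub>R\<^esub> y) a = tensor x a \<oplus>\<^bsub>loc_ring\<^esub> tensor y a"
proof (rule diff_diff_zeroD)
  have "frag_of (x \<oplus>\<^bsub>R\<^esub> y, a) - frag_of (x, a) - frag_of (y, a) \<in> tensor_relations R (Z_loc P)"
    using assms unfolding tensor_relations_def by blast
  from T.cls_relation[OF this] show "tensor (x \<oplus>\<^bsub>R\<^esub> y) a \<ominus>\<^bsub>loc_ring\<^esub> tensor x a \<ominus>\<^bsub>loc_ring\<^esub> tensor y a = \<zero>\<^bsub>loc_ring\<^esub>"
    using assms by (simp add: T.cls_minus keys_diff_subset tensor_def T.gen_def loc_ring_eq)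
qed (use assms in auto)

lemma tensor_add_right:
  assumes "x \<in> carrier R" "a \<in> carrier (Z_loc P)" "b \<in> carrier (Z_loc P)"
  shows "tensor x (a + b) = tensor x a \<oplus>\<^bsub>loc_ring\<^esub> tensor x b"
proof (rule diff_diff_zeroD)
  have ab: "a + b \<in> carrier (Z_loc P)" using Z.add.m_closed[OF assms(2,3)] by simp
  have "frag_of (x, a + b) - frag_of (x, a) - frag_of (x, b) \<in> tensor_relations R (Z_loc P)"
    using assms unfolding tensor_relations_def by auto
  from T.cls_relation[OF this] show "tensor x (a + b) \<ominus>\<^bsub>loc_ring\<^esub> tensor x a \<ominus>\<^bsub>loc_ring\<^esub> tensor x b = \<zero>\<^bsub>loc_ring\<^esub>"
    using assms ab by (simp add: T.cls_minus keys_diff_subset tensor_def T.gen_def loc_ring_eq)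
  show "tensor x (a + b) \<in> carrier loc_ring" using assms(1) ab by simp
qed (use assms in auto)

lemma tensor_zero_left: "a \<in> carrier (Z_loc P) \<Longrightarrow> tensor \<zero>\<^bsub>R\<^esub> a = \<zero>\<^bsub>loc_ring\<^esub>"
  using tensor_add_left[of "\<zero>\<^bsub>R\<^esub>" "\<zero>\<^bsub>R\<^esub>" a] by simp

lemma tensor_zero_right: "x \<in> carrier R \<Longrightarrow> tensor x 0 = \<zero>\<^bsub>loc_ring\<^esub>"
  using tensor_add_right[of x 0 0] Z.zero_closed by simp

lemma tensor_minus_left: "x \<in> carrier R \<Longrightarrow> a \<in> carrier (Z_loc P) \<Longrightarrow> tensor (\<ominus>\<^bsub>R\<^esub> x) a = \<ominus>\<^bsub>loc_ring\<^esub> tensor x a"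
  using tensor_add_left[of "\<ominus>\<^bsub>R\<^esub> x" x a] by (simp add: R.l_neg tensor_zero_left L.minus_equality)

lemma Z_minus: "a \<in> carrier (Z_loc P) \<Longrightarrow> - a \<in> carrier (Z_loc P)"
proof -
  assume a: "a \<in> carrier (Z_loc P)"
  have "\<ominus>\<^bsub>Z_loc P\<^esub> a = - a" using Z.l_neg[OF a] by (simp add: eq_neg_iff_add_eq_0)
  then show "- a \<in> carrier (Z_loc P)" using Z.a_inv_closed[OF a] by metis
qed

lemma tensor_minus_right: "x \<in> carrier R \<Longrightarrow> a \<in> carrier (Z_loc P) \<Longrightarrow> tensor x (- a) = \<ominus>\<^bsub>loc_ring\<^esub> tensor x a"
  using tensor_add_right[of x "- a" a] by (simp add: Z_minus tensor_zero_right L.minus_equality)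

lemma of_nat_mult_closed: "a \<in> carrier (Z_loc P) \<Longrightarrow> of_nat n * a \<in> carrier (Z_loc P)"
proof (induction n)
  case (Suc n)
  then show ?case using Z.add.m_closed[of a "of_nat n * a"] by (simp add: distrib_right)
qed (use Z.zero_closed in simp)

lemma tensor_nat_mult: "x \<in> carrier R \<Longrightarrow> a \<in> carrier (Z_loc P) \<Longrightarrow> tensor x (of_nat n * a) = tensor ([n] \<cdot>\<^bsub>R\<^esub> x) a"
proof (induction n)
  case (Suc n)
  then have "tensor x (of_nat (Suc n) * a) = tensor x (of_nat n * a) \<oplus>\<^bsub>loc_ring\<^esub> tensor x a"
    using tensor_add_right[of x "of_nat n * a" a] of_nat_mult_closed by (simp add: algebra_simps)
  then show ?case using Suc by (simp add: tensor_add_left)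
qed (simp add: tensor_zero_right tensor_zero_left)

text \<open>Two pure tensors with second components $1/m$ and $1/n$ can be written over the common
denominator $mn$, by moving the integers $n$ and $m$ to the first components.\<close>

lemma tensor_common_denominator:
  assumes "z \<in> carrier loc_ring"
  obtains x m where "x \<in> carrier R" "invertible_at P m" "z = tensor x (1 / of_nat m)"
proof -
  have "\<exists>x m. x \<in> carrier R \<and> invertible_at P m \<and> z = tensor x (1 / of_nat m)"
    using assms unfolding loc_ring_eq[symmetric]
  proof (induction rule: T.presented_induct)
    case (gen g)
    then obtain x a where g: "g = (x, a)" "x \<in> carrier R" "a \<in> carrier (Z_loc P)" by auto
    obtain k m where km: "invertible_at P m" "a = of_int k / of_nat m" using Z_loc_form[OF g(3)] .
    note inv = Z_loc_inverse[OF km(1)]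
    show ?case
    proof (cases "k \<ge> 0")
      case True
      then have "a = of_nat (nat k) * (1 / of_nat m)" by (simp add: km)
      then have "tensor x a = tensor ([nat k] \<cdot>\<^bsub>R\<^esub> x) (1 / of_nat m)" using tensor_nat_mult[OF g(2) inv] by simp
      then show ?thesis unfolding g(1) tensor_def[symmetric] using g(2) km(1) R.add.nat_pow_closed by blast
    next
      case False
      then have "a = - (of_nat (nat (- k)) * (1 / of_nat m))" by (simp add: km)
      then have "tensor x a = \<ominus>\<^bsub>loc_ring\<^esub> tensor ([nat (- k)] \<cdot>\<^bsub>R\<^esub> x) (1 / of_nat m)"
        using tensor_nat_mult[OF g(2) inv, of "nat (- k)"] tensor_minus_right[OF g(2) of_nat_mult_closed[OF inv, of "nat (- k)"]]
        by simp
      also have "\<dots> = tensor (\<ominus>\<^bsub>R\<^esub> ([nat (- k)] \<cdot>\<^bsub>R\<^esub> x)) (1 / of_nat m)" using g(2) inv by (simp add: tensor_minus_left)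
      finally show ?thesis unfolding g(1) tensor_def[symmetric]
        using g(2) km(1) R.add.nat_pow_closed R.a_inv_closed by blast
    qed
  next
    case zero
    show ?case unfolding loc_ring_eq using Z.one_closed
      by (intro exI[of _ "\<zero>\<^bsub>R\<^esub>"] exI[of _ 1]) (simp add: tensor_zero_left)
  next
    case (diff z w)
    then obtain x m y n where *: "x \<in> carrier R" "invertible_at P m" "z = tensor x (1 / of_nat m)"
      "y \<in> carrier R" "invertible_at P n" "w = tensor y (1 / of_nat n)" by auto
    have mn: "m > 0" "n > 0" using * by (auto simp: invertible_at_def)
    note inv = Z_loc_inverse[OF invertible_at_mult[OF *(2,5)]]
    let ?d = "1 / of_nat (m * n) :: rat"
    have "1 / of_nat m = of_nat n * ?d" "1 / of_nat n = of_nat m * ?d" using mn by simp_all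
    then have zw: "z = tensor ([n] \<cdot>\<^bsub>R\<^esub> x) ?d" "w = tensor ([m] \<cdot>\<^bsub>R\<^esub> y) ?d"
      using tensor_nat_mult[OF *(1) inv, of n] tensor_nat_mult[OF *(4) inv, of m] *(3,6) by metis+
    have "z \<ominus>\<^bsub>loc_ring\<^esub> w = tensor ([n] \<cdot>\<^bsub>R\<^esub> x \<ominus>\<^bsub>R\<^esub> [m] \<cdot>\<^bsub>R\<^esub> y) ?d"
      unfolding zw a_minus_def
      using *(1,4) tensor_add_left[OF _ _ inv, of "[n] \<cdot>\<^bsub>R\<^esub> x" "\<ominus>\<^bsub>R\<^esub> ([m] \<cdot>\<^bsub>R\<^esub> y)"]
        tensor_minus_left[OF _ inv, of "[m] \<cdot>\<^bsub>R\<^esub> y"] by simp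
    moreover have "[n] \<cdot>\<^bsub>R\<^esub> x \<ominus>\<^bsub>R\<^esub> [m] \<cdot>\<^bsub>R\<^esub> y \<in> carrier R" using *(1,4) by simp
    ultimately show ?case unfolding loc_ring_eq using invertible_at_mult[OF *(2,5)] by blast
  qed
  then show ?thesis using that by blast
qed

end

section \<open>Classes of representations and their characters\<close>

text \<open>The second parameter only fixes the type of the coefficient field.\<close>

locale rep_theory = group G for G :: "('g, 'b) monoid_scheme" (structure) +
  fixes K :: "'k::field itself"
begin

sublocale Rep: ring_presentation "rep_monoid G :: ('g, 'k) rep monoid" "rep_relations G"
  by (rule rep_ring_presentation)

abbreviation RR :: "(('g, 'k) rep \<Rightarrow>\<^sub>0 int) set ring" where "RR \<equiv> rep_ring G"

lemma RR_eq: "presented_ring (rep_monoid G) (rep_relations G) = RR"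
  by (simp add: rep_ring_def)

lemma RR_ring: "ring RR"
  using Rep.presented_is_ring unfolding RR_eq .

interpretation RR: ring RR by (rule RR_ring)

definition cls :: "('g, 'k) rep \<Rightarrow> (('g, 'k) rep \<Rightarrow>\<^sub>0 int) set" where "cls V = Rep.gen V"

lemma cls_closed [simp]: "is_rep G V \<Longrightarrow> cls V \<in> carrier RR"
  using Rep.gen_closed[of V] by (simp add: cls_def RR_eq)

lemma cls_iso:
  assumes "is_rep G V" "is_rep G W" "rep_iso G V W"
  shows "cls V = cls W"
proof -
  have "frag_of V - frag_of W \<in> rep_relations G" using assms unfolding rep_relations_def by blast
  from Rep.cls_relation[OF this] have "cls V \<ominus>\<^bsub>RR\<^esub> cls W = \<zero>\<^bsub>RR\<^esub>"
    using assms by (simp add: Rep.cls_minus cls_def Rep.gen_def RR_eq)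
  then show ?thesis using assms by (simp add: RR.r_right_minus_eq)
qed

lemma cls_sum:
  assumes "is_rep G V" "is_rep G W"
  shows "cls (rep_sum V W) = cls V \<oplus>\<^bsub>RR\<^esub> cls W"
proof -
  have "frag_of (rep_sum V W) - frag_of V - frag_of W \<in> rep_relations G"
    using assms unfolding rep_relations_def by blast
  from Rep.cls_relation[OF this]
  have "cls (rep_sum V W) \<ominus>\<^bsub>RR\<^esub> cls V \<ominus>\<^bsub>RR\<^esub> cls W = \<zero>\<^bsub>RR\<^esub>"
    using assms by (simp add: Rep.cls_minus keys_diff_subset is_rep_sum cls_def Rep.gen_def RR_eq)
  then have "cls (rep_sum V W) \<ominus>\<^bsub>RR\<^esub> cls V = cls W"
    using assms by (subst (asm) RR.r_right_minus_eq) (simp_all add: is_rep_sum)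
  then have "cls V \<oplus>\<^bsub>RR\<^esub> cls W = cls V \<oplus>\<^bsub>RR\<^esub> (cls (rep_sum V W) \<ominus>\<^bsub>RR\<^esub> cls V)" by simp
  also have "\<dots> = cls (rep_sum V W)"
    using assms by (simp add: a_minus_def RR.a_lcomm[of "cls V" "cls (rep_sum V W)"] RR.r_neg is_rep_sum)
  finally show ?thesis by simp
qed

lemma is_rep_zero: "is_rep G (0, \<lambda>_. 1\<^sub>m 0 :: 'k mat)"
  by (rule is_repI) auto

lemma cls_zero: "cls (0, \<lambda>_. 1\<^sub>m 0) = \<zero>\<^bsub>RR\<^esub>"
proof -
  let ?Z = "(0, \<lambda>_. 1\<^sub>m 0) :: ('g, 'k) rep"
  have "cls (rep_sum ?Z ?Z) = cls ?Z"
  proof (rule cls_iso)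
    show "rep_iso G (rep_sum ?Z ?Z) ?Z"
      by (auto simp: rep_iso_def rep_sum_def intro!: bexI[of _ "1\<^sub>m 0"] invertible_matI[of _ 0 "1\<^sub>m 0"])
  qed (rule is_rep_sum is_rep_zero)+
  then show ?thesis using cls_sum[OF is_rep_zero is_rep_zero] is_rep_zero by simp
qed

text \<open>Differences of classes are closed under subtraction because the sum of two classes is the
class of the direct sum.\<close>

lemma rep_ring_difference:
  assumes "x \<in> carrier RR"
  obtains V W where "is_rep G V" "is_rep G W" "x = cls V \<ominus>\<^bsub>RR\<^esub> cls W"
proof -
  have "\<exists>V W. is_rep G V \<and> is_rep G W \<and> x = cls V \<ominus>\<^bsub>RR\<^esub> cls W"
    using assms unfolding RR_eq[symmetric]
  proof (induction rule: Rep.presented_induct)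
    case (gen V)
    then have "Rep.gen V = cls V \<ominus>\<^bsub>RR\<^esub> cls (0, \<lambda>_. 1\<^sub>m 0)"
      using cls_closed[of V] by (simp add: cls_zero a_minus_def) (simp add: cls_def)
    then show ?case unfolding RR_eq using gen is_rep_zero by fastforce
  next
    case zero
    have "\<zero>\<^bsub>RR\<^esub> = cls (0, \<lambda>_. 1\<^sub>m 0) \<ominus>\<^bsub>RR\<^esub> cls (0, \<lambda>_. 1\<^sub>m 0)" by (simp add: cls_zero a_minus_def)
    then show ?case unfolding RR_eq using is_rep_zero by blast
  next
    case (diff a b)
    then obtain V W V' W' where *: "is_rep G V" "is_rep G W" "a = cls V \<ominus>\<^bsub>RR\<^esub> cls W"
      "is_rep G V'" "is_rep G W'" "b = cls V' \<ominus>\<^bsub>RR\<^esub> cls W'" unfolding RR_eq by blast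
    note c = cls_closed[OF *(1)] cls_closed[OF *(2)] cls_closed[OF *(4)] cls_closed[OF *(5)]
    have "a \<ominus>\<^bsub>RR\<^esub> b = cls (rep_sum V W') \<ominus>\<^bsub>RR\<^esub> cls (rep_sum W V')"
      using c by (simp add: * cls_sum a_minus_def RR.minus_add RR.minus_minus RR.a_ac)
    then show ?case unfolding RR_eq using * is_rep_sum by blast
  qed
  then show ?thesis using that by blast
qed

definition ring_character :: "'g \<Rightarrow> (('g, 'k) rep \<Rightarrow>\<^sub>0 int) set \<Rightarrow> 'k" where
  "ring_character g = Rep.lift (\<lambda>V. mtrace (snd V g))"

lemma mtrace_iso:
  assumes "rep_iso G V W" "is_rep G V" "is_rep G (W :: ('g, 'k) rep)" "g \<in> carrier G"
  shows "mtrace (snd V g) = mtrace (snd W g)"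
proof -
  obtain T where T: "T \<in> carrier_mat (fst V) (fst V)" "invertible_mat T"
    "T * snd V g = snd W g * T" and d: "fst V = fst W"
    using assms(1,4) unfolding rep_iso_def by blast
  obtain U where U: "U \<in> carrier_mat (fst V) (fst V)" "T * U = 1\<^sub>m (fst V)" "U * T = 1\<^sub>m (fst V)"
    using invertible_mat_obtain[OF T(2,1)] .
  have V: "snd V g \<in> carrier_mat (fst V) (fst V)" and W: "snd W g \<in> carrier_mat (fst V) (fst V)"
    using is_repD(1)[OF assms(2,4)] is_repD(1)[OF assms(3,4)] d by auto
  have "mtrace (snd V g) = mtrace (U * T * snd V g)" using U V by simp
  also have "\<dots> = mtrace (U * (snd W g * T))" 
    unfolding assoc_mult_mat[OF U(1) T(1) V] T(3) ..
  also have "\<dots> = mtrace (snd W g * T * U)" using U T W by (intro mtrace_comm) auto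
  also have "\<dots> = mtrace (snd W g)" using U T W by (simp add: assoc_mult_mat[of "snd W g" "fst V" "fst V" T])
  finally show ?thesis .
qed

context
  fixes g assumes g: "g \<in> carrier G"
begin

lemma char_mult: "x \<in> carrier (rep_monoid G) \<Longrightarrow> y \<in> carrier (rep_monoid G) \<Longrightarrow>
  mtrace (snd (x \<otimes>\<^bsub>rep_monoid G\<^esub> y) g) = mtrace (snd x g) * mtrace (snd (y :: ('g, 'k) rep) g)"
  using is_repD(1)[of x, OF _ g] is_repD(1)[of y, OF _ g] by (simp add: rep_tensor_def mtrace_kronecker)

lemma char_one: "mtrace (snd (\<one>\<^bsub>rep_monoid G\<^esub> :: ('g, 'k) rep) g) = 1"
  by (simp add: mtrace_def)

lemma char_relations: "s \<in> rep_relations G \<Longrightarrow> frag_eval (\<lambda>V :: ('g, 'k) rep. mtrace (snd V g)) s = 0"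
proof (elim rep_relationsE)
  fix V W :: "('g, 'k) rep" assume "is_rep G V" "is_rep G W" "rep_iso G V W" "s = frag_of V - frag_of W"
  then show ?thesis using mtrace_iso g by (simp add: frag_eval_diff)
next
  fix V W :: "('g, 'k) rep" assume *: "is_rep G V" "is_rep G W" "s = frag_of (rep_sum V W) - frag_of V - frag_of W"
  then show ?thesis using is_repD(1)[OF *(1) g] is_repD(1)[OF *(2) g]
    by (simp add: frag_eval_diff rep_sum_def mtrace_four_block)
qed

lemma ring_character_cls: "is_rep G V \<Longrightarrow> ring_character g (cls V) = mtrace (snd V g)"
  unfolding ring_character_def cls_def
  by (rule Rep.lift_gen[OF char_mult char_one char_relations]) simp_all

lemma ring_character_hom: "ring_hom_ring RR (ring_of_type_algebra :: 'k ring) (ring_character g)"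
  unfolding ring_character_def RR_eq[symmetric]
  by (rule Rep.lift_hom[OF char_mult char_one char_relations])

end
end

lemma type_algebra_ops [simp]:
  "x \<oplus>\<^bsub>ring_of_type_algebra\<^esub> y = x + (y :: 'r::comm_ring_1)" "x \<otimes>\<^bsub>ring_of_type_algebra\<^esub> y = x * y"
  "\<one>\<^bsub>ring_of_type_algebra\<^esub> = (1::'r)" "\<zero>\<^bsub>ring_of_type_algebra\<^esub> = (0::'r)" "\<ominus>\<^bsub>ring_of_type_algebra\<^esub> x = - x"
  by (simp_all add: type_algebra_minus) (simp_all add: ring_of_type_algebra_def)

locale loc_rep_theory = rep_theory G K for G :: "('g, 'b) monoid_scheme" (structure) and K :: "'k::field_char_0 itself" +
  fixes P :: "nat set"
begin

sublocale Loc: ring_localization "rep_ring G :: (('g, 'k) rep \<Rightarrow>\<^sub>0 int) set ring" P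
  by (intro ring_localization.intro RR_ring)

lemma L_rep: "Loc.loc_ring = rep_ring_loc G P"
  by (simp add: Loc.loc_ring_def rep_ring_loc_def)

definition loc_character :: "'g \<Rightarrow> ('g, 'k) loc_class \<Rightarrow> 'k" where
  "loc_character g = Loc.T.lift (\<lambda>(x, a). ring_character g x * of_rat a)"

context
  fixes g assumes g: "g \<in> carrier G"
begin

interpretation c: ring_hom_ring RR "ring_of_type_algebra :: 'k ring" "ring_character g"
  by (rule ring_character_hom[OF g])

lemma loc_character_mult:
  "u \<in> carrier (RR \<times>\<times> Z_loc P) \<Longrightarrow> v \<in> carrier (RR \<times>\<times> Z_loc P) \<Longrightarrow>
    (\<lambda>(x, a). ring_character g x * of_rat a) (u \<otimes>\<^bsub>RR \<times>\<times> Z_loc P\<^esub> v) =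
    (\<lambda>(x, a). ring_character g x * of_rat a) u * (\<lambda>(x, a). ring_character g x * of_rat a) v"
  by (cases u; cases v) (auto simp: c.hom_mult of_rat_mult)

lemma loc_character_one: "(\<lambda>(x, a). ring_character g x * of_rat a) \<one>\<^bsub>RR \<times>\<times> Z_loc P\<^esub> = 1"
  using c.hom_one by simp

lemma loc_character_relations: "s \<in> tensor_relations RR (Z_loc P) \<Longrightarrow> frag_eval (\<lambda>(x, a). ring_character g x * of_rat a) s = 0"
  by (elim Loc.tensor_relationsE)
    (simp_all add: frag_eval_diff c.hom_add of_rat_add distrib_left distrib_right)

lemma loc_character_tensor: "x \<in> carrier RR \<Longrightarrow> a \<in> carrier (Z_loc P) \<Longrightarrow> loc_character g (Loc.tensor x a) = ring_character g x * of_rat a"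
  unfolding loc_character_def Loc.tensor_def
  by (subst Loc.T.lift_gen[OF loc_character_mult loc_character_one loc_character_relations]) simp_all

lemma loc_character_hom: "ring_hom_ring Loc.loc_ring (ring_of_type_algebra :: 'k ring) (loc_character g)"
  unfolding loc_character_def Loc.loc_ring_eq[symmetric]
  by (rule Loc.T.lift_hom[OF loc_character_mult loc_character_one loc_character_relations])

end
end

section \<open>Extension of scalars\<close>

text \<open>A ring homomorphism of the first factors carries each biadditivity relation to a biadditivity relation.\<close>

lemma tensor_map_presentation_map:
  assumes f: "ring_hom_ring R R' f"
  shows "presentation_map (R \<times>\<times> Z_loc P) (tensor_relations R (Z_loc P))
    (R' \<times>\<times> Z_loc P) (tensor_relations R' (Z_loc P)) (\<lambda>(x, a). (f x, a))"
proof -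
  interpret f: ring_hom_ring R R' f by fact
  interpret M: ring_localization R P by (intro ring_localization.intro f.R.ring_axioms)
  interpret N: ring_localization R' P by (intro ring_localization.intro f.S.ring_axioms)
  let ?f = "\<lambda>(x, a). (f x, a)"
  show ?thesis
  proof
    show "?f \<in> hom (R \<times>\<times> Z_loc P) (R' \<times>\<times> Z_loc P)"
      by (rule homI) auto
    show "?f \<one>\<^bsub>R \<times>\<times> Z_loc P\<^esub> = \<one>\<^bsub>R' \<times>\<times> Z_loc P\<^esub>" by simp
    fix s assume "s \<in> tensor_relations R (Z_loc P)"
    then have "frag_extend (\<lambda>x. frag_of (?f x)) s \<in> tensor_relations R' (Z_loc P)"
    proof (cases rule: M.tensor_relationsE)
      case (1 x y a)
      then have "frag_extend (\<lambda>x. frag_of (?f x)) s =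
          frag_of (f x \<oplus>\<^bsub>R'\<^esub> f y, a) - frag_of (f x, a) - frag_of (f y, a)"
        by (simp add: frag_extend_diff)
      moreover have "f x \<in> carrier R'" "f y \<in> carrier R'" using 1 by auto
      ultimately show ?thesis using 1(3) unfolding tensor_relations_def by blast
    next
      case (2 x a b)
      then have "frag_extend (\<lambda>x. frag_of (?f x)) s =
          frag_of (f x, a \<oplus>\<^bsub>Z_loc P\<^esub> b) - frag_of (f x, a) - frag_of (f x, b)"
        by (simp add: frag_extend_diff)
      moreover have "f x \<in> carrier R'" using 2 by auto
      ultimately show ?thesis using 2(2,3) unfolding tensor_relations_def by blast
    qed
    then show "N.T.cls (frag_extend (\<lambda>x. frag_of (?f x)) s) =
        \<zero>\<^bsub>presented_ring (R' \<times>\<times> Z_loc P) (tensor_relations R' (Z_loc P))\<^esub>"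
      by (rule N.T.cls_relation)
  qed
qed

locale scalar_extension = D: loc_rep_theory G K P + E: loc_rep_theory G L P
  for G :: "('g, 'b) monoid_scheme" (structure) and K :: "'k::field_char_0 itself"
    and L :: "'l::field_char_0 itself" and P :: "nat set" +
  fixes h :: "'k \<Rightarrow> 'l"
  assumes h: "field_hom h"
begin

lemma rep_ext_hom: "ring_hom_ring D.RR E.RR (rep_ring_ext G h)"
  using presentation_map.presented_map_hom[OF D.rep_ring_ext_presentation_map[OF h]]
  unfolding D.RR_eq E.RR_eq rep_ring_ext_def .

lemma rep_ext_cls:
  "is_rep G V \<Longrightarrow> rep_ring_ext G h (D.cls V) = E.cls (fst V, \<lambda>g. map_mat h (snd V g))"
  using presentation_map.presented_map_gen[OF D.rep_ring_ext_presentation_map[OF h], of V]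
  unfolding rep_ring_ext_def D.cls_def E.cls_def by simp

lemma loc_ext_hom: "ring_hom_ring D.Loc.loc_ring E.Loc.loc_ring (rep_ring_loc_ext G P h)"
  using presentation_map.presented_map_hom[OF tensor_map_presentation_map[OF rep_ext_hom, of P]]
  unfolding D.Loc.loc_ring_eq E.Loc.loc_ring_eq rep_ring_loc_ext_def tensor_map_def .

lemma loc_ext_tensor:
  "x \<in> carrier D.RR \<Longrightarrow> a \<in> carrier (Z_loc P) \<Longrightarrow>
    rep_ring_loc_ext G P h (D.Loc.tensor x a) = E.Loc.tensor (rep_ring_ext G h x) a"
  using presentation_map.presented_map_gen[OF tensor_map_presentation_map[OF rep_ext_hom, of P], of "(x, a)"]
  unfolding rep_ring_loc_ext_def tensor_map_def D.Loc.tensor_def E.Loc.tensor_def by simp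

definition ext_image where "ext_image = rep_ring_loc_ext G P h ` carrier D.Loc.loc_ring"

lemma ext_image_subring: "subring ext_image E.Loc.loc_ring"
  unfolding ext_image_def using ring_hom_ring.img_is_subring[OF loc_ext_hom ring.carrier_is_subring[OF D.Loc.loc_ring_is_ring]] .

text \<open>The functions on $G$ that are characters of elements in the image of extension of scalars.
Only their values on the carrier of $G$ matter.\<close>

definition ext_characters :: "('g \<Rightarrow> 'l) set" where
  "ext_characters = {f. \<exists>z\<in>ext_image. \<forall>g\<in>carrier G. f g = E.loc_character g z}"

lemma ext_charactersI: "z \<in> ext_image \<Longrightarrow> (\<And>g. g \<in> carrier G \<Longrightarrow> E.loc_character g z = f g) \<Longrightarrow> f \<in> ext_characters"
  unfolding ext_characters_def by (intro CollectI bexI[of _ z]) simp_all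

lemma tensor_in_ext_image:
  assumes x: "x \<in> carrier D.RR" and a: "a \<in> carrier (Z_loc P)"
  shows "E.Loc.tensor (rep_ring_ext G h x) a \<in> ext_image"
  unfolding ext_image_def loc_ext_tensor[OF x a, symmetric]
  by (rule imageI) (rule D.Loc.tensor_closed[OF x a])

lemma loc_character_ring_ops:
  assumes "g \<in> carrier G" "z \<in> carrier E.Loc.loc_ring" "w \<in> carrier E.Loc.loc_ring"
  shows "E.loc_character g (z \<oplus>\<^bsub>E.Loc.loc_ring\<^esub> w) = E.loc_character g z + E.loc_character g w"
    "E.loc_character g (z \<otimes>\<^bsub>E.Loc.loc_ring\<^esub> w) = E.loc_character g z * E.loc_character g w"
    "E.loc_character g (\<ominus>\<^bsub>E.Loc.loc_ring\<^esub> w) = - E.loc_character g w"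
proof -
  interpret c: ring_hom_ring E.Loc.loc_ring "ring_of_type_algebra :: 'l ring" "E.loc_character g"
    by (rule E.loc_character_hom[OF assms(1)])
  show "E.loc_character g (z \<oplus>\<^bsub>E.Loc.loc_ring\<^esub> w) = E.loc_character g z + E.loc_character g w"
    "E.loc_character g (z \<otimes>\<^bsub>E.Loc.loc_ring\<^esub> w) = E.loc_character g z * E.loc_character g w"
    "E.loc_character g (\<ominus>\<^bsub>E.Loc.loc_ring\<^esub> w) = - E.loc_character g w"
    using c.hom_add[OF assms(2,3)] c.hom_mult[OF assms(2,3)] c.hom_a_inv[OF assms(3)] by simp_all
qed

lemma ext_image_sub: "z \<in> ext_image \<Longrightarrow> z \<in> carrier E.Loc.loc_ring"
  using subringE(1)[OF ext_image_subring] by blast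

lemma ext_characters_add:
  assumes "f \<in> ext_characters" "f' \<in> ext_characters"
  shows "(\<lambda>g. f g + f' g) \<in> ext_characters"
proof -
  obtain z w where z: "z \<in> ext_image" "\<And>g. g \<in> carrier G \<Longrightarrow> f g = E.loc_character g z"
    and w: "w \<in> ext_image" "\<And>g. g \<in> carrier G \<Longrightarrow> f' g = E.loc_character g w"
    using assms unfolding ext_characters_def by blast
  have "z \<oplus>\<^bsub>E.Loc.loc_ring\<^esub> w \<in> ext_image" using z(1) w(1) by (rule subringE(7)[OF ext_image_subring])
  moreover have "f g + f' g = E.loc_character g (z \<oplus>\<^bsub>E.Loc.loc_ring\<^esub> w)" if "g \<in> carrier G" for g
    using loc_character_ring_ops[OF that ext_image_sub[OF z(1)] ext_image_sub[OF w(1)]] z(2)[OF that] w(2)[OF that] by simp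
  ultimately show ?thesis unfolding ext_characters_def by blast
qed

lemma ext_characters_mult:
  assumes "f \<in> ext_characters" "f' \<in> ext_characters"
  shows "(\<lambda>g. f g * f' g) \<in> ext_characters"
proof -
  obtain z w where z: "z \<in> ext_image" "\<And>g. g \<in> carrier G \<Longrightarrow> f g = E.loc_character g z"
    and w: "w \<in> ext_image" "\<And>g. g \<in> carrier G \<Longrightarrow> f' g = E.loc_character g w"
    using assms unfolding ext_characters_def by blast
  have "z \<otimes>\<^bsub>E.Loc.loc_ring\<^esub> w \<in> ext_image" using z(1) w(1) by (rule subringE(6)[OF ext_image_subring])
  moreover have "f g * f' g = E.loc_character g (z \<otimes>\<^bsub>E.Loc.loc_ring\<^esub> w)" if "g \<in> carrier G" for g
    using loc_character_ring_ops[OF that ext_image_sub[OF z(1)] ext_image_sub[OF w(1)]] z(2)[OF that] w(2)[OF that] by simp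
  ultimately show ?thesis unfolding ext_characters_def by blast
qed

lemma ext_characters_minus:
  assumes "f \<in> ext_characters"
  shows "(\<lambda>g. - f g) \<in> ext_characters"
proof -
  obtain z where z: "z \<in> ext_image" "\<And>g. g \<in> carrier G \<Longrightarrow> f g = E.loc_character g z"
    using assms unfolding ext_characters_def by blast
  have "\<ominus>\<^bsub>E.Loc.loc_ring\<^esub> z \<in> ext_image" using z(1) by (rule subringE(5)[OF ext_image_subring])
  moreover have "- f g = E.loc_character g (\<ominus>\<^bsub>E.Loc.loc_ring\<^esub> z)" if "g \<in> carrier G" for g
    using loc_character_ring_ops(3)[OF that ext_image_sub[OF z(1)] ext_image_sub[OF z(1)]] z(2)[OF that] by simp
  ultimately show ?thesis unfolding ext_characters_def by blast
qed

lemma ext_characters_const: 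
  assumes a: "a \<in> carrier (Z_loc P)"
  shows "(\<lambda>_. of_rat a) \<in> ext_characters"
proof -
  interpret f: ring_hom_ring D.RR E.RR "rep_ring_ext G h" by (rule rep_ext_hom)
  have "E.loc_character g (E.Loc.tensor \<one>\<^bsub>E.RR\<^esub> a) = of_rat a" if g: "g \<in> carrier G" for g
  proof -
    interpret c: ring_hom_ring E.RR "ring_of_type_algebra :: 'l ring" "E.ring_character g"
      by (rule E.ring_character_hom[OF g])
    show ?thesis using E.loc_character_tensor[OF g f.S.one_closed a] c.hom_one by simp
  qed
  then show ?thesis
    using tensor_in_ext_image[OF f.R.one_closed a] unfolding f.hom_one by (intro ext_charactersI)
qed

lemma ext_characters_rep:
  assumes V: "is_rep G (V :: ('g, 'k) rep)"
  shows "(\<lambda>g. mtrace (map_mat h (snd V g))) \<in> ext_characters"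
proof -
  let ?W = "(fst V, \<lambda>g. map_mat h (snd V g))"
  have W: "is_rep G ?W" by (rule D.is_rep_map[OF h V])
  have 1: "1 \<in> carrier (Z_loc P)" using ring.ring_simprules(6)[OF Z_loc_ring] by simp
  have "E.loc_character g (E.Loc.tensor (E.cls ?W) 1) = mtrace (map_mat h (snd V g))" if g: "g \<in> carrier G" for g
    using E.loc_character_tensor[OF g E.cls_closed[OF W] 1] E.ring_character_cls[OF g W] by simp
  then show ?thesis
    using tensor_in_ext_image[OF D.cls_closed[OF V] 1] unfolding rep_ext_cls[OF V] by (intro ext_charactersI)
qed

end

section \<open>Rank normal form of a matrix\<close>

definition inverse_pair :: "nat \<Rightarrow> 'a::semiring_1 mat \<Rightarrow> 'a mat \<Rightarrow> bool" where
  "inverse_pair n P P' \<longleftrightarrow> P \<in> carrier_mat n n \<and> P' \<in> carrier_mat n n \<and> P * P' = 1\<^sub>m n \<and> P' * P = 1\<^sub>m n"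

lemma inverse_pairD:
  assumes "inverse_pair n P P'"
  shows "P \<in> carrier_mat n n" "P' \<in> carrier_mat n n" "P * P' = 1\<^sub>m n" "P' * P = 1\<^sub>m n"
  using assms by (auto simp: inverse_pair_def)

lemma inverse_pair_mult:
  assumes "inverse_pair n P P'" "inverse_pair n Q Q'"
  shows "inverse_pair n (P * Q) (Q' * P')"
proof -
  note P = inverse_pairD[OF assms(1)] and Q = inverse_pairD[OF assms(2)]
  have cancel: "A * B * (C * D) = 1\<^sub>m n"
    if "A \<in> carrier_mat n n" "B \<in> carrier_mat n n" "C \<in> carrier_mat n n" "D \<in> carrier_mat n n"
      "B * C = 1\<^sub>m n" "A * D = 1\<^sub>m n" for A B C D :: "'a mat"
  proof -
    have "A * B * (C * D) = A * (B * C * D)"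
      using that(1-4) by (simp add: assoc_mult_mat[of _ n n _ n _ n])
    then show ?thesis using that by simp
  qed
  show ?thesis
    unfolding inverse_pair_def
    using cancel[OF P(1) Q(1) Q(2) P(2) Q(3) P(3)] cancel[OF Q(2) P(2) P(1) Q(1) P(4) Q(4)] P Q
    by simp
qed

lemma inverse_pair_one: "inverse_pair n (1\<^sub>m n) (1\<^sub>m n)"
  by (simp add: inverse_pair_def)

lemma mult_diag_block_mat:
  fixes A :: "'a::semiring_1 mat"
  assumes "A \<in> carrier_mat n m" "B \<in> carrier_mat m k"
  shows "four_block_mat (1\<^sub>m p) (0\<^sub>m p m) (0\<^sub>m n p) A * four_block_mat (1\<^sub>m p) (0\<^sub>m p k) (0\<^sub>m m p) B =
    four_block_mat (1\<^sub>m p) (0\<^sub>m p k) (0\<^sub>m n p) (A * B)"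
  using assms
  by (subst mult_four_block_mat[OF one_carrier_mat zero_carrier_mat zero_carrier_mat assms(1)
        one_carrier_mat zero_carrier_mat zero_carrier_mat assms(2)]) simp

lemma inverse_pair_block:
  assumes "inverse_pair n P P'"
  shows "inverse_pair (p + n) (four_block_mat (1\<^sub>m p) (0\<^sub>m p n) (0\<^sub>m n p) P)
    (four_block_mat (1\<^sub>m p) (0\<^sub>m p n) (0\<^sub>m n p) P')"
  using inverse_pairD[OF assms] unfolding inverse_pair_def by (simp add: mult_diag_block_mat)

text \<open>One step of Gaussian elimination in block form: an identity block clears its row and its
column.\<close>

lemma clear_block:
  fixes b :: "'a::comm_ring_1 mat"
  assumes b: "b \<in> carrier_mat p k" and c: "c \<in> carrier_mat n p" and d: "d \<in> carrier_mat n k"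
  obtains L L' U U' where "inverse_pair (p + n) L L'" "inverse_pair (p + k) U U'"
    "L * four_block_mat (1\<^sub>m p) b c d * U = four_block_mat (1\<^sub>m p) (0\<^sub>m p k) (0\<^sub>m n p) (d - c * b)"
proof -
  let ?L = "\<lambda>c. four_block_mat (1\<^sub>m p) (0\<^sub>m p n) c (1\<^sub>m n)"
    and ?U = "\<lambda>b. four_block_mat (1\<^sub>m p) b (0\<^sub>m k p) (1\<^sub>m k)"
  have Lmult: "?L c * four_block_mat (1\<^sub>m p) x y z = four_block_mat (1\<^sub>m p) x (c + y) (c * x + z)"
    if "c \<in> carrier_mat n p" "x \<in> carrier_mat p l" "y \<in> carrier_mat n p" "z \<in> carrier_mat n l"
    for c x y z :: "'a mat" and l
    using that by (subst mult_four_block_mat[OF one_carrier_mat zero_carrier_mat that(1) one_carrier_mat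
          one_carrier_mat that(2-4)]) simp
  have Umult: "four_block_mat (1\<^sub>m p) x y z * ?U b = four_block_mat (1\<^sub>m p) (b + x) y (y * b + z)"
    if "b \<in> carrier_mat p k" "x \<in> carrier_mat p k" "y \<in> carrier_mat l p" "z \<in> carrier_mat l k"
    for b x y z :: "'a mat" and l
    using that by (subst mult_four_block_mat[OF one_carrier_mat that(2-4) one_carrier_mat that(1)
          zero_carrier_mat one_carrier_mat]) simp
  have b0: "- b + b = 0\<^sub>m p k" "b + - b = 0\<^sub>m p k" and c0: "- c + c = 0\<^sub>m n p" "c + - c = 0\<^sub>m n p"
    using b c by (auto intro!: eq_matI)
  have m0: "- 0\<^sub>m i j = (0\<^sub>m i j :: 'a mat)" for i j by (auto intro!: eq_matI)
  have mb: "- b \<in> carrier_mat p k" and mc: "- c \<in> carrier_mat n p" using b c by auto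
  have L: "inverse_pair (p + n) (?L (- c)) (?L c)"
    using Lmult[OF mc zero_carrier_mat c one_carrier_mat] Lmult[OF c zero_carrier_mat mc one_carrier_mat] c mc c0
    by (simp add: inverse_pair_def)
  have U: "inverse_pair (p + k) (?U (- b)) (?U b)"
    using Umult[OF mb b zero_carrier_mat one_carrier_mat] Umult[OF b mb zero_carrier_mat one_carrier_mat] b mb b0 m0
    by (simp add: inverse_pair_def)
  have cb: "- c * b + d = d - c * b"
    using b c d by (intro eq_matI) (auto simp: scalar_prod_def sum_negf)
  have "?L (- c) * four_block_mat (1\<^sub>m p) b c d = four_block_mat (1\<^sub>m p) b (0\<^sub>m n p) (d - c * b)"
    using Lmult[OF mc b c d] by (simp add: c0 cb)
  also have "\<dots> * ?U (- b) = four_block_mat (1\<^sub>m p) (0\<^sub>m p k) (0\<^sub>m n p) (d - c * b)"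
    using Umult[OF mb b zero_carrier_mat minus_carrier_mat[OF mult_carrier_mat[OF c b]], of d] b c d
    by (simp add: b0 m0 left_add_zero_mat[OF minus_carrier_mat[OF mult_carrier_mat[OF c b]]])
  finally show ?thesis using that[OF L U] by simp
qed

lemma two_sided_assoc:
  fixes A :: "'a::semiring_0 mat"
  assumes A: "A \<in> carrier_mat n m" and P: "P \<in> carrier_mat n n" "R \<in> carrier_mat n n"
    and Q: "Q \<in> carrier_mat m m" "T \<in> carrier_mat m m"
  shows "R * (P * A * Q) * T = (R * P) * A * (Q * T)"
proof -
  have PA: "P * A \<in> carrier_mat n m" using P(1) A by (rule mult_carrier_mat)
  have "R * (P * A * Q) * T = R * (P * A) * Q * T"
    by (simp only: assoc_mult_mat[OF P(2) PA Q(1)])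
  also have "\<dots> = R * P * A * Q * T"
    by (simp only: assoc_mult_mat[OF P(2,1) A])
  also have "\<dots> = (R * P) * A * (Q * T)"
    by (rule assoc_mult_mat[OF mult_carrier_mat[OF mult_carrier_mat[OF P(2,1)] A] Q])
  finally show ?thesis .
qed

text \<open>The $n \times m$ matrix with an identity block of size $r$ in the upper left corner and zeros
elsewhere.\<close>

definition rank_form :: "nat \<Rightarrow> nat \<Rightarrow> nat \<Rightarrow> 'a::zero_neq_one mat" where
  "rank_form n m r = mat n m (\<lambda>(i, j). if i = j \<and> i < r then 1 else 0)"

lemma rank_form_0: "rank_form n m 0 = 0\<^sub>m n m"
  by (rule eq_matI) (simp_all add: rank_form_def)

lemma rank_form_block: "four_block_mat (1\<^sub>m 1) (0\<^sub>m 1 m) (0\<^sub>m n 1) (rank_form n m r) = rank_form (1 + n) (1 + m) (Suc r)"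
  by (rule eq_matI) (auto simp: rank_form_def)

lemma move_pivot:
  fixes A :: "'a::field mat"
  assumes A: "A \<in> carrier_mat n m" and nz: "A \<noteq> 0\<^sub>m n m"
  obtains P P' Q Q' where "inverse_pair n P P'" "inverse_pair m Q Q'" "(P * A * Q) $$ (0, 0) = 1" "n > 0" "m > 0"
proof -
  have "\<exists>i j. i < n \<and> j < m \<and> A $$ (i, j) \<noteq> 0"
  proof (rule ccontr)
    assume "\<not> ?thesis"
    then have "A = 0\<^sub>m n m" using A by (intro eq_matI) auto
    then show False using nz by simp
  qed
  then obtain i j where ij: "i < n" "j < m" "A $$ (i, j) \<noteq> 0" by blast
  let ?a = "A $$ (i, j)"
  let ?S = "swaprows_mat n 0 i :: 'a mat" and ?Q = "swaprows_mat m 0 j :: 'a mat"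
  have S: "inverse_pair n ?S ?S" and Q: "inverse_pair m ?Q ?Q"
    using ij swaprows_mat_inv[of 0 n i] swaprows_mat_inv[of 0 m j] by (auto simp: inverse_pair_def)
  have smult: "(x \<cdot>\<^sub>m 1\<^sub>m n) * (y \<cdot>\<^sub>m 1\<^sub>m n) = 1\<^sub>m n" if "x * y = 1" for x y :: 'a
    using that by (subst mult_smult_assoc_mat[of _ n n]) (auto intro!: eq_matI)
  have scale: "inverse_pair n (inverse ?a \<cdot>\<^sub>m 1\<^sub>m n) (?a \<cdot>\<^sub>m 1\<^sub>m n)"
    using smult[of ?a "inverse ?a"] smult[of "inverse ?a" ?a] ij(3) by (simp add: inverse_pair_def)
  have SA: "?S * A \<in> carrier_mat n m" using A by (rule mult_carrier_mat[OF swaprows_mat_carrier])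
  then have SAQ: "?S * A * ?Q \<in> carrier_mat n m" by (rule mult_carrier_mat) (rule swaprows_mat_carrier)
  have "?S * A * ?Q = swapcols 0 j (swaprows 0 i A)"
    using A ij SA by (subst swapcols_mat[of _ n m]) (simp_all add: swaprows_mat[of A n m])
  then have pivot: "(?S * A * ?Q) $$ (0, 0) = ?a" using A ij by simp
  have "inverse ?a \<cdot>\<^sub>m 1\<^sub>m n * ?S * A * ?Q = (inverse ?a \<cdot>\<^sub>m ?S) * A * ?Q"
    unfolding mult_smult_assoc_mat[OF one_carrier_mat swaprows_mat_carrier] left_mult_one_mat[OF swaprows_mat_carrier] ..
  also have "\<dots> = inverse ?a \<cdot>\<^sub>m (?S * A * ?Q)"
    unfolding mult_smult_assoc_mat[OF swaprows_mat_carrier A] mult_smult_assoc_mat[OF SA swaprows_mat_carrier] ..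
  finally have "inverse ?a \<cdot>\<^sub>m 1\<^sub>m n * ?S * A * ?Q = inverse ?a \<cdot>\<^sub>m (?S * A * ?Q)" .
  then have "(inverse ?a \<cdot>\<^sub>m 1\<^sub>m n * ?S * A * ?Q) $$ (0, 0) = 1"
    using pivot SAQ ij by simp
  then show ?thesis using that[OF inverse_pair_mult[OF scale S] Q] ij by simp
qed

text \<open>A nonzero entry is moved to the corner and scaled to 1, the block elimination clears its row
and column, and induction treats the remaining block.\<close>

theorem rank_normal_form:
  fixes A :: "'a::field mat"
  assumes "A \<in> carrier_mat n m"
  shows "\<exists>P P' Q Q' r. inverse_pair n P P' \<and> inverse_pair m Q Q' \<and> r \<le> n \<and> r \<le> m \<and> P * A * Q = rank_form n m r"
  using assms
proof (induction n arbitrary: m A)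
  case 0
  have "1\<^sub>m 0 * A * 1\<^sub>m m = rank_form 0 m 0" using 0 by (intro eq_matI) (auto simp: rank_form_def)
  then show ?case by (intro exI[of _ "1\<^sub>m 0"] exI[of _ "1\<^sub>m m"] exI[of _ 0]) (simp add: inverse_pair_one)
next
  case (Suc n m A)
  show ?case
  proof (cases "A = 0\<^sub>m (Suc n) m")
    case True
    have "1\<^sub>m (Suc n) * A * 1\<^sub>m m = rank_form (Suc n) m 0" unfolding True rank_form_0 by simp
    then show ?thesis
      by (intro exI[of _ "1\<^sub>m (Suc n)"] exI[of _ "1\<^sub>m m"] exI[of _ 0]) (simp add: inverse_pair_one)
  next
    case False
    obtain P P' Q Q' where PQ: "inverse_pair (Suc n) P P'" "inverse_pair m Q Q'" "(P * A * Q) $$ (0, 0) = 1" "m > 0"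
      by (rule move_pivot[OF Suc.prems False])
    obtain k where m: "m = 1 + k" using PQ(4) by (cases m) auto
    define B where "B = P * A * Q"
    have B00: "B $$ (0, 0) = 1" unfolding B_def by (rule PQ(3))
    have B: "B \<in> carrier_mat (1 + n) (1 + k)"
      using mult_carrier_mat[OF mult_carrier_mat[OF inverse_pairD(1)[OF PQ(1)] Suc.prems] inverse_pairD(1)[OF PQ(2)]]
      by (simp add: B_def m)
    obtain a b c d where abcd: "split_block B 1 1 = (a, b, c, d)" by (cases "split_block B 1 1") auto
    have a1: "a = 1\<^sub>m 1"
    proof (rule eq_matI)
      fix i j assume "i < dim_row (1\<^sub>m 1 :: 'a mat)" "j < dim_col (1\<^sub>m 1 :: 'a mat)"
      then show "a $$ (i, j) = 1\<^sub>m 1 $$ (i, j)"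
        using abcd B00 unfolding split_block_def Let_def by auto
    qed (use abcd in \<open>auto simp: split_block_def Let_def\<close>)
    note bl = split_block[OF abcd, of n k, OF carrier_matD[OF B]]
    obtain L L' U U' where LU: "inverse_pair (1 + n) L L'" "inverse_pair (1 + k) U U'"
      "L * four_block_mat (1\<^sub>m 1) b c d * U = four_block_mat (1\<^sub>m 1) (0\<^sub>m 1 k) (0\<^sub>m n 1) (d - c * b)"
      by (rule clear_block[OF bl(2,3,4)])
    have d': "d - c * b \<in> carrier_mat n k" using bl(2-4) by (intro minus_carrier_mat mult_carrier_mat)
    obtain R R' T T' r where RT: "inverse_pair n R R'" "inverse_pair k T T'" "r \<le> n" "r \<le> k"
      "R * (d - c * b) * T = rank_form n k r"
      using Suc.IH[OF d'] by (elim exE conjE)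
    let ?E = "\<lambda>l A. four_block_mat (1\<^sub>m 1) (0\<^sub>m 1 l) (0\<^sub>m l 1) A"
    have fin: "?E n R * (L * B * U) * ?E k T = rank_form (1 + n) (1 + k) (Suc r)"
      unfolding bl(5)[unfolded a1] LU(3) mult_diag_block_mat[OF inverse_pairD(1)[OF RT(1)] d']
        mult_diag_block_mat[OF mult_carrier_mat[OF inverse_pairD(1)[OF RT(1)] d'] inverse_pairD(1)[OF RT(2)]]
        RT(5) by (rule rank_form_block)
    let ?P = "?E n R * (L * P)" and ?Q = "Q * U * ?E k T"
    have P: "inverse_pair (1 + n) P P'" and Q: "inverse_pair (1 + k) Q Q'" using PQ(1,2) by (simp_all add: m)
    note E = inverse_pair_block[OF RT(1), of 1] inverse_pair_block[OF RT(2), of 1]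
    note P' = inverse_pair_mult[OF E(1) inverse_pair_mult[OF LU(1) P]]
      and Q' = inverse_pair_mult[OF inverse_pair_mult[OF Q LU(2)] E(2)]
    have A: "A \<in> carrier_mat (1 + n) (1 + k)" using Suc.prems by (simp add: m)
    have "?P * A * ?Q = ?E n R * (L * P * A * (Q * U)) * ?E k T"
      by (rule two_sided_assoc[OF A inverse_pairD(1)[OF inverse_pair_mult[OF LU(1) P]] inverse_pairD(1)[OF E(1)]
            inverse_pairD(1)[OF inverse_pair_mult[OF Q LU(2)]] inverse_pairD(1)[OF E(2)], symmetric])
    also have "L * P * A * (Q * U) = L * B * U"
      by (rule two_sided_assoc[OF A inverse_pairD(1)[OF P] inverse_pairD(1)[OF LU(1)]
            inverse_pairD(1)[OF Q] inverse_pairD(1)[OF LU(2)], folded B_def, symmetric])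
    also have "?E n R * (L * B * U) * ?E k T = rank_form (Suc n) m (Suc r)" unfolding fin by (simp add: m)
    finally have "?P * A * ?Q = rank_form (Suc n) m (Suc r)" .
    moreover have "Suc r \<le> Suc n" "Suc r \<le> m" using RT m by auto
    ultimately show ?thesis
      using P'[unfolded plus_1_eq_Suc] Q'[folded m] by (intro exI conjI)
  qed
qed

section \<open>Representations with equal characters\<close>

definition matsum :: "nat \<Rightarrow> nat \<Rightarrow> 'g set \<Rightarrow> ('g \<Rightarrow> 'a::comm_monoid_add mat) \<Rightarrow> 'a mat" where
  "matsum n m S F = mat n m (\<lambda>ij. \<Sum>g\<in>S. F g $$ ij)"

lemma matsum_carrier [simp]: "matsum n m S F \<in> carrier_mat n m" "dim_row (matsum n m S F) = n" "dim_col (matsum n m S F) = m"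
  by (simp_all add: matsum_def)

lemma matsum_index: "i < n \<Longrightarrow> j < m \<Longrightarrow> matsum n m S F $$ (i, j) = (\<Sum>g\<in>S. F g $$ (i, j))"
  by (simp add: matsum_def)

lemma matsum_cong: "(\<And>g. g \<in> S \<Longrightarrow> F g = F' g) \<Longrightarrow> matsum n m S F = matsum n m S F'"
  by (simp add: matsum_def cong: sum.cong)

lemma matsum_add:
  "(\<And>g. g \<in> S \<Longrightarrow> F g \<in> carrier_mat n m) \<Longrightarrow> (\<And>g. g \<in> S \<Longrightarrow> F' g \<in> carrier_mat n m) \<Longrightarrow>
    matsum n m S (\<lambda>g. F g + F' g) = matsum n m S F + matsum n m S F'"
proof (rule eq_matI)
  assume F': "\<And>g. g \<in> S \<Longrightarrow> F' g \<in> carrier_mat n m"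
  fix i j assume "i < dim_row (matsum n m S F + matsum n m S F')" "j < dim_col (matsum n m S F + matsum n m S F')"
  then show "matsum n m S (\<lambda>g. F g + F' g) $$ (i, j) = (matsum n m S F + matsum n m S F') $$ (i, j)"
    using carrier_matD[OF F'] by (simp add: matsum_index sum.distrib[symmetric])
qed simp_all

lemma matsum_const:
  "B \<in> carrier_mat n m \<Longrightarrow> matsum n m S (\<lambda>_. B) = of_nat (card S) \<cdot>\<^sub>m (B :: 'a::semiring_1 mat)"
  by (rule eq_matI) (auto simp: matsum_index)

lemma matsum_left:
  fixes A :: "'a::semiring_0 mat"
  assumes A: "A \<in> carrier_mat k n" and F: "\<And>g. g \<in> S \<Longrightarrow> F g \<in> carrier_mat n m"
  shows "A * matsum n m S F = matsum k m S (\<lambda>g. A * F g)"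
proof (rule eq_matI)
  fix i j assume "i < dim_row (matsum k m S (\<lambda>g. A * F g))" "j < dim_col (matsum k m S (\<lambda>g. A * F g))"
  then have ij: "i < k" "j < m" by simp_all
  have "(A * matsum n m S F) $$ (i, j) = (\<Sum>l\<in>{0..<n}. \<Sum>g\<in>S. A $$ (i, l) * F g $$ (l, j))"
    using ij by (subst mat_mult_index_sum[OF A matsum_carrier(1)]) (simp_all add: matsum_index sum_distrib_left)
  also have "\<dots> = (\<Sum>g\<in>S. (A * F g) $$ (i, j))"
    by (subst sum.swap) (intro sum.cong refl, use ij in \<open>simp add: mat_mult_index_sum[OF A F] del: index_mult_mat\<close>)
  finally show "(A * matsum n m S F) $$ (i, j) = matsum k m S (\<lambda>g. A * F g) $$ (i, j)"
    using ij by (simp add: matsum_index del: index_mult_mat)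
qed (use A in auto)

lemma matsum_right:
  fixes A :: "'a::semiring_0 mat"
  assumes A: "A \<in> carrier_mat m k" and F: "\<And>g. g \<in> S \<Longrightarrow> F g \<in> carrier_mat n m"
  shows "matsum n m S F * A = matsum n k S (\<lambda>g. F g * A)"
proof (rule eq_matI)
  fix i j assume "i < dim_row (matsum n k S (\<lambda>g. F g * A))" "j < dim_col (matsum n k S (\<lambda>g. F g * A))"
  then have ij: "i < n" "j < k" by simp_all
  have "(matsum n m S F * A) $$ (i, j) = (\<Sum>l\<in>{0..<m}. \<Sum>g\<in>S. F g $$ (i, l) * A $$ (l, j))"
    using ij by (subst mat_mult_index_sum[OF matsum_carrier(1) A]) (simp_all add: matsum_index sum_distrib_right)
  also have "\<dots> = (\<Sum>g\<in>S. (F g * A) $$ (i, j))"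
    by (subst sum.swap) (intro sum.cong refl, use ij in \<open>simp add: mat_mult_index_sum[OF F A] del: index_mult_mat\<close>)
  finally show "(matsum n m S F * A) $$ (i, j) = matsum n k S (\<lambda>g. F g * A) $$ (i, j)"
    using ij by (simp add: matsum_index del: index_mult_mat)
qed (use A in auto)

lemma (in group) sum_translate:
  assumes s: "s \<in> carrier G"
  shows "(\<Sum>g\<in>carrier G. F (s \<otimes> g)) = (\<Sum>g\<in>carrier G. F g)"
proof (rule sum.reindex_bij_witness[of _ "\<lambda>g. inv s \<otimes> g" "\<lambda>g. s \<otimes> g"])
  fix g assume g: "g \<in> carrier G"
  show "inv s \<otimes> (s \<otimes> g) = g" "s \<otimes> (inv s \<otimes> g) = g" using s g by (simp_all add: m_assoc[symmetric])
qed (use s in auto)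

lemma (in group) matsum_translate:
  "s \<in> carrier G \<Longrightarrow> matsum n m (carrier G) (\<lambda>g. F (s \<otimes> g)) = matsum n m (carrier G) F"
  using sum_translate[of s "\<lambda>g. F g $$ ij" for ij] by (simp add: matsum_def)

context rep_theory begin

text \<open>Averaging $W(g) E V(g)^{-1}$ over the group makes an arbitrary matrix $E$ commute with the two
actions, because translation permutes the summands.\<close>

lemma averaged_intertwiner:
  assumes V: "is_rep G (V :: ('g, 'k) rep)" and W: "is_rep G W" and E: "E \<in> carrier_mat (fst W) (fst V)"
    and s: "s \<in> carrier G"
  defines "T \<equiv> matsum (fst W) (fst V) (carrier G) (\<lambda>g. snd W g * E * snd V (inv g))"
  shows "snd W s * T = T * snd V s"
proof -
  note Vc = is_repD(1)[OF V] and Wc = is_repD(1)[OF W]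
  let ?n = "fst V" and ?m = "fst W"
  have car: "snd W g * E * snd V (inv g) \<in> carrier_mat ?m ?n" if "g \<in> carrier G" for g
    using Vc[OF inv_closed[OF that]] Wc[OF that] E by simp
  have "snd W s * T = matsum ?m ?n (carrier G) (\<lambda>g. snd W s * (snd W g * E * snd V (inv g)))"
    unfolding T_def by (rule matsum_left[OF Wc[OF s] car])
  also have "\<dots> = matsum ?m ?n (carrier G) (\<lambda>g. (snd W (s \<otimes> g) * E * snd V (inv (s \<otimes> g))) * snd V s)"
  proof (rule matsum_cong)
    fix g assume g: "g \<in> carrier G"
    let ?B = "snd V (inv g)"
    have B: "?B \<in> carrier_mat ?n ?n" using g by (intro Vc) simp
    have "inv (s \<otimes> g) \<otimes> s = inv g" using s g by (simp add: inv_mult_group m_assoc)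
    then have "?B = snd V (inv (s \<otimes> g)) * snd V s" using is_repD(2)[OF V, of "inv (s \<otimes> g)" s] s g by simp
    moreover have "snd W s * (snd W g * E * ?B) = snd W s * snd W g * E * ?B"
      using assoc_mult_mat[OF Wc[OF s] mult_carrier_mat[OF Wc[OF g] E] B] assoc_mult_mat[OF Wc[OF s] Wc[OF g] E] by simp
    moreover have "snd W s * snd W g * E \<in> carrier_mat ?m ?n"
      using Wc[OF s] Wc[OF g] E by simp
    ultimately show "snd W s * (snd W g * E * ?B) = (snd W (s \<otimes> g) * E * snd V (inv (s \<otimes> g))) * snd V s"
      using assoc_mult_mat[of "snd W s * snd W g * E" ?m ?n "snd V (inv (s \<otimes> g))" ?n "snd V s" ?n]
        Vc[OF s] Vc[of "inv (s \<otimes> g)"] s g is_repD(2)[OF W s g]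
      by (metis inv_closed m_closed)
  qed
  also have "\<dots> = matsum ?m ?n (carrier G) (\<lambda>g. (snd W g * E * snd V (inv g)) * snd V s)"
    by (rule matsum_translate[OF s])
  also have "\<dots> = T * snd V s"
    unfolding T_def by (rule matsum_right[OF Vc[OF s] car, symmetric])
  finally show ?thesis .
qed

definition unit_mat :: "nat \<Rightarrow> nat \<Rightarrow> nat \<Rightarrow> nat \<Rightarrow> 'a::zero_neq_one mat" where
  "unit_mat n m i j = mat n m (\<lambda>(k, l). if k = i \<and> l = j then 1 else 0)"

lemma unit_mat_sandwich:
  fixes A :: "'a::semiring_1 mat"
  assumes A: "A \<in> carrier_mat n n" and B: "B \<in> carrier_mat m m" and ij: "i < n" "j < m" "k < n" "l < m"
  shows "(A * unit_mat n m i j * B) $$ (k, l) = A $$ (k, i) * B $$ (j, l)"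
proof -
  have E: "unit_mat n m i j \<in> carrier_mat n m" by (simp add: unit_mat_def)
  have "(A * unit_mat n m i j) $$ (k, l') = (if l' = j then A $$ (k, i) else 0)" if "l' < m" for l'
  proof -
    have "(A * unit_mat n m i j) $$ (k, l') = (\<Sum>a\<in>{0..<n}. A $$ (k, a) * unit_mat n m i j $$ (a, l'))"
      by (rule mat_mult_index_sum[OF A E ij(3) that])
    also have "\<dots> = (\<Sum>a\<in>{0..<n}. if a = i then (if l' = j then A $$ (k, i) else 0) else 0)"
      using that by (intro sum.cong) (auto simp: unit_mat_def)
    finally show ?thesis using ij by simp
  qed
  then have "(A * unit_mat n m i j * B) $$ (k, l) = (\<Sum>a\<in>{0..<m}. if a = j then A $$ (k, i) * B $$ (j, l) else 0)"
    unfolding mat_mult_index_sum[OF mult_carrier_mat[OF A E] B ij(3,4)] by (intro sum.cong) auto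
  then show ?thesis using ij by simp
qed

text \<open>If all averages of matrix units vanished, then so would the sum of their entries at the positions of the
units, and that sum is the given sum of products of traces.\<close>

lemma nonzero_intertwiner:
  assumes V: "is_rep G (V :: ('g, 'k) rep)" and W: "is_rep G W"
    and nz: "(\<Sum>g\<in>carrier G. mtrace (snd W g) * mtrace (snd V (inv g))) \<noteq> 0"
  obtains T where "T \<in> carrier_mat (fst W) (fst V)" "T \<noteq> 0\<^sub>m (fst W) (fst V)"
    "\<And>s. s \<in> carrier G \<Longrightarrow> snd W s * T = T * snd V s"
proof -
  let ?n = "fst V" and ?m = "fst W"
  let ?T = "\<lambda>i j. matsum ?m ?n (carrier G) (\<lambda>g. snd W g * unit_mat ?m ?n i j * snd V (inv g))"
  have E: "unit_mat ?m ?n i j \<in> carrier_mat ?m ?n" for i j by (simp add: unit_mat_def)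
  have "\<exists>i<?m. \<exists>j<?n. ?T i j \<noteq> 0\<^sub>m ?m ?n"
  proof (rule ccontr)
    assume "\<not> ?thesis"
    then have z: "?T i j $$ (i, j) = 0" if "i < ?m" "j < ?n" for i j using that by simp
    have "(\<Sum>g\<in>carrier G. snd W g $$ (i, i) * snd V (inv g) $$ (j, j)) = 0" if "i < ?m" "j < ?n" for i j
    proof -
      have "(\<Sum>g\<in>carrier G. snd W g $$ (i, i) * snd V (inv g) $$ (j, j)) =
        (\<Sum>g\<in>carrier G. (snd W g * unit_mat ?m ?n i j * snd V (inv g)) $$ (i, j))"
        using that is_repD(1)[OF V] is_repD(1)[OF W]
        by (intro sum.cong refl unit_mat_sandwich[symmetric]) simp_all
      then show ?thesis using z[OF that] that by (simp add: matsum_index)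
    qed
    then have "0 = (\<Sum>i\<in>{0..<?m}. \<Sum>j\<in>{0..<?n}. \<Sum>g\<in>carrier G. snd W g $$ (i, i) * snd V (inv g) $$ (j, j))"
      by (simp add: sum.neutral)
    also have "\<dots> = (\<Sum>i\<in>{0..<?m}. \<Sum>g\<in>carrier G. \<Sum>j\<in>{0..<?n}. snd W g $$ (i, i) * snd V (inv g) $$ (j, j))"
      by (intro sum.cong refl sum.swap)
    also have "\<dots> = (\<Sum>g\<in>carrier G. \<Sum>i\<in>{0..<?m}. \<Sum>j\<in>{0..<?n}. snd W g $$ (i, i) * snd V (inv g) $$ (j, j))"
      by (rule sum.swap)
    also have "\<dots> = (\<Sum>g\<in>carrier G. mtrace (snd W g) * mtrace (snd V (inv g)))"
    proof (intro sum.cong refl)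
      fix g assume g: "g \<in> carrier G"
      have "dim_row (snd W g) = ?m" "dim_row (snd V (inv g)) = ?n"
        using is_repD(1)[OF V, of "inv g"] is_repD(1)[OF W g] g by auto
      then show "(\<Sum>i\<in>{0..<?m}. \<Sum>j\<in>{0..<?n}. snd W g $$ (i, i) * snd V (inv g) $$ (j, j)) =
          mtrace (snd W g) * mtrace (snd V (inv g))"
        by (simp add: mtrace_def sum_product)
    qed
    finally show False using nz by simp
  qed
  then obtain i j where "?T i j \<noteq> 0\<^sub>m ?m ?n" by blast
  then show ?thesis
    using that[of "?T i j"] averaged_intertwiner[OF V W E] by simp
qed

end

lemma four_block_inject:
  assumes "A \<in> carrier_mat p q" "A' \<in> carrier_mat p q" "B \<in> carrier_mat p k" "B' \<in> carrier_mat p k"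
    "C \<in> carrier_mat l q" "C' \<in> carrier_mat l q" "D \<in> carrier_mat l k" "D' \<in> carrier_mat l k"
    and eq: "four_block_mat A B C D = four_block_mat A' B' C' D'"
  shows "A = A'" "B = B'" "C = C'" "D = D'"
proof -
  have e: "four_block_mat A B C D $$ (i, j) = four_block_mat A' B' C' D' $$ (i, j)" for i j
    by (simp only: eq)
  show "A = A'"
  proof (rule eq_matI)
    fix i j assume "i < dim_row A'" "j < dim_col A'"
    then show "A $$ (i, j) = A' $$ (i, j)" using e[of i j] assms(1-8) by auto
  qed (use assms in auto)
  show "B = B'"
  proof (rule eq_matI)
    fix i j assume "i < dim_row B'" "j < dim_col B'"
    then show "B $$ (i, j) = B' $$ (i, j)" using e[of i "j + q"] assms(1-8) by auto
  qed (use assms in auto)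
  show "C = C'"
  proof (rule eq_matI)
    fix i j assume "i < dim_row C'" "j < dim_col C'"
    then show "C $$ (i, j) = C' $$ (i, j)" using e[of "i + p" j] assms(1-8) by auto
  qed (use assms in auto)
  show "D = D'"
  proof (rule eq_matI)
    fix i j assume "i < dim_row D'" "j < dim_col D'"
    then show "D $$ (i, j) = D' $$ (i, j)" using e[of "i + p" "j + q"] assms(1-8) by auto
  qed (use assms in auto)
qed

lemma inverse_pair_invertible: "inverse_pair n P P' \<Longrightarrow> invertible_mat P"
  using inverse_pairD[of n P P'] by (intro invertible_matI)

locale rep_theory_char0 = rep_theory G K
  for G :: "('g, 'b) monoid_scheme" (structure) and K :: "'k::field_char_0 itself" +
  assumes finite_G: "finite (carrier G)"
begin

text \<open>The off-diagonal blocks of a block triangular representation form a cocycle. Averaging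
$b(g) d(g)^{-1}$ writes it as a coboundary; this is Maschke's theorem for matrices.\<close>

lemma crossed_hom_split:
  assumes a: "is_rep G (p, a :: 'g \<Rightarrow> 'k mat)" and d: "is_rep G (q, d)"
    and b: "\<And>g. g \<in> carrier G \<Longrightarrow> b g \<in> carrier_mat p q"
    and crossed: "\<And>g h. g \<in> carrier G \<Longrightarrow> h \<in> carrier G \<Longrightarrow> b (g \<otimes> h) = a g * b h + b g * d h"
  obtains Y where "Y \<in> carrier_mat p q" "\<And>h. h \<in> carrier G \<Longrightarrow> Y * d h = a h * Y + b h"
proof -
  note a = is_repD[OF a, simplified] and d = is_repD[OF d, simplified]
  define F where "F g = b g * d (inv g)" for g
  define Z where "Z = matsum p q (carrier G) F"
  define N where "N = (of_nat (card (carrier G)) :: 'k)"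
  have N: "N \<noteq> 0" using finite_G one_closed by (auto simp: N_def card_eq_0_iff)
  have Fc: "F g \<in> carrier_mat p q" if "g \<in> carrier G" for g
    unfolding F_def using b[OF that] d(1)[OF inv_closed[OF that]] by (rule mult_carrier_mat)
  have Z: "Z \<in> carrier_mat p q" by (simp add: Z_def)
  have main: "Z * d h = a h * Z + N \<cdot>\<^sub>m b h" if h: "h \<in> carrier G" for h
  proof -
    have "Z * d h = matsum p q (carrier G) (\<lambda>g. F g * d h)"
      unfolding Z_def by (rule matsum_right[OF d(1)[OF h] Fc])
    also have "\<dots> = matsum p q (carrier G) (\<lambda>g. F (h \<otimes> g) * d h)"
      by (rule matsum_translate[OF h, symmetric])
    also have "\<dots> = matsum p q (carrier G) (\<lambda>g. a h * F g + b h)"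
    proof (rule matsum_cong)
      fix g assume g: "g \<in> carrier G"
      have gi: "d (inv g) \<in> carrier_mat q q" "d (inv (h \<otimes> g)) \<in> carrier_mat q q"
        using g h by (auto intro!: d(1))
      have "F (h \<otimes> g) * d h = b (h \<otimes> g) * (d (inv (h \<otimes> g)) * d h)"
        unfolding F_def using b[of "h \<otimes> g"] gi(2) d(1)[OF h] g h by (intro assoc_mult_mat) auto
      also have "d (inv (h \<otimes> g)) * d h = d (inv g)"
        using g h d(2)[of "inv (h \<otimes> g)" h] by (simp add: inv_mult_group m_assoc)
      also have "b (h \<otimes> g) * d (inv g) = a h * b g * d (inv g) + b h * d g * d (inv g)"
        unfolding crossed[OF h g]
        by (rule add_mult_distrib_mat[OF mult_carrier_mat[OF a(1)[OF h] b[OF g]] mult_carrier_mat[OF b[OF h] d(1)[OF g]] gi(1)])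
      also have "a h * b g * d (inv g) = a h * F g"
        unfolding F_def by (rule assoc_mult_mat[OF a(1)[OF h] b[OF g] gi(1)])
      also have "b h * d g * d (inv g) = b h"
      proof -
        have "d g * d (inv g) = 1\<^sub>m q" using d(2)[OF g inv_closed[OF g]] g d(3) by simp
        then show ?thesis
          using assoc_mult_mat[OF b[OF h] d(1)[OF g] gi(1)] right_mult_one_mat[OF b[OF h]] by simp
      qed
      finally show "F (h \<otimes> g) * d h = a h * F g + b h" .
    qed
    also have "\<dots> = matsum p q (carrier G) (\<lambda>g. a h * F g) + matsum p q (carrier G) (\<lambda>g. b h)"
      by (rule matsum_add) (use mult_carrier_mat[OF a(1)[OF h] Fc] b[OF h] in auto)
    also have "matsum p q (carrier G) (\<lambda>g. a h * F g) = a h * Z"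
      unfolding Z_def by (rule matsum_left[OF a(1)[OF h] Fc, symmetric])
    also have "matsum p q (carrier G) (\<lambda>g. b h) = N \<cdot>\<^sub>m b h"
      unfolding N_def by (rule matsum_const[OF b[OF h]])
    finally show ?thesis .
  qed
  show ?thesis
  proof (rule that[of "inverse N \<cdot>\<^sub>m Z"])
    fix h assume h: "h \<in> carrier G"
    have "inverse N \<cdot>\<^sub>m Z * d h = inverse N \<cdot>\<^sub>m (a h * Z + N \<cdot>\<^sub>m b h)"
      unfolding main[OF h, symmetric] by (rule mult_smult_assoc_mat[OF Z d(1)[OF h]])
    also have "\<dots> = inverse N \<cdot>\<^sub>m (a h * Z) + inverse N \<cdot>\<^sub>m (N \<cdot>\<^sub>m b h)"
      using a(1)[OF h] Z b[OF h] by (intro eq_matI) (auto simp: distrib_left)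
    also have "inverse N \<cdot>\<^sub>m (N \<cdot>\<^sub>m b h) = b h" using N by (intro eq_matI) (simp_all add: field_simps)
    also have "inverse N \<cdot>\<^sub>m (a h * Z) = a h * (inverse N \<cdot>\<^sub>m Z)"
      by (rule mult_smult_distrib[OF a(1)[OF h] Z, symmetric])
    finally show "inverse N \<cdot>\<^sub>m Z * d h = a h * (inverse N \<cdot>\<^sub>m Z) + b h" .
  qed (use Z in simp)
qed

lemma cls_conj:
  assumes V: "is_rep G (n, v :: 'g \<Rightarrow> 'k mat)" and P: "inverse_pair n P P'"
  shows "is_rep G (n, \<lambda>g. P * v g * P')" "cls (n, \<lambda>g. P * v g * P') = cls (n, v)"
proof -
  note v = is_repD[OF V, simplified] and P = inverse_pairD[OF P] and PP = P
  have c: "P * v g \<in> carrier_mat n n" if "g \<in> carrier G" for g using P(1) v(1)[OF that] by (rule mult_carrier_mat)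
  have canc: "P * v g * P' * P = P * v g" if "g \<in> carrier G" for g
    using assoc_mult_mat[OF c[OF that] P(2,1)] P(4) right_mult_one_mat[OF c[OF that]] by simp
  show rep: "is_rep G (n, \<lambda>g. P * v g * P')"
  proof (rule is_repI)
    fix g h assume g: "g \<in> carrier G" and h: "h \<in> carrier G"
    have "P * v g * P' * (P * v h * P') = P * v g * P' * (P * v h) * P'"
      using assoc_mult_mat[OF mult_carrier_mat[OF c[OF g] P(2)] c[OF h] P(2)] by simp
    also have "P * v g * P' * (P * v h) = P * v g * P' * P * v h"
      using assoc_mult_mat[OF mult_carrier_mat[OF c[OF g] P(2)] P(1) v(1)[OF h]] by simp
    also have "\<dots> = P * (v g * v h)"
      unfolding canc[OF g] by (rule assoc_mult_mat[OF P(1) v(1)[OF g] v(1)[OF h]])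
    finally show "P * v (g \<otimes> h) * P' = P * v g * P' * (P * v h * P')" by (simp add: v(2)[OF g h])
  next
    show "P * v \<one> * P' = 1\<^sub>m n" using P by (simp add: v(3))
  qed (use mult_carrier_mat[OF c P(2)] in simp)
  have "rep_iso G (n, v) (n, \<lambda>g. P * v g * P')"
    unfolding rep_iso_def using P(1) inverse_pair_invertible[OF PP] canc by auto
  then show "cls (n, \<lambda>g. P * v g * P') = cls (n, v)"
    using cls_iso[OF V rep] by simp
qed

text \<open>The cocycle of off-diagonal blocks is a coboundary, so a unipotent change of basis makes the
representation block diagonal.\<close>

lemma cls_upper_triangular:
  fixes a b d :: "'g \<Rightarrow> 'k mat"
  assumes V: "is_rep G (p + q, v)"
    and v: "\<And>g. g \<in> carrier G \<Longrightarrow> v g = four_block_mat (a g) (b g) (0\<^sub>m q p) (d g)"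
    and car: "\<And>g. g \<in> carrier G \<Longrightarrow> a g \<in> carrier_mat p p" "\<And>g. g \<in> carrier G \<Longrightarrow> b g \<in> carrier_mat p q"
      "\<And>g. g \<in> carrier G \<Longrightarrow> d g \<in> carrier_mat q q"
  shows "is_rep G (p, a)" "is_rep G (q, d)" "cls (p + q, v) = cls (p, a) \<oplus>\<^bsub>RR\<^esub> cls (q, d)"
proof -
  note V' = is_repD[OF V, simplified]
  have eqs: "a (g \<otimes> h) = a g * a h" "b (g \<otimes> h) = a g * b h + b g * d h" "d (g \<otimes> h) = d g * d h"
    if g: "g \<in> carrier G" and h: "h \<in> carrier G" for g h
  proof -
    note gc = car(1,2)[OF g] zero_carrier_mat car(3)[OF g] and hc = car(1,2)[OF h] zero_carrier_mat car(3)[OF h]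
    have e: "four_block_mat (a (g \<otimes> h)) (b (g \<otimes> h)) (0\<^sub>m q p) (d (g \<otimes> h)) =
      four_block_mat (a g * a h) (a g * b h + b g * d h) (0\<^sub>m q p) (d g * d h)"
      using V'(2)[OF g h] mult_four_block_mat[OF gc hc] gc hc v[OF g] v[OF h] v[of "g \<otimes> h"] g h by simp
    note i = four_block_inject[OF _ _ _ _ _ _ _ _ e, of p p q q]
    have cs: "a (g \<otimes> h) \<in> carrier_mat p p" "a g * a h \<in> carrier_mat p p" "b (g \<otimes> h) \<in> carrier_mat p q"
      "a g * b h + b g * d h \<in> carrier_mat p q" "(0\<^sub>m q p :: 'k mat) \<in> carrier_mat q p" "(0\<^sub>m q p :: 'k mat) \<in> carrier_mat q p"
      "d (g \<otimes> h) \<in> carrier_mat q q" "d g * d h \<in> carrier_mat q q"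
      using car g h by (auto intro!: mult_carrier_mat add_carrier_mat)
    show "a (g \<otimes> h) = a g * a h" by (rule i(1)) (rule cs)+
    show "b (g \<otimes> h) = a g * b h + b g * d h" by (rule i(2)) (rule cs)+
    show "d (g \<otimes> h) = d g * d h" by (rule i(4)) (rule cs)+
  qed
  have e: "four_block_mat (a \<one>) (b \<one>) (0\<^sub>m q p) (d \<one>) = four_block_mat (1\<^sub>m p) (0\<^sub>m p q) (0\<^sub>m q p) (1\<^sub>m q)"
    using V'(3) v[OF one_closed] by simp
  have one: "a \<one> = 1\<^sub>m p" "d \<one> = 1\<^sub>m q"
    using four_block_inject(1,4)[OF car(1)[OF one_closed] one_carrier_mat car(2)[OF one_closed] zero_carrier_mat
        zero_carrier_mat zero_carrier_mat car(3)[OF one_closed] one_carrier_mat e] by auto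
  show ra: "is_rep G (p, a)" by (rule is_repI) (use car(1) eqs(1) one(1) in auto)
  show rd: "is_rep G (q, d)" by (rule is_repI) (use car(3) eqs(3) one(2) in auto)
  obtain Y where Y: "Y \<in> carrier_mat p q" "\<And>h. h \<in> carrier G \<Longrightarrow> Y * d h = a h * Y + b h"
    using crossed_hom_split[OF ra rd car(2) eqs(2)] by blast
  let ?U = "\<lambda>Y. four_block_mat (1\<^sub>m p) Y (0\<^sub>m q p) (1\<^sub>m q)"
  have mY: "- Y \<in> carrier_mat p q" using Y(1) by simp
  have Um: "?U A * four_block_mat x y (0\<^sub>m q p) z = four_block_mat x (y + A * z) (0\<^sub>m q p) z"
    if "A \<in> carrier_mat p q" "x \<in> carrier_mat p p" "y \<in> carrier_mat p q" "z \<in> carrier_mat q q" for A x y z :: "'k mat"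
    using that by (subst mult_four_block_mat[OF one_carrier_mat that(1) zero_carrier_mat one_carrier_mat that(2,3) zero_carrier_mat that(4)]) simp
  have "rep_iso G (p + q, v) (rep_sum (p, a) (q, d))"
    unfolding rep_iso_def
  proof (intro conjI bexI ballI)
    show "fst (p + q, v) = fst (rep_sum (p, a) (q, d))" by (simp add: rep_sum_def)
    have inv: "Y + - Y = 0\<^sub>m p q" "- Y + Y = 0\<^sub>m p q" using Y(1) by (auto intro!: eq_matI)
    show "invertible_mat (?U (- Y))"
      using Um[OF mY one_carrier_mat Y(1) one_carrier_mat] Um[OF Y(1) one_carrier_mat mY one_carrier_mat] Y(1) mY inv
      by (intro invertible_matI[of _ "p + q" "?U Y"]) simp_all
    show "?U (- Y) \<in> carrier_mat (fst (p + q, v)) (fst (p + q, v))" by simp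
    fix g assume g: "g \<in> carrier G"
    note c = car[OF g]
    have "b g + - Y * d g = - (a g * Y)"
    proof -
      have "- Y * d g = - (a g * Y + b g)"
        unfolding Y(2)[OF g, symmetric] using Y(1) c(3) by (intro eq_matI) (auto simp: scalar_prod_def sum_negf)
      moreover have "a g * Y \<in> carrier_mat p q" using c(1) Y(1) by (rule mult_carrier_mat)
      moreover have "B + - (A + B) = - A" if "A \<in> carrier_mat p q" "B \<in> carrier_mat p q" for A B :: "'k mat"
        using that by (intro eq_matI) auto
      ultimately show ?thesis using c(2) by simp
    qed
    then have "?U (- Y) * v g = four_block_mat (a g) (- (a g * Y)) (0\<^sub>m q p) (d g)"
      using Um[OF mY c] v[OF g] by simp
    moreover have "four_block_mat (a g) (0\<^sub>m p q) (0\<^sub>m q p) (d g) * ?U (- Y) =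
        four_block_mat (a g) (- (a g * Y)) (0\<^sub>m q p) (d g)"
    proof -
      have "a g * - Y = - (a g * Y)" using c(1) Y(1) by (intro eq_matI) (auto simp: scalar_prod_def sum_negf)
      moreover have "- (a g * Y) \<in> carrier_mat p q" using mult_carrier_mat[OF c(1) Y(1)] by simp
      ultimately show ?thesis
        using c by (subst mult_four_block_mat[OF c(1) zero_carrier_mat zero_carrier_mat c(3) one_carrier_mat mY zero_carrier_mat one_carrier_mat])
          (simp add: left_mult_zero_mat[OF mY])
    qed
    ultimately show "?U (- Y) * snd (p + q, v) g = snd (rep_sum (p, a) (q, d)) g * ?U (- Y)"
      by (simp add: rep_sum_def)
  qed
  then have "cls (p + q, v) = cls (rep_sum (p, a) (q, d))"
    by (rule cls_iso[OF V is_rep_sum[OF ra rd]])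
  then show "cls (p + q, v) = cls (p, a) \<oplus>\<^bsub>RR\<^esub> cls (q, d)" using cls_sum[OF ra rd] by simp
qed

text \<open>Interchanging the two blocks of basis vectors reduces this to the upper triangular case.\<close>

lemma cls_lower_triangular:
  fixes a c d :: "'g \<Rightarrow> 'k mat"
  assumes V: "is_rep G (p + q, v)"
    and v: "\<And>g. g \<in> carrier G \<Longrightarrow> v g = four_block_mat (a g) (0\<^sub>m p q) (c g) (d g)"
    and car: "\<And>g. g \<in> carrier G \<Longrightarrow> a g \<in> carrier_mat p p" "\<And>g. g \<in> carrier G \<Longrightarrow> c g \<in> carrier_mat q p"
      "\<And>g. g \<in> carrier G \<Longrightarrow> d g \<in> carrier_mat q q"
  shows "is_rep G (p, a)" "is_rep G (q, d)" "cls (p + q, v) = cls (p, a) \<oplus>\<^bsub>RR\<^esub> cls (q, d)"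
proof -
  let ?S = "four_block_mat (0\<^sub>m q p) (1\<^sub>m q) (1\<^sub>m p) (0\<^sub>m p q) :: 'k mat"
  let ?S' = "four_block_mat (0\<^sub>m p q) (1\<^sub>m p) (1\<^sub>m q) (0\<^sub>m q p) :: 'k mat"
  have SS: "?S * ?S' = 1\<^sub>m (q + p)" "?S' * ?S = 1\<^sub>m (p + q)"
    by (subst mult_four_block_mat[OF zero_carrier_mat one_carrier_mat one_carrier_mat zero_carrier_mat
          zero_carrier_mat one_carrier_mat one_carrier_mat zero_carrier_mat], simp)+
  have S: "inverse_pair (q + p) ?S ?S'"
    unfolding inverse_pair_def
    using SS four_block_carrier_mat[of "0\<^sub>m q p :: 'k mat" q p "0\<^sub>m p q" p q]
      four_block_carrier_mat[of "0\<^sub>m p q :: 'k mat" p q "0\<^sub>m q p" q p] by (simp add: add.commute)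
  have V': "is_rep G (q + p, v)" using V by (simp add: add.commute)
  have sw: "?S * v g * ?S' = four_block_mat (d g) (c g) (0\<^sub>m p q) (a g)" if g: "g \<in> carrier G" for g
  proof -
    have "?S * v g = four_block_mat (c g) (d g) (a g) (0\<^sub>m p q)"
      unfolding v[OF g]
      by (subst mult_four_block_mat[OF zero_carrier_mat one_carrier_mat one_carrier_mat zero_carrier_mat
          car(1)[OF g] zero_carrier_mat car(2)[OF g] car(3)[OF g]])
        (simp add: left_mult_zero_mat[OF car(1)[OF g]] left_mult_zero_mat[OF car(2)[OF g]] left_mult_zero_mat[OF car(3)[OF g]]
          left_mult_one_mat[OF car(1)[OF g]] left_mult_one_mat[OF car(2)[OF g]] left_mult_one_mat[OF car(3)[OF g]]
          left_add_zero_mat[OF car(2)[OF g]] left_add_zero_mat[OF car(3)[OF g]] right_add_zero_mat[OF car(1)[OF g]])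
    also have "\<dots> * ?S' = four_block_mat (d g) (c g) (0\<^sub>m p q) (a g)"
      by (subst mult_four_block_mat[OF car(2)[OF g] car(3)[OF g] car(1)[OF g] zero_carrier_mat
          zero_carrier_mat one_carrier_mat one_carrier_mat zero_carrier_mat])
        (simp add: right_mult_zero_mat[OF car(1)[OF g]] right_mult_zero_mat[OF car(2)[OF g]] right_mult_zero_mat[OF car(3)[OF g]]
          right_mult_one_mat[OF car(1)[OF g]] right_mult_one_mat[OF car(2)[OF g]] right_mult_one_mat[OF car(3)[OF g]]
          left_add_zero_mat[OF car(3)[OF g]] right_add_zero_mat[OF car(2)[OF g]] right_add_zero_mat[OF car(1)[OF g]])
    finally show ?thesis .
  qed
  note up = cls_upper_triangular[OF cls_conj(1)[OF V' S] sw car(3,2,1)]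
  show "is_rep G (p, a)" "is_rep G (q, d)" using up(1,2) by simp_all
  then have "cls (p, a) \<in> carrier RR" "cls (q, d) \<in> carrier RR" by simp_all
  then show "cls (p + q, v) = cls (p, a) \<oplus>\<^bsub>RR\<^esub> cls (q, d)"
    using up(3) cls_conj(2)[OF V' S] abelian_monoid.a_comm[OF abelian_group.axioms(1)[OF ring.axioms(1)[OF RR_ring]]]
    by (simp add: add.commute)
qed

lemma trace_conj:
  assumes "inverse_pair n P P'" "A \<in> carrier_mat n n"
  shows "mtrace (P * A * P') = mtrace (A :: 'k mat)"
proof -
  note P = inverse_pairD[OF assms(1)]
  have "mtrace (P * A * P') = mtrace (P' * (P * A))"
    by (rule mtrace_comm[OF mult_carrier_mat[OF P(1) assms(2)] P(2)])
  also have "P' * (P * A) = A"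
    using assoc_mult_mat[OF P(2,1) assms(2)] P(4) assms(2) by simp
  finally show ?thesis .
qed

text \<open>Induction on the dimension. A nonzero intertwiner in rank normal form $D$ satisfies
$D V(g) = W(g) D$. This equation forces $V(g)$ to be block lower triangular and $W(g)$ to be
block upper triangular, with the same upper left block. The lower right blocks then have equal characters and smaller dimension.
The positivity hypothesis provides the intertwiner; over the complex numbers it is the positivity of
$\sum_g |\chi(g)|^2$.\<close>

theorem same_character_same_class:
  assumes pos: "\<And>V :: ('g, 'k) rep. is_rep G V \<Longrightarrow> fst V > 0 \<Longrightarrow>
      (\<Sum>g\<in>carrier G. mtrace (snd V g) * mtrace (snd V (inv g))) \<noteq> 0"
    and V: "is_rep G (V :: ('g, 'k) rep)" and W: "is_rep G W"
    and char: "\<And>g. g \<in> carrier G \<Longrightarrow> mtrace (snd V g) = mtrace (snd W g)"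
  shows "cls V = cls W"
  using V W char
proof (induction "fst V" arbitrary: V W rule: less_induct)
  case (less V W)
  note V = less.prems(1) and W = less.prems(2) and char = less.prems(3)
  obtain n v where Vv: "V = (n, v)" by (cases V)
  obtain n' w where Ww': "W = (n', w)" by (cases W)
  have "(of_nat n :: 'k) = of_nat n'"
    using char[OF one_closed] is_repD(3)[OF V] is_repD(3)[OF W] by (simp add: Vv Ww' mtrace_one)
  then have Ww: "W = (n, w)" using Ww' by simp
  note vd = is_repD[OF V, unfolded Vv, simplified] and wd = is_repD[OF W, unfolded Ww, simplified]
  show ?case
  proof (cases "n = 0")
    case True
    have "rep_iso G V W"
      unfolding rep_iso_def
    proof (intro conjI bexI[of _ "1\<^sub>m 0"] ballI)
      fix g assume "g \<in> carrier G"
      then show "1\<^sub>m 0 * snd V g = snd W g * 1\<^sub>m 0" using vd(1)[of g] wd(1)[of g] True by (intro eq_matI) (auto simp: Vv Ww)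
    qed (use True in \<open>auto simp: Vv Ww intro: invertible_matI[of _ 0 "1\<^sub>m 0"]\<close>)
    then show ?thesis by (rule cls_iso[OF V W])
  next
    case False
    have "(\<Sum>g\<in>carrier G. mtrace (snd W g) * mtrace (snd V (inv g))) =
        (\<Sum>g\<in>carrier G. mtrace (snd V g) * mtrace (snd V (inv g)))"
      using char by (intro sum.cong) simp_all
    also have "\<dots> \<noteq> 0" by (rule pos[OF V]) (use False in \<open>simp add: Vv\<close>)
    finally obtain T where T: "T \<in> carrier_mat n n" "T \<noteq> 0\<^sub>m n n" "\<And>s. s \<in> carrier G \<Longrightarrow> w s * T = T * v s"
      using nonzero_intertwiner[OF V W] unfolding Vv Ww by auto
    obtain P P' Q Q' r where PQ: "inverse_pair n P P'" "inverse_pair n Q Q'" "r \<le> n" "P * T * Q = rank_form n n r"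
      using rank_normal_form[OF T(1)] by (elim exE conjE)
    note P = inverse_pairD[OF PQ(1)] and Q = inverse_pairD[OF PQ(2)]
    have Q': "inverse_pair n Q' Q" using Q by (simp add: inverse_pair_def)
    have T_eq: "T = P' * (rank_form n n r) * Q'"
    proof -
      have "P' * (P * T * Q) * Q' = (P' * P) * T * (Q * Q')"
        by (rule two_sided_assoc[OF T(1) P(1,2) Q(1,2)])
      then show ?thesis using T(1) P(4) Q(3) PQ(4) by simp
    qed
    have r: "r > 0"
    proof (rule ccontr)
      assume "\<not> r > 0"
      then have "T = 0\<^sub>m n n" using T_eq P(2) Q(2) by (simp add: rank_form_0)
      then show False using T(2) by simp
    qed
    obtain q where n: "n = r + q" using PQ(3) le_Suc_ex by blast
    define v' where "v' g = Q' * v g * Q" for g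
    define w' where "w' g = P * w g * P'" for g
    have v'c: "v' g \<in> carrier_mat n n" and w'c: "w' g \<in> carrier_mat n n" if "g \<in> carrier G" for g
      unfolding v'_def w'_def using P Q vd(1)[OF that] wd(1)[OF that] by (auto intro!: mult_carrier_mat)
    note V' = cls_conj[OF V[unfolded Vv] Q', folded v'_def] and W' = cls_conj[OF W[unfolded Ww] PQ(1), folded w'_def]
    let ?D = "rank_form n n r :: 'k mat"
    have inter: "?D * v' g = w' g * ?D" if g: "g \<in> carrier G" for g
    proof -
      have PT: "P * T \<in> carrier_mat n n" using P(1) T(1) by (rule mult_carrier_mat)
      have "?D * v' g = P * T * (Q * (Q' * v g * Q))"
        unfolding PQ(4)[symmetric] v'_def
        by (rule assoc_mult_mat[OF PT Q(1) mult_carrier_mat[OF mult_carrier_mat[OF Q(2) vd(1)[OF g]] Q(1)]])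
      also have "Q * (Q' * v g * Q) = v g * Q"
        using assoc_mult_mat[OF Q(2) vd(1)[OF g] Q(1)] assoc_mult_mat[OF Q(1,2) mult_carrier_mat[OF vd(1)[OF g] Q(1)]]
          Q(3) left_mult_one_mat[OF mult_carrier_mat[OF vd(1)[OF g] Q(1)]] by simp
      also have "P * T * (v g * Q) = P * (T * v g) * Q"
        using assoc_mult_mat[OF PT vd(1)[OF g] Q(1)] assoc_mult_mat[OF P(1) T(1) vd(1)[OF g]] by simp
      also have "\<dots> = P * (w g * T) * Q" by (simp only: T(3)[OF g])
      also have "\<dots> = P * w g * (T * Q)"
        using assoc_mult_mat[OF P(1) wd(1)[OF g] T(1)] assoc_mult_mat[OF mult_carrier_mat[OF P(1) wd(1)[OF g]] T(1) Q(1)] by simp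
      also have "T * Q = P' * ?D"
        using assoc_mult_mat[OF P(2) P(1) mult_carrier_mat[OF T(1) Q(1)]] assoc_mult_mat[OF P(1) T(1) Q(1)] PQ(4) P(4)
          left_mult_one_mat[OF mult_carrier_mat[OF T(1) Q(1)]] by simp
      also have "P * w g * (P' * ?D) = w' g * ?D"
        unfolding w'_def
        by (rule assoc_mult_mat[OF mult_carrier_mat[OF P(1) wd(1)[OF g]] P(2), where n\<^sub>4 = n, symmetric])
          (simp add: rank_form_def)
      finally show ?thesis .
    qed
    define a where "a g = mat r r (\<lambda>(i, j). v' g $$ (i, j))" for g
    define c where "c g = mat q r (\<lambda>(i, j). v' g $$ (i + r, j))" for g
    define d where "d g = mat q q (\<lambda>(i, j). v' g $$ (i + r, j + r))" for g
    define b where "b g = mat r q (\<lambda>(i, j). w' g $$ (i, j + r))" for g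
    define d' where "d' g = mat q q (\<lambda>(i, j). w' g $$ (i + r, j + r))" for g
    have car: "a g \<in> carrier_mat r r" "c g \<in> carrier_mat q r" "d g \<in> carrier_mat q q" "b g \<in> carrier_mat r q"
      "d' g \<in> carrier_mat q q" for g by (simp_all add: a_def b_def c_def d_def d'_def)
    have entries: "i < r \<Longrightarrow> j < n \<Longrightarrow> v' g $$ (i, j) = (if j < r then w' g $$ (i, j) else 0)"
      "i < n \<Longrightarrow> j < r \<Longrightarrow> w' g $$ (i, j) = (if i < r then v' g $$ (i, j) else 0)" if g: "g \<in> carrier G" for g i j
    proof -
      have left: "(?D * v' g) $$ (i, j) = (if i < r then v' g $$ (i, j) else 0)" if "i < n" "j < n" for i j
      proof -
        have "(?D * v' g) $$ (i, j) = (\<Sum>l\<in>{0..<n}. ?D $$ (i, l) * v' g $$ (l, j))"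
          using that by (intro mat_mult_index_sum[OF _ v'c[OF g]]) (simp_all add: rank_form_def)
        also have "\<dots> = (\<Sum>l\<in>{0..<n}. if l = i then (if i < r then v' g $$ (i, j) else 0) else 0)"
          using that by (intro sum.cong) (auto simp: rank_form_def)
        finally show ?thesis using that by simp
      qed
      have right: "(w' g * ?D) $$ (i, j) = (if j < r then w' g $$ (i, j) else 0)" if "i < n" "j < n" for i j
      proof -
        have "(w' g * ?D) $$ (i, j) = (\<Sum>l\<in>{0..<n}. w' g $$ (i, l) * ?D $$ (l, j))"
          using that by (intro mat_mult_index_sum[OF w'c[OF g]]) (simp_all add: rank_form_def)
        also have "\<dots> = (\<Sum>l\<in>{0..<n}. if l = j then (if j < r then w' g $$ (i, j) else 0) else 0)"
          using that by (intro sum.cong) (auto simp: rank_form_def)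
        finally show ?thesis using that by simp
      qed
      have e: "(if i < r then v' g $$ (i, j) else 0) = (if j < r then w' g $$ (i, j) else 0)" if "i < n" "j < n" for i j
        using left[OF that] right[OF that] inter[OF g] by simp
      show "i < r \<Longrightarrow> j < n \<Longrightarrow> v' g $$ (i, j) = (if j < r then w' g $$ (i, j) else 0)"
        using e[of i j] PQ(3) by simp
      show "i < n \<Longrightarrow> j < r \<Longrightarrow> w' g $$ (i, j) = (if i < r then v' g $$ (i, j) else 0)"
        using e[of i j] PQ(3) by simp
    qed
    have v'_block: "v' g = four_block_mat (a g) (0\<^sub>m r q) (c g) (d g)" if g: "g \<in> carrier G" for g
      using v'c[OF g] entries(1)[OF g] by (intro eq_matI) (auto simp: a_def c_def d_def n)
    have w'_block: "w' g = four_block_mat (a g) (b g) (0\<^sub>m q r) (d' g)" if g: "g \<in> carrier G" for g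
      using w'c[OF g] entries(2)[OF g] by (intro eq_matI) (auto simp: a_def b_def d'_def n)
    note lo = cls_lower_triangular[OF V'(1)[unfolded n] v'_block car(1,2,3)]
      and up = cls_upper_triangular[OF W'(1)[unfolded n] w'_block car(1,4,5)]
    have "cls (q, d) = cls (q, d')"
    proof (rule less.hyps)
      show "fst (q, d) < fst V" using r by (simp add: Vv n)
      show "is_rep G (q, d)" "is_rep G (q, d')" using lo(2) up(2) by simp_all
      fix g assume g: "g \<in> carrier G"
      have "mtrace (a g) + mtrace (d g) = mtrace (v' g)"
        unfolding v'_block[OF g] by (rule mtrace_four_block[OF car(1,3), symmetric])
      also have "\<dots> = mtrace (v g)" unfolding v'_def by (rule trace_conj[OF Q' vd(1)[OF g]])
      also have "\<dots> = mtrace (w g)" using char[OF g] by (simp add: Vv Ww)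
      also have "\<dots> = mtrace (w' g)" unfolding w'_def by (rule trace_conj[OF PQ(1) wd(1)[OF g], symmetric])
      also have "\<dots> = mtrace (a g) + mtrace (d' g)"
        unfolding w'_block[OF g] by (rule mtrace_four_block[OF car(1,5)])
      finally show "mtrace (snd (q, d) g) = mtrace (snd (q, d') g)" by simp
    qed
    then show ?thesis using lo(3) up(3) V'(2) W'(2) by (simp add: Vv Ww n)
  qed
qed

end

section \<open>Values of complex characters\<close>

text \<open>The sequences $k \mapsto \sum_j c_j z^{jk}$ with integers $c_j$. For a root of unity $z$ these
are the sequences of values of virtual characters on the powers of a group element. Working with
the whole sequence, rather than with its value at 1, makes the substitution $k \mapsto qk$ available without any
Galois theory.\<close>

inductive_set exp_sums :: "complex \<Rightarrow> (nat \<Rightarrow> complex) set" for z where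
  single: "(\<lambda>k. (z ^ j) ^ k) \<in> exp_sums z"
| diff: "u \<in> exp_sums z \<Longrightarrow> v \<in> exp_sums z \<Longrightarrow> (\<lambda>k. u k - v k) \<in> exp_sums z"

lemma exp_sums_0: "(\<lambda>k. 0) \<in> exp_sums z"
  using exp_sums.diff[OF exp_sums.single[of z 0] exp_sums.single[of z 0]] by simp

lemma exp_sums_add: "u \<in> exp_sums z \<Longrightarrow> v \<in> exp_sums z \<Longrightarrow> (\<lambda>k. u k + v k) \<in> exp_sums z"
  using exp_sums.diff[OF _ exp_sums.diff[OF exp_sums_0], of u z v] by simp

lemma exp_sums_single_mult: "v \<in> exp_sums z \<Longrightarrow> (\<lambda>k. (z ^ j) ^ k * v k) \<in> exp_sums z"
proof (induction rule: exp_sums.induct)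
  case (single i)
  have "(\<lambda>k. (z ^ j) ^ k * (z ^ i) ^ k) = (\<lambda>k. (z ^ (j + i)) ^ k)"
    by (rule ext) (simp only: power_add power_mult_distrib)
  then show ?case using exp_sums.single[of z "j + i"] by metis
next
  case (diff u v)
  then show ?case using exp_sums.diff by (simp add: right_diff_distrib)
qed

lemma exp_sums_mult: "u \<in> exp_sums z \<Longrightarrow> v \<in> exp_sums z \<Longrightarrow> (\<lambda>k. u k * v k) \<in> exp_sums z"
proof (induction rule: exp_sums.induct)
  case (single j)
  then show ?case by (rule exp_sums_single_mult)
next
  case (diff u w)
  then show ?case using exp_sums.diff by (simp add: left_diff_distrib)
qed

lemma exp_sums_1: "(\<lambda>k. 1) \<in> exp_sums z"
proof -
  have "(\<lambda>k. 1) = (\<lambda>k. (z ^ 0) ^ k)" by (rule ext) simp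
  then show ?thesis using exp_sums.single[of z 0] by metis
qed

lemma exp_sums_power: "u \<in> exp_sums z \<Longrightarrow> (\<lambda>k. u k ^ n) \<in> exp_sums z"
  by (induction n) (simp_all add: exp_sums_1 exp_sums_mult)

lemma exp_sums_sum: "(\<And>i. i \<in> S \<Longrightarrow> u i \<in> exp_sums z) \<Longrightarrow> (\<lambda>k. \<Sum>i\<in>S. u i k) \<in> exp_sums z"
  by (induction S rule: infinite_finite_induct) (simp_all add: exp_sums_0 exp_sums_add)

lemma exp_sums_nat: "(\<lambda>k. of_nat n) \<in> exp_sums z"
  by (induction n) (simp_all add: exp_sums_0 exp_sums_1 exp_sums_add)

lemma exp_sums_dilate: "u \<in> exp_sums z \<Longrightarrow> (\<lambda>k. u (n * k)) \<in> exp_sums z"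
proof (induction rule: exp_sums.induct)
  case (single j)
  show ?case using exp_sums.single[of z "j * n"] by (simp add: power_mult)
next
  case (diff u v)
  show ?case using exp_sums.diff[OF diff.IH] .
qed

text \<open>In the ring of these sequences raising to the $q$-th power is additive modulo $q$, and it agrees
with the substitution $k \mapsto qk$ on the generators.\<close>

lemma exp_sums_frobenius:
  assumes "prime q" "u \<in> exp_sums z"
  obtains v where "v \<in> exp_sums z" "\<And>k. u (q * k) = u k ^ q + of_nat q * v k"
proof -
  have "\<exists>v\<in>exp_sums z. \<forall>k. u (q * k) = u k ^ q + of_nat q * v k"
    using assms(2)
  proof (induction rule: exp_sums.induct)
    case (single j)
    show ?case by (intro bexI[OF _ exp_sums_0]) (simp add: power_mult[symmetric] mult_ac)
  next
    case (diff u w)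
    then obtain v v' where v: "v \<in> exp_sums z" "\<And>k. u (q * k) = u k ^ q + of_nat q * v k"
      "v' \<in> exp_sums z" "\<And>k. w (q * k) = w k ^ q + of_nat q * v' k" by blast
    define a where "a k = u k - w k" for k
    have a: "a \<in> exp_sums z" unfolding a_def[abs_def] using diff.hyps by (rule exp_sums.diff)
    \<comment> \<open>the inner terms of the binomial expansion of $(a + w)^q$, divided by $q$\<close>
    define y where "y k = (\<Sum>i\<in>{1..<q}. of_nat ((q choose i) div q) * (a k ^ i * w k ^ (q - i)))" for k
    have y: "y \<in> exp_sums z" unfolding y_def[abs_def]
      by (intro exp_sums_sum exp_sums_mult exp_sums_nat exp_sums_power a diff.hyps)
    have bin: "u k ^ q = a k ^ q + w k ^ q + of_nat q * y k" for k
    proof -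
      have q: "q > 0" using assms(1) by (rule prime_gt_0_nat)
      have "u k = a k + w k" by (simp add: a_def)
      then have "u k ^ q = (\<Sum>i\<le>q. of_nat (q choose i) * a k ^ i * w k ^ (q - i))"
        by (simp add: binomial_ring)
      also have "{..q} = insert 0 (insert q {1..<q})" using q by auto
      also have "(\<Sum>i\<in>insert 0 (insert q {1..<q}). of_nat (q choose i) * a k ^ i * w k ^ (q - i)) =
        w k ^ q + (a k ^ q + (\<Sum>i\<in>{1..<q}. of_nat (q choose i) * a k ^ i * w k ^ (q - i)))"
        using q by simp
      also have "(\<Sum>i\<in>{1..<q}. of_nat (q choose i) * a k ^ i * w k ^ (q - i)) = of_nat q * y k"
        unfolding y_def sum_distrib_left
      proof (intro sum.cong refl)
        fix i assume "i \<in> {1..<q}"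
        then have "q dvd (q choose i)" using assms(1) by (intro dvd_choose_prime) auto
        then have "(of_nat (q choose i) :: complex) = of_nat q * of_nat ((q choose i) div q)"
          by (metis dvd_mult_div_cancel of_nat_mult)
        then show "of_nat (q choose i) * a k ^ i * w k ^ (q - i) =
            of_nat q * (of_nat ((q choose i) div q) * (a k ^ i * w k ^ (q - i)))" by (simp add: mult_ac)
      qed
      finally show ?thesis by simp
    qed
    have "(\<lambda>k. y k + v k - v' k) \<in> exp_sums z"
      by (intro exp_sums.diff exp_sums_add y v)
    moreover have "\<forall>k. u (q * k) - w (q * k) = (u k - w k) ^ q + of_nat q * (y k + v k - v' k)"
    proof
      fix k show "u (q * k) - w (q * k) = (u k - w k) ^ q + of_nat q * (y k + v k - v' k)"
        using v(2)[of k] v(4)[of k] bin[of k] by (simp add: a_def algebra_simps)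
    qed
    ultimately show ?case by (intro bexI[where x = "\<lambda>k. y k + v k - v' k"])
  qed
  then show ?thesis using that by blast
qed

lemma exp_sums_span:
  assumes "u \<in> exp_sums z" "z ^ n = 1" "n > 0"
  obtains c :: "nat \<Rightarrow> int" where "u 1 = (\<Sum>j\<in>{0..<n}. of_int (c j) * z ^ j)"
proof -
  have "\<exists>c :: nat \<Rightarrow> int. u 1 = (\<Sum>j\<in>{0..<n}. of_int (c j) * z ^ j)"
    using assms(1)
  proof (induction rule: exp_sums.induct)
    case (single j)
    have "z ^ j = z ^ (n * (j div n) + j mod n)" by simp
    also have "\<dots> = z ^ (j mod n)" unfolding power_add power_mult assms(2) by simp
    also have "\<dots> = (\<Sum>i\<in>{0..<n}. if i = j mod n then z ^ i else 0)" using assms(3) by simp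
    also have "\<dots> = (\<Sum>i\<in>{0..<n}. of_int (if i = j mod n then 1 else 0) * z ^ i)"
      by (intro sum.cong) auto
    finally show ?case by (intro exI[of _ "\<lambda>i. if i = j mod n then 1 else 0"]) simp
  next
    case (diff u v)
    then obtain c d :: "nat \<Rightarrow> int" where "u 1 = (\<Sum>j\<in>{0..<n}. of_int (c j) * z ^ j)"
      "v 1 = (\<Sum>j\<in>{0..<n}. of_int (d j) * z ^ j)" by blast
    then show ?case
      by (intro exI[of _ "\<lambda>j. c j - d j"]) (simp add: sum_subtractf[symmetric] left_diff_distrib)
  qed
  then show ?thesis using that by blast
qed

text \<open>Multiplication by the value at 1 maps the span of the powers of $z$ to itself, so this value is an
eigenvalue of an integer matrix.\<close>

lemma exp_sums_algebraic_int:
  assumes u: "u \<in> exp_sums z" and z: "z ^ n = 1" "n > 0"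
  shows "algebraic_int (u 1)"
proof -
  have "\<exists>c :: nat \<Rightarrow> int. z ^ i * u 1 = (\<Sum>j\<in>{0..<n}. of_int (c j) * z ^ j)" for i
  proof -
    obtain c :: "nat \<Rightarrow> int" where "(z ^ i) ^ 1 * u 1 = (\<Sum>j\<in>{0..<n}. of_int (c j) * z ^ j)"
      using exp_sums_span[OF exp_sums_single_mult[OF u] z] by blast
    then show ?thesis by auto
  qed
  then obtain c :: "nat \<Rightarrow> nat \<Rightarrow> int" where c: "\<And>i. z ^ i * u 1 = (\<Sum>j\<in>{0..<n}. of_int (c i j) * z ^ j)"
    by metis
  define A where "A = mat n n (\<lambda>(i, j). c i j)"
  let ?A = "map_mat of_int A :: complex mat"
  define v where "v = vec n (\<lambda>j. z ^ j)"
  have A: "A \<in> carrier_mat n n" "?A \<in> carrier_mat n n" by (auto simp: A_def)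
  have "eigenvector ?A v (u 1)"
    unfolding eigenvector_def
  proof (intro conjI)
    show "v \<in> carrier_vec (dim_row ?A)" by (simp add: v_def A_def)
    show "v \<noteq> 0\<^sub>v (dim_row ?A)"
    proof
      assume "v = 0\<^sub>v (dim_row ?A)"
      then have "v $ 0 = 0" using z(2) by (simp add: A_def)
      then show False using z(2) by (simp add: v_def)
    qed
    show "?A *\<^sub>v v = u 1 \<cdot>\<^sub>v v"
    proof (rule eq_vecI)
      fix i assume "i < dim_vec (u 1 \<cdot>\<^sub>v v)"
      then have i: "i < n" by (simp add: v_def)
      have "(?A *\<^sub>v v) $ i = (\<Sum>j\<in>{0..<n}. of_int (c i j) * z ^ j)"
        using i by (simp add: A_def v_def scalar_prod_def)
      also have "\<dots> = z ^ i * u 1" by (rule c[symmetric])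
      also have "\<dots> = (u 1 \<cdot>\<^sub>v v) $ i" using i by (simp add: v_def)
      finally show "(?A *\<^sub>v v) $ i = (u 1 \<cdot>\<^sub>v v) $ i" .
    qed (simp add: A_def v_def)
  qed
  then have "eigenvalue ?A (u 1)" unfolding eigenvalue_def by blast
  then have root: "poly (char_poly ?A) (u 1) = 0" using eigenvalue_root_char_poly[OF A(2)] by simp
  have "char_poly ?A = map_poly of_int (char_poly A)"
    by (rule of_int_hom.char_poly_hom[OF A(1)])
  then have "\<forall>i. coeff (char_poly ?A) i \<in> \<int>" by (simp add: coeff_map_poly)
  moreover have "lead_coeff (char_poly ?A) = 1" using degree_monic_char_poly[OF A(2)] by simp
  ultimately show ?thesis using root by (intro algebraic_int.intros)
qed

text \<open>The quotient of the difference by $q$ is an algebraic integer and rational, hence an integer.\<close>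

lemma exp_sums_prime_congruence:
  assumes u: "u \<in> exp_sums z" and z: "z ^ n = 1" "n > 0" and q: "prime q"
    and ab: "u 1 = of_int a" "u q = of_int b"
  shows "int q dvd b - a ^ q"
proof -
  obtain v where v: "v \<in> exp_sums z" "\<And>k. u (q * k) = u k ^ q + of_nat q * v k"
    using exp_sums_frobenius[OF q u] by blast
  have q0: "q > 0" using q by (rule prime_gt_0_nat)
  have eq: "of_nat q * v 1 = of_int (b - a ^ q)" using v(2)[of 1] ab by simp
  then have "v 1 = of_int (b - a ^ q) / of_nat q" using q0 by (simp add: field_simps)
  moreover have "of_int (b - a ^ q) / of_nat q \<in> (\<rat> :: complex set)"
    by (intro Rats_divide Rats_of_int Rats_of_nat)
  ultimately have "v 1 \<in> \<rat>" by simp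
  then have "v 1 \<in> \<int>" using rational_algebraic_int_is_int exp_sums_algebraic_int[OF v(1) z] by blast
  then obtain c where "v 1 = of_int c" by (auto elim: Ints_cases)
  then have "(of_int (int q * c) :: complex) = of_int (b - a ^ q)" using eq by simp
  then have "int q * c = b - a ^ q" using of_int_eq_iff by blast
  then show ?thesis by (metis dvd_triv_left)
qed

text \<open>For a prime $q$ not dividing $m$ the congruence $u_q \equiv u_1^q$ modulo $q$ distinguishes the
two possible values 0 and $m$. A general exponent is a product of such primes.\<close>

lemma two_valued_exp_sum_invariant:
  assumes u: "u \<in> exp_sums z" and z: "z ^ n = 1" "n > 0" and val: "\<And>k. u k = 0 \<or> u k = of_nat m"
    and K: "coprime K m" "K > 0"
  shows "u (K * k) = u k"
  using K
proof (induction K arbitrary: k rule: less_induct)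
  case (less K)
  show ?case
  proof (cases "K = 1")
    case False
    then obtain q where q: "prime q" "q dvd K" using prime_factor_nat by blast
    then obtain L where L: "K = q * L" by (auto elim: dvdE)
    have "q > 1" using q(1) by (rule prime_gt_1_nat)
    then have "L < K" "L > 0" "coprime L m" using less.prems L by (auto simp: coprime_mult_left_iff)
    then have IH: "u (L * k) = u k" by (intro less.IH)
    have nq: "\<not> q dvd m"
      using less.prems(1) q by (metis coprime_common_divisor_nat not_prime_1)
    define w where "w j = u (L * k * j)" for j
    have w: "w \<in> exp_sums z" unfolding w_def[abs_def] by (rule exp_sums_dilate[OF u])
    define x y where "x = (if w 1 = 0 then 0 else 1 :: int)" and "y = (if w q = 0 then 0 else 1 :: int)"
    have xy: "w 1 = of_int (int m * x)" "w q = of_int (int m * y)"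
      using val[of "L * k * 1"] val[of "L * k * q"] by (auto simp: x_def y_def w_def)
    have "int q dvd int m * y - (int m * x) ^ q"
      by (rule exp_sums_prime_congruence[OF w z q(1) xy])
    moreover have "\<not> q dvd m ^ q" using nq q(1) prime_dvd_power by blast
    then have "\<not> int q dvd int m" "\<not> int q dvd int m ^ q"
      using nq by (simp, metis of_nat_dvd_iff of_nat_power)
    moreover have "(0 :: int) ^ q = 0" using \<open>q > 1\<close> by simp
    ultimately have "x = y" by (auto simp: x_def y_def zero_power split: if_splits)
    then have "w q = w 1" using xy by simp
    then show ?thesis using IH by (simp add: w_def L mult_ac)
  qed simp
qed


lemma upper_triangular_mult:
  assumes A: "A \<in> carrier_mat n n" "upper_triangular A" and B: "B \<in> carrier_mat n n" "upper_triangular B"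
  shows "upper_triangular (A * B :: 'a::semiring_0 mat)" "i < n \<Longrightarrow> (A * B) $$ (i, i) = A $$ (i, i) * B $$ (i, i)"
proof -
  have A0: "A $$ (i, l) = 0" if "l < i" "i < n" for i l using A that by auto
  have B0: "B $$ (i, l) = 0" if "l < i" "i < n" for i l using B that by auto
  show "upper_triangular (A * B)"
  proof (rule upper_triangularI)
    fix i j assume "j < i" "i < dim_row (A * B)"
    then have ij: "j < i" "i < n" using A by auto
    have "A $$ (i, l) * B $$ (l, j) = 0" if "l < n" for l
      using A0[of l i] B0[of j l] ij that by (cases "l < i") auto
    then show "(A * B) $$ (i, j) = 0"
      using ij by (subst mat_mult_index_sum[OF A(1) B(1)]) (auto intro!: sum.neutral)
  qed
  assume i: "i < n"
  have "A $$ (i, l) * B $$ (l, i) = (if l = i then A $$ (i, i) * B $$ (i, i) else 0)" if "l < n" for l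
    using A0[of l i] B0[of i l] i that by (cases "l < i") auto
  then have "(A * B) $$ (i, i) = (\<Sum>l\<in>{0..<n}. if l = i then A $$ (i, i) * B $$ (i, i) else 0)"
    by (subst mat_mult_index_sum[OF A(1) B(1) i i]) (auto intro!: sum.cong)
  then show "(A * B) $$ (i, i) = A $$ (i, i) * B $$ (i, i)" using i by simp
qed

lemma upper_triangular_pow:
  assumes A: "A \<in> carrier_mat n n" "upper_triangular (A :: 'a::semiring_1 mat)"
  shows "upper_triangular (A ^\<^sub>m k)" "i < n \<Longrightarrow> (A ^\<^sub>m k) $$ (i, i) = (A $$ (i, i)) ^ k"
proof -
  have *: "upper_triangular (A ^\<^sub>m k) \<and> (\<forall>i<n. (A ^\<^sub>m k) $$ (i, i) = (A $$ (i, i)) ^ k)"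
  proof (induction k)
    case 0
    then show ?case using A by auto
  next
    case (Suc k)
    have "A ^\<^sub>m k \<in> carrier_mat n n" using A by simp
    from upper_triangular_mult[OF this _ A] Suc show ?case by (simp add: power_commutes)
  qed
  then show "upper_triangular (A ^\<^sub>m k)" "i < n \<Longrightarrow> (A ^\<^sub>m k) $$ (i, i) = (A $$ (i, i)) ^ k" by auto
qed

text \<open>After triangularization the diagonal entries of the powers are the powers of the diagonal
entries.\<close>

lemma finite_order_trace:
  fixes A :: "complex mat"
  assumes A: "A \<in> carrier_mat d d" "A ^\<^sub>m n = 1\<^sub>m d"
  obtains l where "\<And>i. i < d \<Longrightarrow> l i ^ n = 1" "\<And>k. mtrace (A ^\<^sub>m k) = (\<Sum>i\<in>{0..<d}. l i ^ k)"
proof -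
  obtain es where "char_poly A = (\<Prod>a\<leftarrow>es. [:- a, 1:])" using char_poly_factorized[OF A(1)] by blast
  then obtain B where B: "B \<in> carrier_mat d d" "upper_triangular B" "similar_mat A B"
    using schur_decomposition_exists[OF A(1)] by blast
  then obtain P Q where PQ: "similar_mat_wit A B P Q" unfolding similar_mat_def by blast
  then have PQc: "inverse_pair d P Q" using similar_mat_witD2[OF A(1) PQ] by (simp add: inverse_pair_def)
  note c = inverse_pairD[OF PQc]
  have pow: "A ^\<^sub>m k = P * B ^\<^sub>m k * Q" for k by (rule similar_mat_wit_pow_id[OF PQ])
  have Bk: "B ^\<^sub>m k \<in> carrier_mat d d" for k using B by simp
  have QP: "inverse_pair d Q P" using c by (simp add: inverse_pair_def)
  have tr: "mtrace (A ^\<^sub>m k) = (\<Sum>i\<in>{0..<d}. (B $$ (i, i)) ^ k)" for k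
  proof -
    have "mtrace (A ^\<^sub>m k) = mtrace (Q * (P * B ^\<^sub>m k))"
      unfolding pow by (rule mtrace_comm[OF mult_carrier_mat[OF c(1) Bk] c(2)])
    also have "Q * (P * B ^\<^sub>m k) = B ^\<^sub>m k"
      using assoc_mult_mat[OF c(2,1) Bk] c(4) left_mult_one_mat[OF Bk] by simp
    finally show ?thesis using upper_triangular_pow(2)[OF B(1,2)] Bk[of k] B(1) by (simp add: mtrace_def)
  qed
  have "B ^\<^sub>m n = 1\<^sub>m d"
  proof -
    have "Q * (P * B ^\<^sub>m n * Q) * P = (Q * P) * B ^\<^sub>m n * (Q * P)"
      by (rule two_sided_assoc[OF Bk c(1,2) c(2,1)])
    then have "B ^\<^sub>m n = Q * A ^\<^sub>m n * P" using c(4) left_mult_one_mat[OF Bk] right_mult_one_mat[OF Bk] by (simp add: pow)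
    then show ?thesis using A(2) c by simp
  qed
  then have "(B $$ (i, i)) ^ n = 1" if "i < d" for i
    using upper_triangular_pow(2)[OF B(1,2) that, of n] that by simp
  then show ?thesis using tr by (rule that)
qed

lemma root_of_unity_obtain:
  assumes "w ^ n = (1 :: complex)" "n > 0"
  obtains j where "w = cis (2 * pi / n) ^ j"
proof -
  have "w \<in> (\<lambda>k. cis (2 * pi * real k / real n)) ` {..<n}"
    using bij_betw_roots_unity[OF assms(2)] assms(1) by (auto simp: bij_betw_def)
  then obtain k where "w = cis (2 * pi * real k / real n)" by auto
  then have "w = cis (2 * pi / n) ^ k" by (simp add: DeMoivre mult.commute)
  then show ?thesis using that by blast
qed

lemma cis_root: "n > 0 \<Longrightarrow> cis (2 * pi / real n) ^ n = 1"
  by (simp add: DeMoivre)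

context group begin

lemma rep_pow:
  assumes V: "is_rep G (V :: ('a, 'k::field) rep)" and g: "g \<in> carrier G"
  shows "snd V (g [^] k) = snd V g ^\<^sub>m k"
proof (induction k)
  case 0
  then show ?case using is_repD(3)[OF V] is_repD(1)[OF V g] by simp
next
  case (Suc k)
  then show ?case using is_repD(2)[OF V nat_pow_closed[OF g] g] by simp
qed

lemma character_roots:
  assumes V: "is_rep G (V :: ('a, complex) rep)" and g: "g \<in> carrier G" and fin: "finite (carrier G)"
  shows "\<exists>l. (\<forall>i<fst V. l i ^ card (carrier G) = 1) \<and> (\<forall>k::nat. mtrace (snd V (g [^] k)) = (\<Sum>i\<in>{0..<fst V}. l i ^ k))"
proof -
  have "snd V g ^\<^sub>m card (carrier G) = 1\<^sub>m (fst V)"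
    using rep_pow[OF V g, of "card (carrier G)"] pow_order_eq_1[OF g, unfolded Coset.order_def] is_repD(3)[OF V] by simp
  then obtain l where "\<And>i. i < fst V \<Longrightarrow> l i ^ card (carrier G) = 1"
    "\<And>k. mtrace (snd V g ^\<^sub>m k) = (\<Sum>i\<in>{0..<fst V}. l i ^ k)"
    using finite_order_trace[OF is_repD(1)[OF V g]] by metis
  then show ?thesis unfolding rep_pow[OF V g] by (intro exI[of _ l]) simp
qed

lemma character_exp_sum:
  assumes V: "is_rep G (V :: ('a, complex) rep)" and g: "g \<in> carrier G" and fin: "finite (carrier G)"
  shows "(\<lambda>k. mtrace (snd V (g [^] k))) \<in> exp_sums (cis (2 * pi / card (carrier G)))"
proof -
  have n: "card (carrier G) > 0" using fin one_closed card_gt_0_iff by blast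
  obtain l where l: "\<And>i. i < fst V \<Longrightarrow> l i ^ card (carrier G) = 1"
    "\<And>k. mtrace (snd V (g [^] k)) = (\<Sum>i\<in>{0..<fst V}. l i ^ (k::nat))"
    using character_roots[OF V g fin] by auto
  have "\<exists>j. l i = cis (2 * pi / card (carrier G)) ^ j" if "i < fst V" for i
    by (rule root_of_unity_obtain[OF l(1)[OF that] n]) (rule exI)
  then have "\<exists>j. \<forall>i<fst V. l i = cis (2 * pi / card (carrier G)) ^ j i" by (intro choice) simp
  then obtain j where j: "\<And>i. i < fst V \<Longrightarrow> l i = cis (2 * pi / card (carrier G)) ^ j i" by blast
  then have "(\<lambda>k. l i ^ k) \<in> exp_sums (cis (2 * pi / card (carrier G)))" if "i < fst V" for i
    using exp_sums.single[of "cis (2 * pi / card (carrier G))" "j i"] by (simp only: j[OF that])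
  then show ?thesis unfolding l(2) by (intro exp_sums_sum) simp
qed

lemma character_inv:
  assumes V: "is_rep G (V :: ('a, complex) rep)" and g: "g \<in> carrier G" and fin: "finite (carrier G)"
  shows "mtrace (snd V (inv g)) = cnj (mtrace (snd V g))"
proof -
  have n: "card (carrier G) > 0" using fin one_closed card_gt_0_iff by blast
  obtain l where l: "\<And>i. i < fst V \<Longrightarrow> l i ^ card (carrier G) = 1"
    "\<And>k. mtrace (snd V (g [^] k)) = (\<Sum>i\<in>{0..<fst V}. l i ^ (k::nat))"
    using character_roots[OF V g fin] by auto
  have "g [^] (card (carrier G) - 1) \<otimes> g = \<one>"
    using nat_pow_Suc[of g "card (carrier G) - 1"] n pow_order_eq_1[OF g, unfolded Coset.order_def] by simp
  then have inv: "inv g = g [^] (card (carrier G) - 1)" using g by (intro inv_equality) simp_all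
  have "l i ^ (card (carrier G) - 1) = cnj (l i)" if "i < fst V" for i
  proof -
    have 1: "l i * l i ^ (card (carrier G) - 1) = 1"
      using l(1)[OF that] power_minus_mult[OF n, of "l i"] by (simp add: mult.commute)
    have "norm (l i) ^ card (carrier G) = 1" using arg_cong[OF l(1)[OF that], of norm] by (simp add: norm_power)
    then have "norm (l i) = 1" using n power_eq_imp_eq_base[of "norm (l i)" "card (carrier G)" 1] by simp
    then have "l i * cnj (l i) = 1" by (simp add: complex_norm_square[symmetric])
    then have "l i * l i ^ (card (carrier G) - 1) = l i * cnj (l i)" and "l i \<noteq> 0" using 1 by auto
    then show ?thesis by simp
  qed
  then have "mtrace (snd V (inv g)) = (\<Sum>i\<in>{0..<fst V}. cnj (l i))" unfolding inv l(2) by simp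
  also have "\<dots> = cnj (mtrace (snd V g))" using l(2)[of 1] g by (simp add: cnj_sum)
  finally show ?thesis .
qed

text \<open>The sum equals $\sum_g |\chi(g)|^2$, and its term at the identity is the square of the
dimension.\<close>

lemma character_norm_pos:
  assumes V: "is_rep G (V :: ('a, complex) rep)" and pos: "fst V > 0" and fin: "finite (carrier G)"
  shows "(\<Sum>g\<in>carrier G. mtrace (snd V g) * mtrace (snd V (inv g))) \<noteq> 0"
proof
  assume "(\<Sum>g\<in>carrier G. mtrace (snd V g) * mtrace (snd V (inv g))) = 0"
  moreover have "(\<Sum>g\<in>carrier G. mtrace (snd V g) * mtrace (snd V (inv g))) =
      of_real (\<Sum>g\<in>carrier G. (norm (mtrace (snd V g)))\<^sup>2)"
    using character_inv[OF V _ fin] by (simp add: complex_norm_square[symmetric])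
  ultimately have "(\<Sum>g\<in>carrier G. (norm (mtrace (snd V g)))\<^sup>2) = 0" by (simp only: of_real_eq_0_iff)
  then have "(norm (mtrace (snd V \<one>)))\<^sup>2 = 0" using fin by (simp add: sum_nonneg_eq_0_iff)
  then show False using pos is_repD(3)[OF V] by (simp add: mtrace_one)
qed

end

section \<open>Permutation representations on coset spaces\<close>

context group begin

text \<open>A permutation matrix has as many diagonal entries equal to 1 as the permutation has fixed
points.\<close>

lemma is_rep_permutation:
  fixes act :: "'a \<Rightarrow> 'x \<Rightarrow> 'x" and \<beta> :: "nat \<Rightarrow> 'x"
  assumes \<beta>: "bij_betw \<beta> {0..<n} S"
    and act: "\<And>g s. g \<in> carrier G \<Longrightarrow> s \<in> S \<Longrightarrow> act g s \<in> S"
      "\<And>g h s. g \<in> carrier G \<Longrightarrow> h \<in> carrier G \<Longrightarrow> s \<in> S \<Longrightarrow> act (g \<otimes> h) s = act g (act h s)"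
      "\<And>s. s \<in> S \<Longrightarrow> act \<one> s = s"
  defines "R \<equiv> \<lambda>g. mat n n (\<lambda>(i, j). if \<beta> i = act g (\<beta> j) then 1 else 0) :: 'k::field mat"
  shows "is_rep G (n, R)" "mtrace (R g) = of_nat (card {s \<in> S. act g s = s})"
proof -
  have inj: "\<beta> i = \<beta> j \<longleftrightarrow> i = j" if "i < n" "j < n" for i j
    using \<beta> that by (auto simp: bij_betw_def inj_on_def)
  have S: "\<beta> i \<in> S" if "i < n" for i using \<beta> that by (auto simp: bij_betw_def)
  show "is_rep G (n, R)"
  proof (rule is_repI)
    fix g h assume g: "g \<in> carrier G" and h: "h \<in> carrier G"
    show "R (g \<otimes> h) = R g * R h"
    proof (rule eq_matI)
      fix i j assume "i < dim_row (R g * R h)" "j < dim_col (R g * R h)"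
      then have ij: "i < n" "j < n" by (auto simp: R_def)
      obtain l where l: "l < n" "\<beta> l = act h (\<beta> j)"
        using act(1)[OF h S[OF ij(2)]] \<beta> unfolding bij_betw_def by (metis (no_types, lifting) atLeastLessThan_iff imageE)
      have "(R g * R h) $$ (i, j) = (\<Sum>k\<in>{0..<n}. R g $$ (i, k) * R h $$ (k, j))"
        by (rule mat_mult_index_sum[OF _ _ ij]) (simp_all add: R_def)
      also have "\<dots> = (\<Sum>k\<in>{0..<n}. if k = l then R g $$ (i, l) else 0)"
        using ij inj[OF _ l(1)] by (intro sum.cong) (auto simp: R_def l(2)[symmetric])
      also have "\<dots> = R g $$ (i, l)" using l(1) by simp
      also have "\<dots> = R (g \<otimes> h) $$ (i, j)"
        using ij l act(2)[OF g h S[OF ij(2)]] by (simp add: R_def)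
      finally show "R (g \<otimes> h) $$ (i, j) = (R g * R h) $$ (i, j)" by simp
    qed (simp_all add: R_def)
  next
    show "R \<one> = 1\<^sub>m n" by (rule eq_matI) (auto simp: R_def act(3) S inj)
  qed (simp add: R_def)
  have "mtrace (R g) = (\<Sum>i\<in>{0..<n}. if act g (\<beta> i) = \<beta> i then 1 else 0)"
    unfolding mtrace_def by (intro sum.cong) (auto simp: R_def)
  also have "\<dots> = (\<Sum>s\<in>S. if act g s = s then 1 else 0)"
    by (rule sum.reindex_bij_betw[OF \<beta>])
  also have "\<dots> = of_nat (card {s \<in> S. act g s = s})"
    using \<beta> bij_betw_finite[OF \<beta>] by (subst sum.inter_filter[symmetric]) simp_all
  finally show "mtrace (R g) = of_nat (card {s \<in> S. act g s = s})" .
qed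

definition fixed_cosets :: "'a set \<Rightarrow> 'a \<Rightarrow> nat" where
  "fixed_cosets H g = card {C \<in> rcosets H. C #> inv g = C}"

text \<open>Permutation matrices have entries 0 and 1, so they are fixed by every homomorphism of fields. This is
why the character is obtained from every subfield.\<close>

lemma coset_rep:
  assumes H: "subgroup H G" and fin: "finite (carrier G)"
  shows "\<exists>V :: ('a, 'k::field) rep. is_rep G V \<and>
    (\<forall>g (h :: 'k \<Rightarrow> 'l::field). field_hom h \<longrightarrow> mtrace (map_mat h (snd V g)) = of_nat (fixed_cosets H g))"
proof -
  have fc: "finite (rcosets H)" using fin unfolding rcosets_part_G[OF H, symmetric] by (rule finite_UnionD)
  obtain \<beta> where \<beta>: "bij_betw \<beta> {0..<card (rcosets H)} (rcosets H)" using ex_bij_betw_nat_finite[OF fc] by blast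
  have sub: "C \<subseteq> carrier G" if "C \<in> rcosets H" for C using rcosets_part_G[OF H] that by blast
  have Hs: "H \<subseteq> carrier G" using H by (rule subgroup.subset)
  have act1: "C #> inv g \<in> rcosets H" if gC: "g \<in> carrier G" "C \<in> rcosets H" for g C
  proof -
    obtain a where a: "a \<in> carrier G" "C = H #> a" using gC(2) unfolding RCOSETS_def by blast
    then have "C #> inv g = H #> (a \<otimes> inv g)" using coset_mult_assoc[OF Hs a(1) inv_closed[OF gC(1)]] by simp
    then show ?thesis using rcosetsI[OF Hs] a(1) gC(1) by simp
  qed
  have act2: "C #> inv (g \<otimes> h) = C #> inv h #> inv g" if "g \<in> carrier G" "h \<in> carrier G" "C \<in> rcosets H" for g h C
    using coset_mult_assoc[OF sub[OF that(3)], of "inv h" "inv g"] that by (simp add: inv_mult_group)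
  have act3: "C #> inv \<one> = C" if "C \<in> rcosets H" for C using sub[OF that] by simp
  note rep = is_rep_permutation[where act = "\<lambda>g C. C #> inv g", OF \<beta> act1 act2 act3]
  let ?V = "\<lambda>g. mat (card (rcosets H)) (card (rcosets H)) (\<lambda>(i, j). if \<beta> i = \<beta> j #> inv g then 1 else 0)"
  show ?thesis
  proof (intro exI[of _ "(card (rcosets H), ?V)"] conjI allI impI)
    show "is_rep G (card (rcosets H), ?V :: 'a \<Rightarrow> 'k mat)" by (rule rep(1))
    fix g and h :: "'k \<Rightarrow> 'l" assume "field_hom h"
    then interpret h: field_hom h .
    have "map_mat h (?V g) = ?V g" by (rule eq_matI) auto
    then show "mtrace (map_mat h (snd (card (rcosets H), ?V) g)) = of_nat (fixed_cosets H g)"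
      using rep(2)[of g, where ?'k = 'l] by (simp add: fixed_cosets_def)
  qed
qed

text \<open>The coset $Hy$ is fixed by $g$ if and only if $y g y^{-1}$ lies in $H$, and this condition depends only on the
coset of $y$.\<close>

lemma fixed_cosets_count:
  assumes H: "subgroup H G" and fin: "finite (carrier G)" and g: "g \<in> carrier G"
  shows "fixed_cosets H g * card H = card {y \<in> carrier G. y \<otimes> g \<otimes> inv y \<in> H}"
proof -
  let ?F = "{C \<in> rcosets H. C #> inv g = C}"
  have Hs: "H \<subseteq> carrier G" using H by (rule subgroup.subset)
  have fc: "finite (rcosets H)" using fin unfolding rcosets_part_G[OF H, symmetric] by (rule finite_UnionD)
  have fix_iff: "H #> y #> inv g = H #> y \<longleftrightarrow> y \<otimes> g \<otimes> inv y \<in> H" if y: "y \<in> carrier G" for y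
  proof -
    have "H #> y #> inv g = H #> (y \<otimes> inv g)" using coset_mult_assoc[OF Hs y inv_closed[OF g]] .
    also have "\<dots> = H #> y \<longleftrightarrow> y \<otimes> inv (y \<otimes> inv g) \<in> H"
    proof
      assume "H #> (y \<otimes> inv g) = H #> y"
      then have "y \<in> H #> (y \<otimes> inv g)" using rcos_self[OF y H] by simp
      then obtain k where k: "k \<in> H" "y = k \<otimes> (y \<otimes> inv g)" unfolding r_coset_def by blast
      have "k \<in> carrier G" using k(1) Hs by blast
      then have "y \<otimes> inv (y \<otimes> inv g) = k"
        using k(2) y g inv_solve_right'[of k y "y \<otimes> inv g"] by simp
      then show "y \<otimes> inv (y \<otimes> inv g) \<in> H" using k(1) by simp
    next
      assume a: "y \<otimes> inv (y \<otimes> inv g) \<in> H"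
      have "y = (y \<otimes> inv (y \<otimes> inv g)) \<otimes> (y \<otimes> inv g)" using y g by (simp add: m_assoc)
      then have "y \<in> H #> (y \<otimes> inv g)" using a unfolding r_coset_def by blast
      then show "H #> (y \<otimes> inv g) = H #> y" using repr_independence[OF _ _ H] y g by simp
    qed
    also have "y \<otimes> inv (y \<otimes> inv g) = y \<otimes> g \<otimes> inv y" using y g by (simp add: inv_mult_group m_assoc)
    finally show ?thesis .
  qed
  have un: "{y \<in> carrier G. y \<otimes> g \<otimes> inv y \<in> H} = \<Union>?F"
  proof (intro equalityI subsetI)
    fix y assume "y \<in> {y \<in> carrier G. y \<otimes> g \<otimes> inv y \<in> H}"
    then have y: "y \<in> carrier G" "H #> y #> inv g = H #> y" using fix_iff by auto
    then show "y \<in> \<Union>?F" using rcosetsI[OF Hs y(1)] rcos_self[OF y(1) H] by blast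
  next
    fix y assume "y \<in> \<Union>?F"
    then obtain C where C: "C \<in> rcosets H" "C #> inv g = C" "y \<in> C" by blast
    then have y: "y \<in> carrier G" using rcosets_part_G[OF H] by blast
    obtain a where a: "a \<in> carrier G" "C = H #> a" using C(1) unfolding RCOSETS_def by blast
    then have "C = H #> y" using repr_independence[OF _ a(1) H] C(3) by blast
    then show "y \<in> {y \<in> carrier G. y \<otimes> g \<otimes> inv y \<in> H}" using fix_iff[OF y] C(2) y by simp
  qed
  have "card H * card ?F = card (\<Union>?F)"
  proof (rule card_partition)
    show "finite ?F" using fc by simp
    show "finite (\<Union>?F)" unfolding un[symmetric] using fin by simp
    show "card C = card H" if "C \<in> ?F" for C using card_rcosets_equal[OF _ Hs, of C] that by simp
    show "C \<inter> D = {}" if "C \<in> ?F" "D \<in> ?F" "C \<noteq> D" for C D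
      using rcos_disjoint[OF H] that unfolding pairwise_def disjnt_def by blast
  qed
  then show ?thesis unfolding un fixed_cosets_def by (simp add: mult.commute)
qed

lemma finite_closed_subgroup:
  assumes fin: "finite (carrier G)" and S: "S \<subseteq> carrier G" "S \<noteq> {}"
    and closed: "\<And>a b. a \<in> S \<Longrightarrow> b \<in> S \<Longrightarrow> a \<otimes> b \<in> S"
  shows "subgroup S G"
proof (rule subgroupI[OF S])
  fix a assume a: "a \<in> S"
  then have ac: "a \<in> carrier G" using S by blast
  have pow: "a [^] Suc k \<in> S" for k :: nat
    by (induction k) (use a ac closed in auto)
  have n: "card (carrier G) > 0" using fin one_closed card_gt_0_iff by blast
  \<comment> \<open>twice the group order, so that the exponent stays positive in the trivial group\<close>
  have "a [^] (2 * card (carrier G) - 1) \<otimes> a = a [^] (2 * card (carrier G))"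
    using nat_pow_Suc[of a "2 * card (carrier G) - 1"] n by simp
  also have "\<dots> = (a [^] card (carrier G)) [^] (2::nat)" using nat_pow_pow[OF ac] by (simp add: mult.commute)
  also have "\<dots> = \<one>" using pow_order_eq_1[OF ac, unfolded Coset.order_def] by simp
  finally have "inv a = a [^] (2 * card (carrier G) - 1)" using ac by (intro inv_equality) simp_all
  also have "2 * card (carrier G) - 1 = Suc (2 * card (carrier G) - 2)" using n by simp
  finally show "inv a \<in> S" using pow by metis
qed (rule closed)

lemma conj_pow:
  assumes "g \<in> carrier G" "x \<in> carrier G"
  shows "g \<otimes> x [^] (k::nat) \<otimes> inv g = (g \<otimes> x \<otimes> inv g) [^] k"
proof (induction k)
  case (Suc k)
  have "g \<otimes> x [^] Suc k \<otimes> inv g = (g \<otimes> x [^] k \<otimes> inv g) \<otimes> (g \<otimes> x \<otimes> inv g)"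
    using assms by (simp add: m_assoc) (simp add: m_assoc[symmetric])
  then show ?case using Suc by simp
qed (use assms in simp)

end

section \<open>Separating elements modulo a prime\<close>

text \<open>Take $k + nt$, where $t$ is the product of the primes that divide $m$ but not $k$. A prime
divisor of $m$ divides exactly one of $k$ and $nt$, as $k$ and $n$ are coprime.\<close>

lemma coprime_representative:
  assumes "coprime k n" "(m::nat) > 0"
  obtains K where "coprime K m" "K > 0" "K mod n = k mod n"
proof (cases "k = 0")
  case True
  then have "n = 1" using assms(1) by simp
  then show ?thesis using that[of 1] by simp
next
  case False
  define t where "t = \<Prod>{q \<in> prime_factors m. \<not> q dvd k}"
  have "coprime (k + n * t) m"
  proof (rule ccontr)
    assume "\<not> coprime (k + n * t) m"
    then obtain q where "prime q" "q dvd gcd (k + n * t) m"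
      using prime_factor_nat by (metis coprime_iff_gcd_eq_1)
    then have q: "prime q" "q dvd k + n * t" "q dvd m" by simp_all
    have q_t: "q dvd t \<longleftrightarrow> \<not> q dvd k"
    proof
      assume "q dvd t"
      then have "\<exists>r\<in>{q \<in> prime_factors m. \<not> q dvd k}. q dvd r"
        unfolding t_def using q(1) by (subst (asm) prime_dvd_prod_iff) auto
      then obtain r where "r \<in> {q \<in> prime_factors m. \<not> q dvd k}" "q dvd r" by blast
      then show "\<not> q dvd k" using q(1) primes_dvd_imp_eq[of q r] by auto
    next
      assume "\<not> q dvd k"
      then have "q \<in> {q \<in> prime_factors m. \<not> q dvd k}"
        using q assms(2) by (simp add: in_prime_factors_iff)
      then show "q dvd t" unfolding t_def by (intro dvd_prodI[of _ _ "\<lambda>x. x", simplified]) auto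
    qed
    show False
    proof (cases "q dvd k")
      case True
      then have "q dvd n * t" using q(2) by (simp add: dvd_add_right_iff)
      then have "q dvd n" using q(1) q_t True by (simp add: prime_dvd_mult_iff)
      then have "q dvd 1" using assms(1) True by (metis coprime_common_divisor)
      then show False using q(1) by simp
    next
      case False
      then have "q dvd n * t" using q_t by simp
      then have "q dvd k" using q(2) by (simp add: dvd_add_left_iff)
      then show False using False by simp
    qed
  qed
  then show ?thesis using that[of "k + n * t"] False by simp
qed

context group begin

lemma pow_mod_ord:
  assumes "x \<in> carrier G"
  shows "x [^] (n mod ord x) = x [^] (n::nat)"
proof -
  have "x [^] n = x [^] (ord x * (n div ord x) + n mod ord x)" by simp
  also have "\<dots> = (x [^] ord x) [^] (n div ord x) \<otimes> x [^] (n mod ord x)"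
    using assms by (simp only: nat_pow_mult nat_pow_pow)
  finally show ?thesis using assms by simp
qed

text \<open>With $C = \langle x \rangle$, $N$ its normalizer, $Q$ a Sylow $p$-subgroup of $N$ and $H = CQ$,
every element of $H$ of order prime to $p$ lies in $C$, because $H/C$ is a $p$-group. Hence the elements that
conjugate $x$ into $H$ form $N$, and the number of fixed points of $x$ on $G/H$ is the index of $H$ in $N$,
which is prime to $p$. A conjugate of $y$ in $H$ would lie in $C$ and, having order at least
that of $x$, would generate $C$.\<close>

lemma p_regular_separation:
  assumes fin: "finite (carrier G)" and p: "prime (p::nat)" and x: "x \<in> carrier G" and y: "y \<in> carrier G"
    and ox: "coprime (ord x) p" and oy: "coprime (ord y) p" and le: "ord x \<le> ord y"
    and nconj: "\<And>g k. g \<in> carrier G \<Longrightarrow> coprime k (ord x) \<Longrightarrow> g \<otimes> y \<otimes> inv g \<noteq> x [^] (k::nat)"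
  obtains H where "subgroup H G" "\<not> p dvd fixed_cosets H x" "fixed_cosets H y = 0"
proof -
  define C where "C = range (\<lambda>k::nat. x [^] k)"
  define N where "N = {g \<in> carrier G. g \<otimes> x \<otimes> inv g \<in> C}"
  have Csub: "C \<subseteq> carrier G" using x by (auto simp: C_def)
  have Cpow: "c [^] (k::nat) \<in> C" if "c \<in> C" for c k
    using that x by (auto simp: C_def nat_pow_pow)
  have C: "subgroup C G"
  proof (rule finite_closed_subgroup[OF fin Csub])
    show "C \<noteq> {}" by (auto simp: C_def)
    show "a \<otimes> b \<in> C" if "a \<in> C" "b \<in> C" for a b
      using that x by (auto simp: C_def nat_pow_mult)
  qed
  have norm: "g \<otimes> c \<otimes> inv g \<in> C" if g: "g \<in> N" and c: "c \<in> C" for g c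
  proof -
    obtain k :: nat where "c = x [^] k" using c by (auto simp: C_def)
    then have "g \<otimes> c \<otimes> inv g = (g \<otimes> x \<otimes> inv g) [^] k" using g conj_pow[OF _ x] by (simp add: N_def)
    then show ?thesis using g Cpow by (simp add: N_def)
  qed
  have Nsub: "N \<subseteq> carrier G" by (auto simp: N_def)
  have xC: "x \<in> C" using x by (auto simp: C_def intro: range_eqI[of _ _ "1::nat"])
  have CN: "C \<subseteq> N"
  proof
    fix c assume c: "c \<in> C"
    then have "c \<otimes> x \<otimes> inv c \<in> C" using C xC by (simp add: subgroup.m_closed subgroup.m_inv_closed)
    then show "c \<in> N" using c Csub by (auto simp: N_def)
  qed
  have N: "subgroup N G"
  proof (rule finite_closed_subgroup[OF fin Nsub])
    show "N \<noteq> {}" using CN xC by blast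
    fix g h assume g: "g \<in> N" and h: "h \<in> N"
    then have gc: "g \<in> carrier G" "h \<in> carrier G" using Nsub by auto
    have "g \<otimes> (h \<otimes> x \<otimes> inv h) \<otimes> inv g \<in> C" using norm[OF g] h by (simp add: N_def)
    then show "g \<otimes> h \<in> N" using gc x by (simp add: N_def inv_mult_group m_assoc)
  qed
  have finN: "finite N" using fin Nsub by (rule rev_finite_subset)
  have cardN: "card N > 0" using finN CN xC card_gt_0_iff by blast
  let ?K = "G\<lparr>carrier := N\<rparr>"
  obtain a m where am: "card N = p ^ a * m" "\<not> p dvd m"
    using prime_power_canonical[OF p cardN] by (auto simp: mult.commute)
  have "\<exists>Q. subgroup Q ?K \<and> card Q = p ^ a"
    by (rule sylow_thm[OF p subgroup.subgroup_is_group[OF N group_axioms], of _ m])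
      (use am finN in \<open>simp_all add: Coset.order_def\<close>)
  then obtain Q where "subgroup Q ?K" and cQ: "card Q = p ^ a" by blast
  then have Q: "subgroup Q G" and QN: "Q \<subseteq> N"
    using incl_subgroup[OF N] subgroup.subset by fastforce+
  define H where "H = {c \<otimes> q |c q. c \<in> C \<and> q \<in> Q}"
  have Hsub: "H \<subseteq> carrier G" using Csub QN Nsub by (auto simp: H_def)
  have one: "\<one> \<in> C" "\<one> \<in> Q" using C Q by (auto simp: subgroup.one_closed)
  have CH: "C \<subseteq> H" and QH: "Q \<subseteq> H"
  proof -
    show "C \<subseteq> H"
    proof
      fix c assume "c \<in> C"
      then have "c = c \<otimes> \<one>" using Csub by auto
      then show "c \<in> H" using \<open>c \<in> C\<close> one unfolding H_def by blast
    qed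
    show "Q \<subseteq> H"
    proof
      fix q assume "q \<in> Q"
      then have "q = \<one> \<otimes> q" using QN Nsub by auto
      then show "q \<in> H" using \<open>q \<in> Q\<close> one unfolding H_def by blast
    qed
  qed
  \<comment> \<open>modulo $C$, multiplication in $H$ is multiplication in $Q$\<close>
  have mult_form: "\<exists>c'\<in>C. (c \<otimes> q) \<otimes> (d \<otimes> r) = c' \<otimes> (q \<otimes> r)" if "c \<in> C" "q \<in> Q" "d \<in> C" "r \<in> Q" for c q d r
  proof -
    have car: "c \<in> carrier G" "q \<in> carrier G" "d \<in> carrier G" "r \<in> carrier G" using that Csub QN Nsub by auto
    have qN: "q \<in> N" using that QN by auto
    have "(c \<otimes> q) \<otimes> (d \<otimes> r) = (c \<otimes> (q \<otimes> d \<otimes> inv q)) \<otimes> (q \<otimes> r)"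
      using car by (simp add: m_assoc) (simp add: m_assoc[symmetric])
    moreover have "c \<otimes> (q \<otimes> d \<otimes> inv q) \<in> C" by (rule subgroup.m_closed[OF C that(1) norm[OF qN that(3)]])
    ultimately show ?thesis by blast
  qed
  have H: "subgroup H G"
  proof (rule finite_closed_subgroup[OF fin Hsub])
    show "H \<noteq> {}" using CH one by blast
    fix u v assume "u \<in> H" "v \<in> H"
    then obtain c q d r where uv: "c \<in> C" "q \<in> Q" "u = c \<otimes> q" "d \<in> C" "r \<in> Q" "v = d \<otimes> r" unfolding H_def by blast
    then obtain c' where "c' \<in> C" "u \<otimes> v = c' \<otimes> (q \<otimes> r)" using mult_form by blast
    moreover have "q \<otimes> r \<in> Q" using uv Q by (simp add: subgroup.m_closed)
    ultimately show "u \<otimes> v \<in> H" unfolding H_def by blast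
  qed
  have p_regular: "w \<in> C" if w: "w \<in> H" and ow: "coprime (ord w) p" for w
  proof -
    obtain c q where cq: "c \<in> C" "q \<in> Q" "w = c \<otimes> q" using w unfolding H_def by blast
    have qc: "q \<in> carrier G" and wc: "w \<in> carrier G" using cq QN Nsub Hsub w by auto
    have qpow: "q [^] (k::nat) \<in> Q" for k by (induction k) (use one cq(2) subgroup.m_closed[OF Q] in auto)
    have "\<exists>c'\<in>C. w [^] (k::nat) = c' \<otimes> q [^] k" for k
    proof (induction k)
      case 0
      then show ?case using one by (intro bexI[of _ \<one>]) simp_all
    next
      case (Suc k)
      then obtain c' where c': "c' \<in> C" "w [^] k = c' \<otimes> q [^] k" by blast
      show ?case using mult_form[OF c'(1) qpow cq(1,2), of k] unfolding cq(3)[symmetric] c'(2)[symmetric] by simp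
    qed
    then obtain c' where c': "c' \<in> C" "w [^] (p ^ a) = c' \<otimes> q [^] (p ^ a)" by blast
    have "q [^] card Q = \<one>"
    proof -
      interpret Q: group "G\<lparr>carrier := Q\<rparr>" by (rule subgroup.subgroup_is_group[OF Q group_axioms])
      have "q [^]\<^bsub>G\<lparr>carrier := Q\<rparr>\<^esub> card Q = \<one>" using Q.pow_order_eq_1[of q] cq(2) by (simp add: Coset.order_def)
      then show ?thesis by (simp add: nat_pow_consistent[symmetric])
    qed
    then have wp: "w [^] (p ^ a) \<in> C" using c' cQ Csub by auto
    have "coprime (p ^ a) (ord w)" using ow by (simp add: coprime_commute)
    then obtain t where t: "[p ^ a * t = Suc 0] (mod ord w)" using cong_solve_coprime_nat by blast
    have "w [^] (p ^ a * t) = w [^] (1::nat)"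
      using t pow_mod_ord[OF wc, of "p ^ a * t"] pow_mod_ord[OF wc, of 1] by (simp add: cong_def)
    then have wt: "(w [^] (p ^ a)) [^] t = w" using wc by (simp add: nat_pow_pow)
    show ?thesis using Cpow[OF wp, of t] unfolding wt .
  qed
  have ord_conj: "ord (g \<otimes> z \<otimes> inv g) = ord z" if "g \<in> carrier G" "z \<in> carrier G" for g z
  proof (rule ord_unique[THEN iffD2, rule_format])
    show "g \<otimes> z \<otimes> inv g \<in> carrier G" using that by simp
    fix n :: nat
    have "(g \<otimes> z \<otimes> inv g) [^] n = \<one> \<longleftrightarrow> g \<otimes> z [^] n \<otimes> inv g = \<one>" using conj_pow[OF that] by simp
    also have "\<dots> \<longleftrightarrow> z [^] n = \<one>"
      using that inv_solve_right'[of \<one> "g \<otimes> z [^] n" g] by (simp add: l_cancel_one)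
    also have "\<dots> \<longleftrightarrow> ord z dvd n" using that(2) by (rule pow_eq_id)
    finally show "((g \<otimes> z \<otimes> inv g) [^] n = \<one>) = (ord z dvd n)" .
  qed
  have "{g \<in> carrier G. g \<otimes> x \<otimes> inv g \<in> H} = N"
  proof -
    have "g \<otimes> x \<otimes> inv g \<in> H \<longleftrightarrow> g \<otimes> x \<otimes> inv g \<in> C" if "g \<in> carrier G" for g
      using p_regular[of "g \<otimes> x \<otimes> inv g"] CH ord_conj[OF that x] ox by auto
    then show ?thesis by (auto simp: N_def)
  qed
  then have count: "fixed_cosets H x * card H = p ^ a * m" using fixed_cosets_count[OF H fin x] am(1) by simp
  have "p ^ a dvd card H"
  proof -
    interpret H: group "G\<lparr>carrier := H\<rparr>" by (rule subgroup.subgroup_is_group[OF H group_axioms])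
    have "subgroup Q (G\<lparr>carrier := H\<rparr>)" by (rule subgroup_incl[OF Q H QH])
    from H.lagrange[OF this] have "card H = p ^ a * card (rcosets\<^bsub>G\<lparr>carrier := H\<rparr>\<^esub> Q)"
      unfolding cQ Coset.order_def by (simp add: mult.commute)
    then show ?thesis by simp
  qed
  then obtain s where "card H = p ^ a * s" by (auto elim: dvdE)
  then have "fixed_cosets H x * s = m" using count prime_gt_0_nat[OF p] by (simp add: mult.left_commute)
  then have px: "\<not> p dvd fixed_cosets H x" using am(2) dvd_mult2 by blast
  have "{g \<in> carrier G. g \<otimes> y \<otimes> inv g \<in> H} = {}"
  proof (rule equals0I)
    fix g assume "g \<in> {g \<in> carrier G. g \<otimes> y \<otimes> inv g \<in> H}"
    then have g: "g \<in> carrier G" "g \<otimes> y \<otimes> inv g \<in> H" by auto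
    then have "g \<otimes> y \<otimes> inv g \<in> C" using p_regular ord_conj[OF g(1) y] oy by simp
    then obtain k :: nat where k: "g \<otimes> y \<otimes> inv g = x [^] k" by (auto simp: C_def)
    then have "ord (x [^] k) = ord y" using ord_conj[OF g(1) y] by simp
    moreover have "ord (x [^] k) dvd ord x"
    proof -
      have "(x [^] k) [^] ord x = (x [^] ord x) [^] k" using x by (simp only: nat_pow_pow mult.commute)
      then have "(x [^] k) [^] ord x = \<one>" using x by simp
      then show ?thesis using x by (simp add: pow_eq_id)
    qed
    moreover have "ord x > 0" using ord_ge_1[OF fin x] by simp
    ultimately have "ord (x [^] k) = ord x" using le dvd_imp_le[of "ord y" "ord x"] by simp
    then have "coprime k (ord x)" using pow_ord_eq_ord_iff[OF fin x] by simp
    then show False using nconj[OF g(1), of k] k by blast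
  qed
  then have "fixed_cosets H y * card H = 0" using fixed_cosets_count[OF H fin y] by (simp only: card.empty)
  moreover have "card H > 0" using subgroup.one_closed[OF H] finite_subset[OF Hsub fin] card_gt_0_iff by blast
  ultimately have "fixed_cosets H y = 0" by simp
  then show ?thesis using that[OF H px] by simp
qed

end

section \<open>Idempotents\<close>

context group begin

text \<open>The congruence $\chi(g^q) \equiv \chi(g)^q$ modulo $q$ for the permutation character.\<close>

lemma fixed_cosets_frobenius:
  assumes fin: "finite (carrier G)" and H: "subgroup H G" and g: "g \<in> carrier G" and q: "prime q"
  shows "q dvd fixed_cosets H (g [^] (q ^ b)) \<longleftrightarrow> q dvd fixed_cosets H g"
proof (induction b)
  case 0
  then show ?case using g by simp
next
  case (Suc b)
  obtain V :: "('a, complex) rep" where V: "is_rep G V"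
    and tr: "\<And>g (h :: complex \<Rightarrow> complex). field_hom h \<Longrightarrow> mtrace (map_mat h (snd V g)) = of_nat (fixed_cosets H g)"
    using coset_rep[OF H fin, where ?'k = complex and ?'l = complex] by blast
  have "field_hom (\<lambda>x :: complex. x)" by unfold_locales simp_all
  moreover have "map_mat (\<lambda>x. x) A = A" for A :: "complex mat" by (rule eq_matI) auto
  ultimately have trV: "mtrace (snd V g) = of_nat (fixed_cosets H g)" for g using tr by metis
  define y where "y = g [^] (q ^ b)"
  have y: "y \<in> carrier G" using g by (simp add: y_def)
  have n: "card (carrier G) > 0" using fin one_closed card_gt_0_iff by blast
  have "(\<lambda>k. of_nat (fixed_cosets H (y [^] k))) \<in> exp_sums (cis (2 * pi / card (carrier G)))"
    using character_exp_sum[OF V y fin] unfolding trV .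
  from exp_sums_prime_congruence[OF this cis_root[OF n] n q, of "int (fixed_cosets H y)" "int (fixed_cosets H (y [^] q))"]
  have d: "int q dvd int (fixed_cosets H (y [^] q)) - int (fixed_cosets H y) ^ q" using y by simp
  have q0: "q > 0" using q by (rule prime_gt_0_nat)
  have "int q dvd int (fixed_cosets H (y [^] q)) \<longleftrightarrow> int q dvd int (fixed_cosets H y) ^ q"
    using d by (metis diff_add_cancel dvd_add_right_iff)
  also have "\<dots> \<longleftrightarrow> q dvd fixed_cosets H y"
    using q q0 by (simp flip: of_nat_power add: prime_dvd_power_iff)
  finally have "q dvd fixed_cosets H (y [^] q) \<longleftrightarrow> q dvd fixed_cosets H y" by simp
  moreover have "y [^] q = g [^] (q ^ Suc b)" using g by (simp add: y_def nat_pow_pow mult.commute)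
  ultimately show ?case using Suc unfolding y_def by simp
qed

text \<open>Both elements are replaced by powers with exponents $p^b$ and $p^c$ whose orders are prime to $p$. This changes
neither the values of $f$ nor the divisibility by $p$ of numbers of fixed points. If a conjugate of $y$
were a generator $x^k$ of $\langle x \rangle$, then $k$ could be replaced by an exponent prime to
$m$, and $f(x) = f(y)$ would follow.\<close>

lemma separating_coset_space:
  assumes fin: "finite (carrier G)" and p: "prime p" "\<not> p dvd m"
    and conj: "\<And>g x. g \<in> carrier G \<Longrightarrow> x \<in> carrier G \<Longrightarrow> f (g \<otimes> x \<otimes> inv g) = f x"
    and pow: "\<And>x K. x \<in> carrier G \<Longrightarrow> coprime K m \<Longrightarrow> K > 0 \<Longrightarrow> f (x [^] (K::nat)) = f x"
    and xy: "x \<in> carrier G" "y \<in> carrier G" "f x \<noteq> f y"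
  obtains H where "subgroup H G" "(p dvd fixed_cosets H x) \<noteq> (p dvd fixed_cosets H y)"
proof -
  have m: "m > 0" using p(2) by (cases m) auto
  have part: "\<exists>b. coprime (ord (z [^] (p ^ b))) p" if z: "z \<in> carrier G" for z
  proof -
    have "ord z > 0" using ord_ge_1[OF fin z] by simp
    then obtain b r where br: "ord z = r * p ^ b" "\<not> p dvd r"
      using prime_power_canonical[OF p(1), of "ord z"] by blast
    have p0: "p ^ b \<noteq> 0" using prime_gt_0_nat[OF p(1)] by simp
    have "ord (z [^] (p ^ b)) = r" using ord_pow[OF z, of "p ^ b"] br(1) p0 by simp
    then show ?thesis using br(2) p(1) prime_imp_coprime[of p r] by (auto simp: coprime_commute)
  qed
  have fpow: "f (z [^] (p ^ b)) = f z" if "z \<in> carrier G" for z b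
    using pow[OF that, of "p ^ b"] p prime_gt_0_nat[OF p(1)] prime_imp_coprime[OF p(1)] by simp
  have one_sided: "\<exists>H. subgroup H G \<and> (p dvd fixed_cosets H x) \<noteq> (p dvd fixed_cosets H y)"
    if z: "x \<in> carrier G" "y \<in> carrier G" "f x \<noteq> f y" and b: "coprime (ord (x [^] (p ^ b))) p" "coprime (ord (y [^] (p ^ c))) p"
      and le: "ord (x [^] (p ^ b)) \<le> ord (y [^] (p ^ c))" for x y b c
  proof -
    let ?x = "x [^] (p ^ b)" and ?y = "y [^] (p ^ c)"
    have car: "?x \<in> carrier G" "?y \<in> carrier G" using z by auto
    have "g \<otimes> ?y \<otimes> inv g \<noteq> ?x [^] k" if g: "g \<in> carrier G" and k: "coprime k (ord ?x)" for g and k :: nat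
    proof
      assume eq: "g \<otimes> ?y \<otimes> inv g = ?x [^] k"
      obtain K where K: "coprime K m" "K > 0" "K mod ord ?x = k mod ord ?x"
        using coprime_representative[OF k m] by blast
      have "?x [^] k = ?x [^] K"
        using pow_mod_ord[OF car(1), of k] pow_mod_ord[OF car(1), of K] K(3) by simp
      then have "f (?x [^] k) = f ?x" using pow[OF car(1) K(1,2)] by simp
      then have "f ?y = f ?x" using conj[OF g car(2)] eq by simp
      then show False using fpow z by simp
    qed
    then obtain H where H: "subgroup H G" "\<not> p dvd fixed_cosets H ?x" "fixed_cosets H ?y = 0"
      using p_regular_separation[OF fin p(1) car b le] by blast
    then have "\<not> p dvd fixed_cosets H x" "p dvd fixed_cosets H y"
      using fixed_cosets_frobenius[OF fin H(1) z(1) p(1), of b] fixed_cosets_frobenius[OF fin H(1) z(2) p(1), of c] by simp_all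
    then show ?thesis using H(1) by blast
  qed
  obtain b c where bc: "coprime (ord (x [^] (p ^ b))) p" "coprime (ord (y [^] (p ^ c))) p"
    using part xy(1,2) by blast
  show ?thesis
  proof (cases "ord (x [^] (p ^ b)) \<le> ord (y [^] (p ^ c))")
    case True
    then show ?thesis using one_sided[OF xy bc] that by blast
  next
    case False
    then have "\<exists>H. subgroup H G \<and> (p dvd fixed_cosets H y) \<noteq> (p dvd fixed_cosets H x)"
      using xy by (intro one_sided[OF xy(2,1) _ bc(2,1)]) auto
    then show ?thesis using that by blast
  qed
qed

end

locale complex_extension = scalar_extension G K "TYPE(complex)" P h
  for G :: "('g, 'b) monoid_scheme" (structure) and K :: "'k::field_char_0 itself" and P and h :: "'k \<Rightarrow> complex" +
  assumes fin: "finite (carrier G)"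
begin

lemma loc_character_form:
  assumes "z \<in> carrier E.Loc.loc_ring"
  obtains V W m where "is_rep G V" "is_rep G W" "invertible_at P m"
    "z = E.Loc.tensor (E.cls V \<ominus>\<^bsub>E.RR\<^esub> E.cls W) (1 / of_nat m)"
    "\<And>g. g \<in> carrier G \<Longrightarrow> of_nat m * E.loc_character g z = mtrace (snd V g) - mtrace (snd W g)"
proof -
  obtain x m where x: "x \<in> carrier E.RR" "invertible_at P m" "z = E.Loc.tensor x (1 / of_nat m)"
    by (rule E.Loc.tensor_common_denominator[OF assms])
  obtain V W where VW: "is_rep G V" "is_rep G W" "x = E.cls V \<ominus>\<^bsub>E.RR\<^esub> E.cls W"
    by (rule E.rep_ring_difference[OF x(1)])
  have m: "m > 0" using x(2) by (simp add: invertible_at_def)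
  have "of_nat m * E.loc_character g z = mtrace (snd V g) - mtrace (snd W g)" if g: "g \<in> carrier G" for g
  proof -
    interpret c: ring_hom_ring E.RR "ring_of_type_algebra :: complex ring" "E.ring_character g" by (rule E.ring_character_hom[OF g])
    have "E.ring_character g x = E.ring_character g (E.cls V) - E.ring_character g (E.cls W)"
      using E.cls_closed[OF VW(1)] E.cls_closed[OF VW(2)] by (simp add: VW(3) a_minus_def)
    then show ?thesis
      using m by (simp add: x(3) E.loc_character_tensor[OF g x(1) Z_loc_inverse[OF x(2)]] E.ring_character_cls[OF g VW(1)]
          E.ring_character_cls[OF g VW(2)] of_rat_divide)
  qed
  then show ?thesis using that[OF VW(1,2) x(2)] x(3) VW(3) by blast
qed

text \<open>The denominator can be ignored: if $[V] - [W]$ has zero character, it is zero.\<close>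

lemma loc_character_injective:
  assumes "z \<in> carrier E.Loc.loc_ring" "\<And>g. g \<in> carrier G \<Longrightarrow> E.loc_character g z = 0"
  shows "z = \<zero>\<^bsub>E.Loc.loc_ring\<^esub>"
proof -
  interpret RR: ring E.RR by (rule E.RR_ring)
  interpret C: rep_theory_char0 G "TYPE(complex)" by unfold_locales (rule fin)
  obtain V W m where VW: "is_rep G V" "is_rep G W" "invertible_at P m"
    "z = E.Loc.tensor (E.cls V \<ominus>\<^bsub>E.RR\<^esub> E.cls W) (1 / of_nat m)"
    "\<And>g. g \<in> carrier G \<Longrightarrow> of_nat m * E.loc_character g z = mtrace (snd V g) - mtrace (snd W g)"
    using loc_character_form[OF assms(1)] by blast
  have "E.cls V = E.cls W"
    by (rule C.same_character_same_class[OF D.character_norm_pos[OF _ _ fin] VW(1,2)])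
      (use VW(5) assms(2) in \<open>simp_all\<close>)
  then have "E.cls V \<ominus>\<^bsub>E.RR\<^esub> E.cls W = \<zero>\<^bsub>E.RR\<^esub>"
    using E.cls_closed[OF VW(2)] by (simp add: a_minus_def RR.r_neg)
  then show ?thesis using VW(4) E.Loc.tensor_zero_left[OF Z_loc_inverse[OF VW(3)]] by simp
qed

lemma ext_characters_cong: "f \<in> ext_characters \<Longrightarrow> (\<And>g. g \<in> carrier G \<Longrightarrow> f g = f' g) \<Longrightarrow> f' \<in> ext_characters"
  unfolding ext_characters_def by simp

lemma ext_characters_int: "(\<lambda>_. of_int k) \<in> ext_characters"
proof -
  have "(of_int k :: rat) \<in> carrier (Z_loc P)"
  proof -
    have 1: "1 \<in> carrier (Z_loc P)" using ring.ring_simprules(6)[OF Z_loc_ring] by simp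
    have n: "of_nat n \<in> carrier (Z_loc P)" for n using D.Loc.of_nat_mult_closed[OF 1, of n] by simp
    show ?thesis
    proof (cases "k \<ge> 0")
      case True
      then show ?thesis using n[of "nat k"] by simp
    next
      case False
      then show ?thesis using D.Loc.Z_minus[OF n[of "nat (- k)"]] by simp
    qed
  qed
  from ext_characters_const[OF this] show ?thesis by simp
qed

lemma ext_characters_nat: "(\<lambda>_. of_nat n) \<in> ext_characters"
  using ext_characters_int[of "int n"] by simp

lemma ext_characters_prod: "(\<And>i. i \<in> S \<Longrightarrow> f i \<in> ext_characters) \<Longrightarrow> (\<lambda>g. \<Prod>i\<in>S. f i g) \<in> ext_characters"
proof (induction S rule: infinite_finite_induct)
  case (insert x S)
  then show ?case using ext_characters_mult[of "f x" "\<lambda>g. \<Prod>i\<in>S. f i g"] by simp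
qed (use ext_characters_int[of 1] in simp_all)

lemma ext_characters_diff: "f \<in> ext_characters \<Longrightarrow> f' \<in> ext_characters \<Longrightarrow> (\<lambda>g. f g - f' g) \<in> ext_characters"
  using ext_characters_add[OF _ ext_characters_minus, of f f'] by simp

lemma ext_characters_fixed_cosets:
  assumes "subgroup H G"
  shows "(\<lambda>g. of_nat (D.fixed_cosets H g)) \<in> ext_characters"
proof -
  obtain V :: "('g, 'k) rep" where V: "is_rep G V"
    and tr: "\<And>g (h :: 'k \<Rightarrow> complex). field_hom h \<Longrightarrow> mtrace (map_mat h (snd V g)) = of_nat (D.fixed_cosets H g)"
    using D.coset_rep[OF assms fin, where ?'k = 'k and ?'l = complex] by blast
  show ?thesis using ext_characters_rep[OF V] unfolding tr[OF h] .
qed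

text \<open>A multiplicative interpolation. For $x$ with $f(x) = 1$ the function
$k_x = \prod_y (\pi_{xy} - \pi_{xy}(y))$ over all $y$ with $f(y) = 0$, where $\pi_{xy}$ is a permutation
character that separates $x$ from $y$ modulo $p$, vanishes at these $y$, and its value at $x$ is prime to $p$. Then $l = \prod_x (k_x(x) - k_x)$ vanishes where $f$ is
1 and is equal to $r = \prod_x k_x(x)$ where $f$ is 0, so $r - l = r f$.\<close>

lemma multiple_in_ext_characters:
  fixes f :: "'g \<Rightarrow> complex"
  assumes two: "\<And>g. g \<in> carrier G \<Longrightarrow> f g = 0 \<or> f g = 1"
    and sep: "\<And>x y. x \<in> carrier G \<Longrightarrow> y \<in> carrier G \<Longrightarrow> f x \<noteq> f y \<Longrightarrow>
      \<exists>H. subgroup H G \<and> (p dvd D.fixed_cosets H x) \<noteq> (p dvd D.fixed_cosets H y)"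
    and p: "prime p"
  obtains r :: int where "\<not> int p dvd r" "(\<lambda>g. of_int r * f g) \<in> ext_characters"
proof -
  define S1 S0 where "S1 = {g \<in> carrier G. f g = 1}" and "S0 = {g \<in> carrier G. f g = 0}"
  have fin1: "finite S1" and fin0: "finite S0" using fin by (auto simp: S1_def S0_def)
  have "\<exists>H. subgroup H G \<and> (p dvd D.fixed_cosets H x) \<noteq> (p dvd D.fixed_cosets H y)" if "x \<in> S1" "y \<in> S0" for x y
    using sep[of x y] that by (auto simp: S1_def S0_def)
  then obtain H where H: "\<And>x y. x \<in> S1 \<Longrightarrow> y \<in> S0 \<Longrightarrow> subgroup (H x y) G"
    "\<And>x y. x \<in> S1 \<Longrightarrow> y \<in> S0 \<Longrightarrow> (p dvd D.fixed_cosets (H x y) x) \<noteq> (p dvd D.fixed_cosets (H x y) y)"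
    by metis
  define k where "k x g = (\<Prod>y\<in>S0. int (D.fixed_cosets (H x y) g) - int (D.fixed_cosets (H x y) y))" for x g
  define l where "l g = (\<Prod>x\<in>S1. k x x - k x g)" for g
  \<comment> \<open>the value of $l$ where $f$ is 0\<close>
  define r where "r = (\<Prod>x\<in>S1. k x x)"
  have k0: "k x y = 0" if "y \<in> S0" for x y
    unfolding k_def using fin0 that by (intro prod_zero) auto
  have ip: "prime (int p)" using p by simp
  have "\<not> int p dvd int (D.fixed_cosets (H x y) x) - int (D.fixed_cosets (H x y) y)" if "x \<in> S1" "y \<in> S0" for x y
  proof
    assume "int p dvd int (D.fixed_cosets (H x y) x) - int (D.fixed_cosets (H x y) y)"
    then have "int p dvd int (D.fixed_cosets (H x y) x) \<longleftrightarrow> int p dvd int (D.fixed_cosets (H x y) y)"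
      by (metis diff_add_cancel dvd_add_right_iff)
    then show False using H(2)[OF that] by simp
  qed
  then have "\<not> int p dvd k x x" if "x \<in> S1" for x
    unfolding k_def using ip fin0 that by (subst prime_dvd_prod_iff) auto
  then have r: "\<not> int p dvd r"
    unfolding r_def using ip fin1 by (subst prime_dvd_prod_iff) auto
  have kC: "(\<lambda>g. of_int (k x g)) \<in> ext_characters" if "x \<in> S1" for x
    unfolding k_def of_int_prod of_int_diff
    using ext_characters_fixed_cosets[OF H(1)[OF that]] ext_characters_nat
    by (intro ext_characters_prod ext_characters_diff) simp_all
  have lC: "(\<lambda>g. of_int (l g)) \<in> ext_characters"
    unfolding l_def of_int_prod of_int_diff
    using kC by (intro ext_characters_prod ext_characters_diff ext_characters_int)
  have "(\<lambda>g. of_int r - of_int (l g)) \<in> ext_characters" by (intro ext_characters_diff ext_characters_int lC)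
  then have "(\<lambda>g. of_int r * f g) \<in> ext_characters"
  proof (rule ext_characters_cong)
    fix g assume g: "g \<in> carrier G"
    show "of_int r - of_int (l g) = of_int r * f g"
    proof (cases "f g = 1")
      case True
      then have "g \<in> S1" using g by (simp add: S1_def)
      then have "l g = 0" unfolding l_def using fin1 by (intro prod_zero) auto
      then show ?thesis using True by simp
    next
      case False
      then have "f g = 0" "g \<in> S0" using two[OF g] g by (auto simp: S0_def)
      then show ?thesis by (simp add: l_def r_def k0)
    qed
  qed
  then show ?thesis using that r by blast
qed

text \<open>The character $f$ is invariant under conjugation and under powers prime to the denominator $m$,
so for each prime $p$ not dividing $m$ some multiple $r f$ with $r$ prime to $p$ is the character of an element of the
image. The least positive $d$ such that $d f$ is one divides all these $r$ and is
therefore invertible in $\mathbb{Z}_{(P)}$.\<close>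

theorem idempotent_in_ext_image:
  assumes e: "e \<in> carrier E.Loc.loc_ring" "e \<otimes>\<^bsub>E.Loc.loc_ring\<^esub> e = e" and P: "\<And>p. p \<in> P \<Longrightarrow> prime p"
  shows "e \<in> ext_image"
proof -
  interpret L: ring E.Loc.loc_ring by (rule E.Loc.loc_ring_is_ring)
  define f where "f g = E.loc_character g e" for g
  have two: "f g = 0 \<or> f g = 1" if "g \<in> carrier G" for g
  proof -
    have "f g * f g = f g" unfolding f_def using loc_character_ring_ops(2)[OF that e(1,1)] e(2) by simp
    then show ?thesis by (simp add: mult_cancel_right2)
  qed
  obtain V W m where VW: "is_rep G V" "is_rep G W" "invertible_at P m"
    and "e = E.Loc.tensor (E.cls V \<ominus>\<^bsub>E.RR\<^esub> E.cls W) (1 / of_nat m)"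
    and char: "\<And>g. g \<in> carrier G \<Longrightarrow> of_nat m * E.loc_character g e = mtrace (snd V g) - mtrace (snd W g)"
    using loc_character_form[OF e(1)] by blast
  have mf_eq: "of_nat m * f g = mtrace (snd V g) - mtrace (snd W g)" if "g \<in> carrier G" for g
    unfolding f_def by (rule char[OF that])
  have m: "m > 0" using VW(3) by (simp add: invertible_at_def)
  have mf: "f g = f g'" if "g \<in> carrier G" "g' \<in> carrier G" "mtrace (snd V g) - mtrace (snd W g) = mtrace (snd V g') - mtrace (snd W g')" for g g'
  proof -
    have "of_nat m * f g = of_nat m * f g'" using that mf_eq by simp
    then show ?thesis using m by simp
  qed
  have conj: "f (g \<otimes> x \<otimes> inv g) = f x" if g: "g \<in> carrier G" and x: "x \<in> carrier G" for g x
  proof (rule mf)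
    have "mtrace (snd U (g \<otimes> x \<otimes> inv g)) = mtrace (snd U x)" if U: "is_rep G U" for U :: "('g, complex) rep"
    proof -
      note u = D.is_repD[OF U]
      have i: "inv g \<in> carrier G" using g by simp
      have "mtrace (snd U (g \<otimes> x \<otimes> inv g)) = mtrace (snd U (g \<otimes> x) * snd U (inv g))" using u(2)[of "g \<otimes> x" "inv g"] g x by simp
      also have "\<dots> = mtrace (snd U (inv g) * snd U (g \<otimes> x))"
        by (rule mtrace_comm[OF u(1) u(1)]) (use g x in auto)
      also have "snd U (inv g) * snd U (g \<otimes> x) = snd U x" using u(2)[of "inv g" "g \<otimes> x"] g x by (simp add: D.m_assoc[symmetric])
      finally show ?thesis .
    qed
    then show "mtrace (snd V (g \<otimes> x \<otimes> inv g)) - mtrace (snd W (g \<otimes> x \<otimes> inv g)) = mtrace (snd V x) - mtrace (snd W x)"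
      using VW(1,2) by simp
  qed (use g x in auto)
  have pow: "f (x [^] K) = f x" if x: "x \<in> carrier G" and K: "coprime K m" "K > 0" for x and K :: nat
  proof -
    have n: "card (carrier G) > 0" using fin D.one_closed card_gt_0_iff by blast
    define u where "u k = mtrace (snd V (x [^] k)) - mtrace (snd W (x [^] k))" for k :: nat
    have u: "u \<in> exp_sums (cis (2 * pi / card (carrier G)))"
      unfolding u_def[abs_def]
      by (intro exp_sums.diff D.character_exp_sum VW(1,2) x fin)
    have "u k = of_nat m * f (x [^] k)" for k using mf_eq[of "x [^] k"] x by (simp add: u_def)
    then have "u k = 0 \<or> u k = of_nat m" for k using two[of "x [^] k"] x by auto
    from two_valued_exp_sum_invariant[OF u cis_root[OF n] n this K, of 1]
    show ?thesis using x by (intro mf) (simp_all add: u_def)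
  qed
  have multiple: "\<exists>r :: int. \<not> int p dvd r \<and> (\<lambda>g. of_int r * f g) \<in> ext_characters" if p: "prime p" "\<not> p dvd m" for p
  proof -
    have sep: "\<exists>H. subgroup H G \<and> (p dvd D.fixed_cosets H x) \<noteq> (p dvd D.fixed_cosets H y)"
      if "x \<in> carrier G" "y \<in> carrier G" "f x \<noteq> f y" for x y
      by (rule D.separating_coset_space[where f = f, OF fin p conj pow that]) blast+
    show ?thesis by (rule multiple_in_ext_characters[where f = f, OF two sep p(1)]) blast+
  qed
  define J where "J = {r :: int. (\<lambda>g. of_int r * f g) \<in> ext_characters}"
  have Jdiff: "r - s \<in> J" if "r \<in> J" "s \<in> J" for r s
    using ext_characters_diff[of "\<lambda>g. of_int r * f g" "\<lambda>g. of_int s * f g"] that by (simp add: J_def left_diff_distrib)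
  have Jmult: "k * r \<in> J" if "r \<in> J" for k r
    using ext_characters_mult[OF ext_characters_int[of k], of "\<lambda>g. of_int r * f g"] that by (simp add: J_def mult.assoc)
  have ex: "\<exists>d::nat. d > 0 \<and> int d \<in> J"
  proof -
    \<comment> \<open>some prime outside the divisors of $m$ is needed to know that the ideal is not zero, even if $P$ is empty\<close>
    obtain p where p: "prime p" "p > m" using bigger_prime by blast
    then have "\<not> p dvd m" using m by (auto dest: dvd_imp_le)
    then obtain r :: int where r: "\<not> int p dvd r" "r \<in> J" using multiple[OF p(1)] by (auto simp: J_def)
    then have "r \<noteq> 0" by auto
    moreover have "\<bar>r\<bar> \<in> J" using r(2) Jmult[OF r(2), of "- 1"] by (cases "r \<ge> 0") auto
    ultimately show ?thesis by (intro exI[of _ "nat \<bar>r\<bar>"]) simp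
  qed
  define d where "d = (LEAST d::nat. d > 0 \<and> int d \<in> J)"
  have d: "d > 0" "int d \<in> J" using LeastI_ex[OF ex] unfolding d_def by auto
  have d_dvd: "int d dvd r" if r: "r \<in> J" for r
  proof (rule ccontr)
    assume nd: "\<not> int d dvd r"
    have "r mod int d \<in> J" using Jdiff[OF r Jmult[OF d(2), of "r div int d"]] by (simp add: minus_div_mult_eq_mod)
    moreover have "r mod int d \<noteq> 0" using nd by (simp add: mod_eq_0_iff_dvd)
    then have "r mod int d > 0" using d(1) pos_mod_sign[of "int d" r] by linarith
    ultimately have "nat (r mod int d) > 0 \<and> int (nat (r mod int d)) \<in> J" by simp
    then have "d \<le> nat (r mod int d)" unfolding d_def by (rule Least_le)
    moreover have "nat (r mod int d) < d"
      using d(1) pos_mod_sign[of "int d" r] pos_mod_bound[of "int d" r] by (simp add: nat_less_iff)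
    ultimately show False by simp
  qed
  have "invertible_at P d"
    unfolding invertible_at_def
  proof (intro conjI ballI impI notI)
    show "d > 0" by (rule d(1))
    fix p assume p: "p \<in> P" "prime p" "p dvd d"
    have "\<not> p dvd m" using VW(3) p by (simp add: invertible_at_def)
    then obtain r :: int where r: "\<not> int p dvd r" "r \<in> J" using multiple[OF p(2)] by (auto simp: J_def)
    moreover have "int p dvd int d" using p(3) by simp
    ultimately show False using d_dvd[OF r(2)] dvd_trans by blast
  qed
  then have "(\<lambda>_. of_rat (1 / of_nat d)) \<in> ext_characters" by (intro ext_characters_const Z_loc_inverse)
  then have "(\<lambda>g. of_rat (1 / of_nat d) * (of_int (int d) * f g)) \<in> ext_characters"
    using d(2) unfolding J_def by (intro ext_characters_mult[of "\<lambda>_. of_rat (1 / of_nat d)"]) simp_all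
  then have "f \<in> ext_characters" by (rule ext_characters_cong) (use d(1) in \<open>simp add: of_rat_divide\<close>)
  then obtain z where z: "z \<in> ext_image" "\<And>g. g \<in> carrier G \<Longrightarrow> f g = E.loc_character g z" unfolding ext_characters_def by blast
  have zc: "z \<in> carrier E.Loc.loc_ring" using z(1) by (rule ext_image_sub)
  have "E.loc_character g (z \<ominus>\<^bsub>E.Loc.loc_ring\<^esub> e) = 0" if g: "g \<in> carrier G" for g
    unfolding a_minus_def loc_character_ring_ops(1)[OF g zc L.a_inv_closed[OF e(1)]] loc_character_ring_ops(3)[OF g e(1,1)]
    using z(2)[OF g] by (simp add: f_def)
  then have "z \<ominus>\<^bsub>E.Loc.loc_ring\<^esub> e = \<zero>\<^bsub>E.Loc.loc_ring\<^esub>" using zc e(1) by (intro loc_character_injective) auto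
  then have "z = e" using zc e(1) by (simp add: L.r_right_minus_eq)
  then show ?thesis using z(1) by simp
qed

end

text \<open>The first part is phrased for the record with a smaller carrier because that record has the same
zero, sum and product; its idempotents are the idempotents in the image.\<close>

lemma idempotents_in_image:
  fixes G :: "('g, 'b) monoid_scheme" and h :: "'k::field_char_0 \<Rightarrow> complex"
  assumes "group G" "finite (carrier G)" "\<And>p. p \<in> P \<Longrightarrow> prime p" "field_hom h"
  defines "S \<equiv> rep_ring_loc_ext G P h ` carrier (rep_ring_loc G P)"
  shows "idempotents (RU_loc G P) = idempotents (RU_loc G P \<lparr>carrier := S\<rparr>)"
    "idempotents (RU_loc G P) \<subseteq> S"
proof -
  interpret group G by fact
  interpret C: complex_extension G "TYPE('k)" P h
    by (intro complex_extension.intro scalar_extension.intro loc_rep_theory.intro rep_theory.intro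
        scalar_extension_axioms.intro complex_extension_axioms.intro) (fact assms group_axioms)+
  have S: "S = C.ext_image" unfolding S_def C.ext_image_def by (simp add: C.D.L_rep)
  have L: "RU_loc G P = C.E.Loc.loc_ring" by (simp add: RU_loc_def C.E.L_rep)
  have sub: "S \<subseteq> carrier (RU_loc G P)"
    unfolding S L using C.ext_image_sub by (rule subsetI)
  show le: "idempotents (RU_loc G P) \<subseteq> S"
  proof
    fix e assume "e \<in> idempotents (RU_loc G P)"
    then have e: "e \<in> carrier C.E.Loc.loc_ring" "e \<otimes>\<^bsub>C.E.Loc.loc_ring\<^esub> e = e"
      by (simp_all add: idempotents_def L)
    show "e \<in> S" unfolding S by (rule C.idempotent_in_ext_image[OF e assms(3)])
  qed
  show "idempotents (RU_loc G P) = idempotents (RU_loc G P \<lparr>carrier := S\<rparr>)"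
  proof (intro equalityI subsetI)
    fix e assume e: "e \<in> idempotents (RU_loc G P)"
    then show "e \<in> idempotents (RU_loc G P \<lparr>carrier := S\<rparr>)"
      using subsetD[OF le e] by (simp add: idempotents_def)
  next
    fix e assume e: "e \<in> idempotents (RU_loc G P \<lparr>carrier := S\<rparr>)"
    then show "e \<in> idempotents (RU_loc G P)"
      using subsetD[OF sub, of e] by (simp add: idempotents_def)
  qed
qed

lemma primitive_idempotents_cong:
  assumes "idempotents R = idempotents (R \<lparr>carrier := S\<rparr>)"
  shows "primitive_idempotents R = primitive_idempotents (R \<lparr>carrier := S\<rparr>)"
  using assms unfolding primitive_idempotents_def by simp

theorem corollary1p4:
  fixes G :: "('g, 'b) monoid_scheme" and P :: "nat set"
  assumes "group G" and "finite (carrier G)"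
    and "\<And>p. p \<in> P \<Longrightarrow> prime p"
  shows "primitive_idempotents (RU_loc G P) \<subseteq> RO_subring G P \<inter> RQ_subring G P
    \<and> primitive_idempotents (RU_loc G P) =
        primitive_idempotents (RU_loc G P \<lparr>carrier := RO_subring G P\<rparr>)
    \<and> primitive_idempotents (RU_loc G P) =
        primitive_idempotents (RU_loc G P \<lparr>carrier := RQ_subring G P\<rparr>)"
proof -
  have hR: "field_hom complex_of_real" by unfold_locales simp_all
  have hQ: "field_hom (of_rat :: rat \<Rightarrow> complex)" by unfold_locales (simp_all add: of_rat_add of_rat_mult)
  note R = idempotents_in_image[OF assms hR, folded RO_loc_def, folded RO_subring_def]
    and Q = idempotents_in_image[OF assms hQ, folded RQ_loc_def, folded RQ_subring_def]
  have "primitive_idempotents (RU_loc G P) \<subseteq> idempotents (RU_loc G P)"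
    by (auto simp: primitive_idempotents_def)
  then have "primitive_idempotents (RU_loc G P) \<subseteq> RO_subring G P \<inter> RQ_subring G P"
    using R(2) Q(2) by (simp add: subset_trans)
  then show ?thesis
    using primitive_idempotents_cong[OF R(1)] primitive_idempotents_cong[OF Q(1)] by (intro conjI)
qed

end
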